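(* Let $d>1$ be an integer and let $\sigma>2$. There is no singular solution $\psi(t,r)$ of the radially-symmetric nonlinear Schr\"odinger equation $$i\psi_t(t,r)+\psi_{rr}+\frac{d-1}{r}\psi_r+|\psi|^{2\sigma}\psi=0$$ with a finite singularity time $T_c$ such that $\psi\sim\psi_Q$ as $t\to T_c$, where $$\psi_Q(t,r)=\frac{1}{L^{1/\sigma}(t)}\,Q(\rho)\,e^{i\tau+i\alpha\frac{L_t}{4L}r^2+i(1-\alpha)\frac{L_t}{4L}(r-r_{\max}(t))^2},$$ $$\tau=\int_0^t\frac{ds}{L^2(s)},\qquad \rho=\frac{r-r_{\max}(t)}{L(t)},\qquad r_{\max}(t)=r_0L^{\alpha}(t),\qquad \alpha=\frac{2-\sigma}{\sigma(d-1)},$$ with $r_0>0$ and $\lim_{t\to T_c}L(t)=0$, and such that, for some constants $\kappa>0$ and $p\in\mathbb{R}$, as $t\to T_c$, $$L(t)\sim\kappa(T_c-t)^p,\qquad L_t\sim -p\,\kappa(T_c-t)^{p-1},\qquad L_{tt}\sim p(p-1)\,\kappa(T_c-t)^{p-2}.$$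
   Context: Here $r=|\mathbf{x}|$, $\mathbf{x}\in\mathbb{R}^d$. Singular at $T_c$ means $\lim_{t\to T_c}\|\psi(t)\|_{H^1}=\infty$, $0<T_c<\infty$. Solutions are understood to be sufficiently regular and localized on $[0,T_c)$: $\psi\in C([0,T_c);H^2(\mathbb{R}^d))\cap C^1([0,T_c);L^2(\mathbb{R}^d))$, $\psi$ is bounded on $[0,T]\times\mathbb{R}^d$ for each $T<T_c$, $|\mathbf{x}|\psi\in C([0,T_c);L^2(\mathbb{R}^d))$, and the power $\|\psi\|_2^2$ and the Hamiltonian $\|\nabla\psi\|_2^2-\frac{1}{\sigma+1}\|\psi\|_{2\sigma+2}^{2\sigma+2}$ are conserved. The function $L:[0,T_c)\to(0,\infty)$ is $C^2$. The self-similar profile $Q$ is a continuous function of $\rho$ alone (independent of $t$), not identically zero, and $|Q|$ attains its global maximum at $\rho=0$. The relation $\psi\sim\psi_Q$ refers to the ring region $|r-r_{\max}(t)|\le\rho_cL(t)$ for some constant $\rho_c>0$, and means $L^{1/\sigma}(t)\,\sup_{|r-r_{\max}(t)|\le\rho_cL(t)}|\psi(t,r)-\psi_Q(t,r)|\to0$ as $t\to T_c$. The asymptotic relations for $L$ mean $L/(T_c-t)^p\to\kappa$, $L_t/(T_c-t)^{p-1}\to-p\kappa$, and $L_{tt}/(T_c-t)^{p-2}\to p(p-1)\kappa$. *)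

theory Defs
  imports "HOL-Analysis.Analysis"
begin

text \<open>
  Elements of $L^2$ are represented by Borel functions. The number
  \<open>L2_norm f\<close> is meaningful only if \<open>in_L2 f\<close>.
\<close>

definition in_L2 :: "('a::euclidean_space \<Rightarrow> complex) \<Rightarrow> bool" where
  "in_L2 f \<longleftrightarrow>
     f \<in> borel_measurable lborel \<and> integrable lborel (\<lambda>x. (cmod (f x))\<^sup>2)"

definition L2_norm :: "('a::euclidean_space \<Rightarrow> complex) \<Rightarrow> real" where
  "L2_norm f = sqrt (\<integral>x. (cmod (f x))\<^sup>2 \<partial>lborel)"

definition locally_integrable :: "'a::euclidean_space set \<Rightarrow> ('a \<Rightarrow> complex) \<Rightarrow> bool" where
  "locally_integrable \<Omega> f \<longleftrightarrow>
     (\<forall>K. compact K \<and> K \<subseteq> \<Omega> \<longrightarrow> set_integrable lborel K f)"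

text \<open>
  Test functions for first-order weak derivatives are of class $C^1_c(\Omega)$
  (as, e.g., in Gilbarg and Trudinger); by mollification this gives the same weak
  derivatives as $C^\infty_c(\Omega)$. Second derivatives are iterated first derivatives.
\<close>

definition C1_test_function :: "'a::euclidean_space set \<Rightarrow> ('a \<Rightarrow> real) \<Rightarrow> bool" where
  "C1_test_function \<Omega> \<phi> \<longleftrightarrow>
     (\<forall>x. \<phi> differentiable (at x)) \<and>
     (\<forall>b\<in>Basis. continuous_on UNIV (\<lambda>x. frechet_derivative \<phi> (at x) b)) \<and>
     compact (closure {x. \<phi> x \<noteq> 0}) \<and> closure {x. \<phi> x \<noteq> 0} \<subseteq> \<Omega>"

definition has_weak_derivative ::
    "'a::euclidean_space set \<Rightarrow> 'a \<Rightarrow> ('a \<Rightarrow> complex) \<Rightarrow> ('a \<Rightarrow> complex) \<Rightarrow> bool" where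
  "has_weak_derivative \<Omega> b f g \<longleftrightarrow>
     locally_integrable \<Omega> f \<and> locally_integrable \<Omega> g \<and>
     (\<forall>\<phi>. C1_test_function \<Omega> \<phi> \<longrightarrow>
        (\<integral>x. frechet_derivative \<phi> (at x) b *\<^sub>R f x \<partial>lborel) =
        - (\<integral>x. \<phi> x *\<^sub>R g x \<partial>lborel))"

text \<open>
  A representative of the weak derivative on the whole space. It is unique up to null sets, so
  the definitions below do not depend on the choice; it is only used under
  hypotheses which guarantee that a weak derivative exists.
\<close>

definition weak_derivative :: "'a::euclidean_space \<Rightarrow> ('a \<Rightarrow> complex) \<Rightarrow> 'a \<Rightarrow> complex" where
  "weak_derivative b f = (SOME g. has_weak_derivative UNIV b f g)"

definition in_H1 :: "('a::euclidean_space \<Rightarrow> complex) \<Rightarrow> bool" where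
  "in_H1 f \<longleftrightarrow>
     in_L2 f \<and> (\<forall>b\<in>Basis. \<exists>g. has_weak_derivative UNIV b f g \<and> in_L2 g)"

definition in_H2 :: "('a::euclidean_space \<Rightarrow> complex) \<Rightarrow> bool" where
  "in_H2 f \<longleftrightarrow> in_H1 f \<and> (\<forall>b\<in>Basis. in_H1 (weak_derivative b f))"

definition gradient_norm_sq :: "('a::euclidean_space \<Rightarrow> complex) \<Rightarrow> real" where
  "gradient_norm_sq f = (\<Sum>b\<in>Basis. (L2_norm (weak_derivative b f))\<^sup>2)"

definition H1_norm :: "('a::euclidean_space \<Rightarrow> complex) \<Rightarrow> real" where
  "H1_norm f = sqrt ((L2_norm f)\<^sup>2 + gradient_norm_sq f)"

definition H2_norm :: "('a::euclidean_space \<Rightarrow> complex) \<Rightarrow> real" where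
  "H2_norm f =
     sqrt ((L2_norm f)\<^sup>2 + gradient_norm_sq f
           + (\<Sum>b\<in>Basis. gradient_norm_sq (weak_derivative b f)))"

definition L2_continuous_on :: "real set \<Rightarrow> (real \<Rightarrow> 'a::euclidean_space \<Rightarrow> complex) \<Rightarrow> bool" where
  "L2_continuous_on I F \<longleftrightarrow>
     (\<forall>t\<in>I. in_L2 (F t) \<and>
        ((\<lambda>s. L2_norm (\<lambda>x. F s x - F t x)) \<longlongrightarrow> 0) (at t within I))"

definition H2_continuous_on :: "real set \<Rightarrow> (real \<Rightarrow> 'a::euclidean_space \<Rightarrow> complex) \<Rightarrow> bool" where
  "H2_continuous_on I F \<longleftrightarrow>
     (\<forall>t\<in>I. in_H2 (F t) \<and>
        ((\<lambda>s. H2_norm (\<lambda>x. F s x - F t x)) \<longlongrightarrow> 0) (at t within I))"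

definition L2_C1_on ::
    "real set \<Rightarrow> (real \<Rightarrow> 'a::euclidean_space \<Rightarrow> complex) \<Rightarrow> (real \<Rightarrow> 'a \<Rightarrow> complex) \<Rightarrow> bool" where
  "L2_C1_on I F Ft \<longleftrightarrow>
     L2_continuous_on I F \<and> L2_continuous_on I Ft \<and>
     (\<forall>t\<in>I. ((\<lambda>s. L2_norm (\<lambda>x. (F s x - F t x) / of_real (s - t) - Ft t x)) \<longlongrightarrow> 0)
              (at t within I))"

definition radial_field :: "(real \<Rightarrow> real \<Rightarrow> complex) \<Rightarrow> real \<Rightarrow> real ^ 'd \<Rightarrow> complex" where
  "radial_field \<psi> t x = \<psi> t (norm x)"

definition nls_power :: "('a::euclidean_space \<Rightarrow> complex) \<Rightarrow> real" where
  "nls_power f = (L2_norm f)\<^sup>2"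

definition hamiltonian :: "real \<Rightarrow> ('a::euclidean_space \<Rightarrow> complex) \<Rightarrow> real" where
  "hamiltonian \<sigma> f =
     gradient_norm_sq f
     - 1 / (\<sigma> + 1) * (\<integral>x. cmod (f x) powr (2 * \<sigma> + 2) \<partial>lborel)"

text \<open>
  The equation at a fixed time, for the profile \<open>u\<close> and its time derivative \<open>ut\<close>. For a radial
  $H^2$ function the radial derivatives exist as weak derivatives on $(0,\infty)$.
\<close>

definition radial_NLS :: "nat \<Rightarrow> real \<Rightarrow> (real \<Rightarrow> complex) \<Rightarrow> (real \<Rightarrow> complex) \<Rightarrow> bool" where
  "radial_NLS d \<sigma> u ut \<longleftrightarrow>
     (\<exists>ur urr. has_weak_derivative {0<..} 1 u ur \<and> has_weak_derivative {0<..} 1 ur urr \<and>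
        (AE r in lborel. 0 < r \<longrightarrow>
           \<i> * ut r + urr r + of_real ((real d - 1) / r) * ur r
           + of_real (cmod (u r) powr (2 * \<sigma>)) * u r = 0))"

text \<open>
  Sufficiently regular and localized solutions on $[0,T_c)$. The type argument fixes the space
  \<open>real ^ 'd\<close>; the time derivative is, like the solution, given by its radial profile.
\<close>

definition radial_NLS_solution ::
    "'d::finite itself \<Rightarrow> real \<Rightarrow> real \<Rightarrow> (real \<Rightarrow> real \<Rightarrow> complex) \<Rightarrow> bool" where
  "radial_NLS_solution _ \<sigma> Tc \<psi> \<longleftrightarrow>
     (let \<Psi> = (radial_field \<psi> :: real \<Rightarrow> real ^ 'd \<Rightarrow> complex) in
      H2_continuous_on {0..<Tc} \<Psi> \<and>
      (\<exists>\<psi>t. L2_C1_on {0..<Tc} \<Psi> (radial_field \<psi>t) \<and>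
            (\<forall>t\<in>{0..<Tc}. radial_NLS CARD('d) \<sigma> (\<psi> t) (\<psi>t t))) \<and>
      (\<forall>T<Tc. \<exists>B. \<forall>t\<in>{0..T}. \<forall>x. cmod (\<Psi> t x) \<le> B) \<and>
      L2_continuous_on {0..<Tc} (\<lambda>t x. of_real (norm x) * \<Psi> t x) \<and>
      (\<forall>t\<in>{0..<Tc}. nls_power (\<Psi> t) = nls_power (\<Psi> 0)) \<and>
      (\<forall>t\<in>{0..<Tc}. hamiltonian \<sigma> (\<Psi> t) = hamiltonian \<sigma> (\<Psi> 0)))"

definition singular_at :: "real \<Rightarrow> (real \<Rightarrow> 'a::euclidean_space \<Rightarrow> complex) \<Rightarrow> bool" where
  "singular_at Tc \<Psi> \<longleftrightarrow> 0 < Tc \<and> filterlim (\<lambda>t. H1_norm (\<Psi> t)) at_top (at_left Tc)"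

definition ring_exponent :: "nat \<Rightarrow> real \<Rightarrow> real" where
  "ring_exponent d \<sigma> = (2 - \<sigma>) / (\<sigma> * (real d - 1))"

definition ring_radius :: "nat \<Rightarrow> real \<Rightarrow> real \<Rightarrow> (real \<Rightarrow> real) \<Rightarrow> real \<Rightarrow> real" where
  "ring_radius d \<sigma> r\<^sub>0 L t = r\<^sub>0 * L t powr ring_exponent d \<sigma>"

definition psi_Q ::
    "nat \<Rightarrow> real \<Rightarrow> (real \<Rightarrow> complex) \<Rightarrow> real \<Rightarrow> (real \<Rightarrow> real) \<Rightarrow> (real \<Rightarrow> real)
      \<Rightarrow> real \<Rightarrow> real \<Rightarrow> complex" where
  "psi_Q d \<sigma> Q r\<^sub>0 L L\<^sub>t t r =
     (let \<alpha> = ring_exponent d \<sigma>;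
          r\<^sub>m = ring_radius d \<sigma> r\<^sub>0 L t;
          \<tau> = integral {0..t} (\<lambda>s. 1 / (L s)\<^sup>2);
          \<rho> = (r - r\<^sub>m) / L t
      in of_real (1 / L t powr (1 / \<sigma>)) * Q \<rho> *
         exp (\<i> * of_real \<tau>
              + \<i> * of_real (\<alpha> * (L\<^sub>t t / (4 * L t)) * r\<^sup>2)
              + \<i> * of_real ((1 - \<alpha>) * (L\<^sub>t t / (4 * L t)) * (r - r\<^sub>m)\<^sup>2)))"

text \<open>
  The relation $\psi \sim \psi_Q$ as $t \to T_c$. For bounded profiles, as in the setting above,
  the supremum is over a bounded nonempty set of reals.
\<close>

definition ring_asymptotic ::
    "nat \<Rightarrow> real \<Rightarrow> real \<Rightarrow> (real \<Rightarrow> real \<Rightarrow> complex) \<Rightarrow> (real \<Rightarrow> complex) \<Rightarrow> real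
      \<Rightarrow> (real \<Rightarrow> real) \<Rightarrow> (real \<Rightarrow> real) \<Rightarrow> bool" where
  "ring_asymptotic d \<sigma> Tc \<psi> Q r\<^sub>0 L L\<^sub>t \<longleftrightarrow>
     (\<exists>\<rho>\<^sub>c>0. ((\<lambda>t. L t powr (1 / \<sigma>) *
          (SUP r \<in> {r. 0 \<le> r \<and> \<bar>r - ring_radius d \<sigma> r\<^sub>0 L t\<bar> \<le> \<rho>\<^sub>c * L t}.
             cmod (\<psi> t r - psi_Q d \<sigma> Q r\<^sub>0 L L\<^sub>t t r))) \<longlongrightarrow> 0) (at_left Tc))"

definition C2_width :: "real \<Rightarrow> (real \<Rightarrow> real) \<Rightarrow> (real \<Rightarrow> real) \<Rightarrow> (real \<Rightarrow> real) \<Rightarrow> bool" where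
  "C2_width Tc L L\<^sub>t L\<^sub>t\<^sub>t \<longleftrightarrow>
     (\<forall>t\<in>{0..<Tc}. 0 < L t \<and>
        (L has_real_derivative L\<^sub>t t) (at t within {0..<Tc}) \<and>
        (L\<^sub>t has_real_derivative L\<^sub>t\<^sub>t t) (at t within {0..<Tc})) \<and>
     continuous_on {0..<Tc} L\<^sub>t\<^sub>t"

definition admissible_profile :: "(real \<Rightarrow> complex) \<Rightarrow> bool" where
  "admissible_profile Q \<longleftrightarrow>
     continuous_on UNIV Q \<and> (\<exists>\<rho>. Q \<rho> \<noteq> 0) \<and> (\<forall>\<rho>. cmod (Q \<rho>) \<le> cmod (Q 0))"

end

theory Submission
  imports Defs
begin

text \<open>
  The obstruction is the variance $V(t) = \int |x|^2 |\psi(t,x)|^2 dx$.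

  On the one hand it stays bounded up to $T_c$. Formally $V' = 4 M$ with the radial momentum $M =
  \mathrm{Im} \int \bar\psi (x \cdot \nabla\psi)$, and the virial identity reads $M' = 2 H -
  \frac{\sigma d - 2}{\sigma + 1} \int |\psi|^{2\sigma+2}$ with the conserved Hamiltonian $H$.
  Since $\sigma d \ge 2$, this gives $V'' \le 8 H$, and $V$ is bounded on the finite interval
  $[0,T_c)$.

  On the other hand the ring pushes it to infinity. On the shell $r_{\max} \le r \le r_{\max} +
  \delta L$ the modulus of $\psi$ is at least a multiple of $L^{-1/\sigma}$, so the shell has mass
  at least a multiple of $r_{\max}^{d-1} \cdot L \cdot L^{-2/\sigma}$, and $\alpha$ is precisely
  the exponent for which this product does not depend on $t$ (\<open>ring_mass_scaling\<close>).
  Hence $V \ge c \, r_{\max}^2$ with a fixed $c > 0$. For $\sigma > 2$ the exponent $\alpha$ is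
  negative, so $L \to 0$ forces $r_{\max} = r_0 L^\alpha \to \infty$, a contradiction.

  The work lies in the virial identity at the regularity at hand. A radial solution is reduced to
  a profile on $(0,\infty)$ that is $C^1$ with absolutely continuous derivative
  (\<open>weak_derivative_ac\<close>, \<open>radial_NLS_regular\<close>), where integration by
  parts is the product rule \<open>ac_pos_mult\<close> together with the vanishing of boundary
  terms, \<open>zero_flux\<close>. The multipliers $r$ and $r^2$ are truncated at a radius $R$;
  the truncated quantities are differentiable in time by $L^2$ difference quotients
  (\<open>momentum_deriv\<close>, \<open>variance_deriv\<close>), and the truncation errors are of
  order $1/R$ on each time interval $[0,T]$ with $T < T_c$ (\<open>virial_inequality\<close>), so
  that $R \to \infty$ yields \<open>variance_bounded\<close>. The conserved Hamiltonian enters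
  through the inequality \<open>radial_derivative_L2\<close> between the radial derivative and the
  full gradient.
\<close>

section \<open>Square-integrable functions\<close>

definition sq_int :: "'a measure \<Rightarrow> ('a \<Rightarrow> complex) \<Rightarrow> bool" where
  "sq_int M f \<longleftrightarrow> f \<in> borel_measurable M \<and> integrable M (\<lambda>x. (cmod (f x))\<^sup>2)"

definition sq_norm :: "'a measure \<Rightarrow> ('a \<Rightarrow> complex) \<Rightarrow> real" where
  "sq_norm M f = (\<integral>x. (cmod (f x))\<^sup>2 \<partial>M)"

lemma sq_int_measurable [measurable_dest]: "sq_int M f \<Longrightarrow> f \<in> borel_measurable M"
  by (simp add: sq_int_def)

lemma sq_norm_nonneg [simp]: "0 \<le> sq_norm M f"
  by (simp add: sq_norm_def)

lemma sq_int_bound: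
  assumes "sq_int M f" "g \<in> borel_measurable M" "AE x in M. cmod (g x) \<le> C * cmod (f x)"
  shows "sq_int M g"
  unfolding sq_int_def
proof
  show "integrable M (\<lambda>x. (cmod (g x))\<^sup>2)"
  proof (rule Bochner_Integration.integrable_bound)
    show "integrable M (\<lambda>x. C\<^sup>2 * (cmod (f x))\<^sup>2)" using assms(1) by (simp add: sq_int_def)
    show "(\<lambda>x. (cmod (g x))\<^sup>2) \<in> borel_measurable M" using assms(2) by measurable
    show "AE x in M. norm ((cmod (g x))\<^sup>2) \<le> norm (C\<^sup>2 * (cmod (f x))\<^sup>2)"
      using assms(3)
    proof eventually_elim
      case (elim x)
      hence "(cmod (g x))\<^sup>2 \<le> (C * cmod (f x))\<^sup>2" by (intro power_mono) auto
      thus ?case by (simp add: power_mult_distrib)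
    qed
  qed
qed (use assms in auto)

lemma sq_norm_bound:
  assumes "sq_int M f" "g \<in> borel_measurable M" "AE x in M. cmod (g x) \<le> C * cmod (f x)"
  shows "sq_norm M g \<le> C\<^sup>2 * sq_norm M f"
proof -
  have "sq_norm M g \<le> (\<integral>x. C\<^sup>2 * (cmod (f x))\<^sup>2 \<partial>M)"
    unfolding sq_norm_def
  proof (rule integral_mono_AE)
    show "integrable M (\<lambda>x. (cmod (g x))\<^sup>2)" using sq_int_bound[OF assms] by (simp add: sq_int_def)
    show "integrable M (\<lambda>x. C\<^sup>2 * (cmod (f x))\<^sup>2)" using assms(1) by (simp add: sq_int_def)
    show "AE x in M. (cmod (g x))\<^sup>2 \<le> C\<^sup>2 * (cmod (f x))\<^sup>2"
      using assms(3)
    proof eventually_elim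
      case (elim x)
      hence "(cmod (g x))\<^sup>2 \<le> (C * cmod (f x))\<^sup>2" by (intro power_mono) auto
      thus ?case by (simp add: power_mult_distrib)
    qed
  qed
  thus ?thesis by (simp add: sq_norm_def)
qed

lemma cmod_add_sq_le: "(cmod (a + b))\<^sup>2 \<le> 2 * (cmod a)\<^sup>2 + 2 * (cmod b)\<^sup>2"
proof -
  have "(cmod (a + b))\<^sup>2 \<le> (cmod a + cmod b)\<^sup>2" by (intro power_mono norm_triangle_ineq) auto
  also have "\<dots> \<le> 2 * (cmod a)\<^sup>2 + 2 * (cmod b)\<^sup>2"
    using sum_squares_bound[of "cmod a" "cmod b"] by (simp add: power2_sum)
  finally show ?thesis .
qed

lemma sq_int_add: 
  assumes "sq_int M f" "sq_int M g" shows "sq_int M (\<lambda>x. f x + g x)"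
  unfolding sq_int_def
proof
  note [measurable] = assms
  show "(\<lambda>x. f x + g x) \<in> borel_measurable M" by measurable
  show "integrable M (\<lambda>x. (cmod (f x + g x))\<^sup>2)"
    by (rule Bochner_Integration.integrable_bound[where f="\<lambda>x. 2 * (cmod (f x))\<^sup>2 + 2 * (cmod (g x))\<^sup>2"])
       (use assms in \<open>auto simp: sq_int_def cmod_add_sq_le\<close>)
qed

lemma sq_norm_add: 
  assumes "sq_int M f" "sq_int M g" 
  shows "sq_norm M (\<lambda>x. f x + g x) \<le> 2 * sq_norm M f + 2 * sq_norm M g"
proof -
  have "sq_norm M (\<lambda>x. f x + g x) \<le> (\<integral>x. 2 * (cmod (f x))\<^sup>2 + 2 * (cmod (g x))\<^sup>2 \<partial>M)"
    unfolding sq_norm_def using assms sq_int_add[OF assms]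
    by (intro integral_mono) (auto simp: sq_int_def cmod_add_sq_le)
  also have "\<dots> = 2 * sq_norm M f + 2 * sq_norm M g"
    using assms by (simp add: sq_norm_def sq_int_def)
  finally show ?thesis .
qed

lemma sq_int_mult_bdd:
  assumes "sq_int M f" "a \<in> borel_measurable M" "AE x in M. cmod (a x) \<le> C"
  shows "sq_int M (\<lambda>x. a x * f x)"
proof (rule sq_int_bound[OF assms(1), where C=C])
  note [measurable] = assms(1,2)
  show "(\<lambda>x. a x * f x) \<in> borel_measurable M" by measurable
  show "AE x in M. cmod (a x * f x) \<le> C * cmod (f x)"
    using assms(3) by eventually_elim (auto simp: norm_mult intro: mult_right_mono)
qed

lemma sq_int_cmult: "sq_int M f \<Longrightarrow> sq_int M (\<lambda>x. a * f x)"
  by (rule sq_int_mult_bdd[where C="cmod a"]) auto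

lemma sq_norm_cmult: "sq_norm M (\<lambda>x. a * f x) = (cmod a)\<^sup>2 * sq_norm M f"
  by (simp add: sq_norm_def norm_mult power_mult_distrib)

lemma sq_int_diff: "sq_int M f \<Longrightarrow> sq_int M g \<Longrightarrow> sq_int M (\<lambda>x. f x - g x)"
  using sq_int_add[of M f "\<lambda>x. -1 * g x"] sq_int_cmult[of M g "-1"] by simp

lemma sq_norm_diff:
  "sq_int M f \<Longrightarrow> sq_int M g \<Longrightarrow> sq_norm M (\<lambda>x. f x - g x) \<le> 2 * sq_norm M f + 2 * sq_norm M g"
  using sq_norm_add[of M f "\<lambda>x. -1 * g x"] sq_int_cmult[of M g "-1"] sq_norm_cmult[of M "-1" g] by simp

lemma borel_measurable_cnj [measurable (raw)]:
  "f \<in> borel_measurable M \<Longrightarrow> (\<lambda>x. cnj (f x)) \<in> borel_measurable M"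
  by (rule borel_measurable_continuous_on[where g=f and f=cnj]) (auto intro: continuous_intros)

lemma sq_int_cnj: "sq_int M f \<Longrightarrow> sq_int M (\<lambda>x. cnj (f x))"
  using borel_measurable_cnj[of f M] by (simp add: sq_int_def)

lemma sq_int_integrable_mult:
  assumes "sq_int M f" "sq_int M g" shows "integrable M (\<lambda>x. f x * g x)"
proof (rule Bochner_Integration.integrable_bound)
  note [measurable] = assms
  show "integrable M (\<lambda>x. (cmod (f x))\<^sup>2 + (cmod (g x))\<^sup>2)"
    using assms by (simp add: sq_int_def)
  show "(\<lambda>x. f x * g x) \<in> borel_measurable M" by measurable
  show "AE x in M. norm (f x * g x) \<le> norm ((cmod (f x))\<^sup>2 + (cmod (g x))\<^sup>2)"
  proof (rule AE_I2)
    fix x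
    have "2 * cmod (f x) * cmod (g x) \<le> (cmod (f x))\<^sup>2 + (cmod (g x))\<^sup>2" by (rule sum_squares_bound)
    moreover have "0 \<le> cmod (f x) * cmod (g x)" by simp
    ultimately show "norm (f x * g x) \<le> norm ((cmod (f x))\<^sup>2 + (cmod (g x))\<^sup>2)"
      by (simp only: norm_mult real_norm_def abs_of_nonneg)
  qed
qed

lemma sq_int_integrable_mult3:
  assumes "sq_int M f" "sq_int M g" "a \<in> borel_measurable M" "AE x in M. cmod (a x) \<le> C"
  shows "integrable M (\<lambda>x. a x * f x * g x)"
  using sq_int_integrable_mult[OF sq_int_mult_bdd[OF assms(1,3,4)] assms(2)] by simp

text \<open>
  The quadratic polynomial $t \mapsto \int (t |f| - |g|)^2$ is nonnegative, hence has a
  nonpositive discriminant.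
\<close>

lemma L2_Cauchy_Schwarz:
  assumes "sq_int M f" "sq_int M g"
  shows "cmod (\<integral>x. f x * g x \<partial>M) \<le> sqrt (sq_norm M f) * sqrt (sq_norm M g)"
proof -
  let ?I = "\<integral>x. cmod (f x) * cmod (g x) \<partial>M"
  have int: "integrable M (\<lambda>x. cmod (f x) * cmod (g x))"
    using integrable_norm[OF sq_int_integrable_mult[OF assms]] by (simp add: norm_mult)
  have 1: "cmod (\<integral>x. f x * g x \<partial>M) \<le> ?I"
    using integral_norm_bound[of M "\<lambda>x. f x * g x"] by (simp add: norm_mult)
  have quad: "0 \<le> sq_norm M f * t\<^sup>2 - 2 * t * ?I + sq_norm M g" for t :: real
  proof -
    have "0 \<le> (\<integral>x. (t * cmod (f x) - cmod (g x))\<^sup>2 \<partial>M)" by simp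
    also have "\<dots> = (\<integral>x. t\<^sup>2 * (cmod (f x))\<^sup>2 - 2 * t * (cmod (f x) * cmod (g x)) + (cmod (g x))\<^sup>2 \<partial>M)"
      by (rule Bochner_Integration.integral_cong) (auto simp: power2_diff power_mult_distrib algebra_simps)
    also have "\<dots> = sq_norm M f * t\<^sup>2 - 2 * t * ?I + sq_norm M g"
      using assms int by (simp add: sq_int_def sq_norm_def)
    finally show ?thesis .
  qed
  have "?I\<^sup>2 \<le> sq_norm M f * sq_norm M g"
  proof (cases "sq_norm M f = 0")
    case True
    have "?I = 0"
    proof (rule ccontr)
      assume "?I \<noteq> 0"
      \<comment> \<open>A polynomial that is in fact affine with nonzero slope takes negative values.\<close>
      thus False using quad[of "(sq_norm M g + 1) / (2 * ?I)"] True by (simp add: field_simps)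
    qed
    thus ?thesis by simp
  next
    case False
    have "0 < sq_norm M f" using False sq_norm_nonneg[of M f] by linarith
    thus ?thesis using quad[of "?I / sq_norm M f"]
      by (simp add: field_simps power2_eq_square)
  qed
  hence "?I \<le> sqrt (sq_norm M f * sq_norm M g)" by (rule real_le_rsqrt)
  thus ?thesis using 1 by (simp add: real_sqrt_mult)
qed

lemma L2_tendsto_mult_zero:
  assumes "\<forall>\<^sub>F s in F. sq_int M (f s)" "\<forall>\<^sub>F s in F. sq_int M (g s)"
    and "((\<lambda>s. sq_norm M (f s)) \<longlongrightarrow> 0) F" and "\<forall>\<^sub>F s in F. sq_norm M (g s) \<le> K"
  shows "((\<lambda>s. \<integral>x. f s x * g s x \<partial>M) \<longlongrightarrow> 0) F"
proof (rule Lim_null_comparison)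
  show "\<forall>\<^sub>F s in F. norm (\<integral>x. f s x * g s x \<partial>M) \<le> sqrt (sq_norm M (f s)) * sqrt K"
    using assms(1,2,4)
  proof eventually_elim
    case (elim s)
    have "norm (\<integral>x. f s x * g s x \<partial>M) \<le> sqrt (sq_norm M (f s)) * sqrt (sq_norm M (g s))"
      by (rule L2_Cauchy_Schwarz) fact+
    also have "\<dots> \<le> sqrt (sq_norm M (f s)) * sqrt K"
      using elim by (intro mult_left_mono) auto
    finally show ?case .
  qed
  have "((\<lambda>s. sqrt (sq_norm M (f s)) * sqrt K) \<longlongrightarrow> sqrt 0 * sqrt K) F"
    by (intro tendsto_intros assms)
  thus "((\<lambda>s. sqrt (sq_norm M (f s)) * sqrt K) \<longlongrightarrow> 0) F" by simp
qed

text \<open>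
  The time derivatives of the truncated momentum and variance are limits of integrals of such
  products, one factor being a difference quotient in time.
\<close>

lemma L2_tendsto_mult:
  assumes fs: "\<forall>\<^sub>F s in F. sq_int M (f s)" and gs: "\<forall>\<^sub>F s in F. sq_int M (g s)"
    and f0: "sq_int M f0" and g0: "sq_int M g0"
    and "((\<lambda>s. sq_norm M (\<lambda>x. f s x - f0 x)) \<longlongrightarrow> 0) F" 
    and "((\<lambda>s. sq_norm M (\<lambda>x. g s x - g0 x)) \<longlongrightarrow> 0) F"
    and a: "a \<in> borel_measurable M" "AE x in M. cmod (a x) \<le> C"
  shows "((\<lambda>s. \<integral>x. a x * f s x * g s x \<partial>M) \<longlongrightarrow> (\<integral>x. a x * f0 x * g0 x \<partial>M)) F"
proof -
  note [measurable] = a(1) f0 g0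
  have af0: "sq_int M (\<lambda>x. a x * f0 x)" by (rule sq_int_mult_bdd[OF f0 a])
  have evd: "\<forall>\<^sub>F s in F. sq_int M (\<lambda>x. a x * (f s x - f0 x))"
    using fs by eventually_elim (intro sq_int_mult_bdd[OF sq_int_diff[OF _ f0] a])
  have evg: "\<forall>\<^sub>F s in F. sq_int M (\<lambda>x. g s x - g0 x)"
    using gs by eventually_elim (rule sq_int_diff[OF _ g0])
  have n1: "((\<lambda>s. sq_norm M (\<lambda>x. a x * (f s x - f0 x))) \<longlongrightarrow> 0) F"
  proof (rule Lim_null_comparison)
    show "\<forall>\<^sub>F s in F. norm (sq_norm M (\<lambda>x. a x * (f s x - f0 x))) \<le> C\<^sup>2 * sq_norm M (\<lambda>x. f s x - f0 x)"
      using fs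
    proof eventually_elim
      case (elim s)
      note [measurable] = elim
      have "sq_norm M (\<lambda>x. a x * (f s x - f0 x)) \<le> C\<^sup>2 * sq_norm M (\<lambda>x. f s x - f0 x)"
      proof (rule sq_norm_bound)
        show "sq_int M (\<lambda>x. f s x - f0 x)" by (rule sq_int_diff[OF elim f0])
        show "AE x in M. cmod (a x * (f s x - f0 x)) \<le> C * cmod (f s x - f0 x)"
          using a(2) by eventually_elim (auto simp: norm_mult intro: mult_right_mono)
      qed measurable
      thus ?case by simp
    qed
    show "((\<lambda>s. C\<^sup>2 * sq_norm M (\<lambda>x. f s x - f0 x)) \<longlongrightarrow> 0) F"
      using tendsto_mult[OF tendsto_const assms(5)] by simp
  qed
  have evK: "\<forall>\<^sub>F s in F. sq_norm M (g s) \<le> 2 * 1 + 2 * sq_norm M g0"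
    using evg order_tendstoD(2)[OF assms(6), of 1, simplified]
  proof eventually_elim
    case (elim s)
    have "sq_norm M (\<lambda>x. (g s x - g0 x) + g0 x) \<le> 2 * sq_norm M (\<lambda>x. g s x - g0 x) + 2 * sq_norm M g0"
      by (rule sq_norm_add) (use elim g0 in auto)
    thus ?case using elim by simp
  qed
  have t1: "((\<lambda>s. \<integral>x. (a x * (f s x - f0 x)) * g s x \<partial>M) \<longlongrightarrow> 0) F"
    by (rule L2_tendsto_mult_zero[OF evd gs n1 evK])
  have t2: "((\<lambda>s. \<integral>x. (g s x - g0 x) * (a x * f0 x) \<partial>M) \<longlongrightarrow> 0) F"
    by (rule L2_tendsto_mult_zero[OF evg _ assms(6), where K="sq_norm M (\<lambda>x. a x * f0 x)"]) (auto simp: af0)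
  have "((\<lambda>s. (\<integral>x. (a x * (f s x - f0 x)) * g s x \<partial>M) + (\<integral>x. (g s x - g0 x) * (a x * f0 x) \<partial>M)
           + (\<integral>x. a x * f0 x * g0 x \<partial>M)) \<longlongrightarrow> 0 + 0 + (\<integral>x. a x * f0 x * g0 x \<partial>M)) F"
    by (intro tendsto_intros t1 t2)
  moreover have "\<forall>\<^sub>F s in F. (\<integral>x. (a x * (f s x - f0 x)) * g s x \<partial>M) + (\<integral>x. (g s x - g0 x) * (a x * f0 x) \<partial>M)
           + (\<integral>x. a x * f0 x * g0 x \<partial>M) = (\<integral>x. a x * f s x * g s x \<partial>M)"
    using evd evg gs
  proof eventually_elim
    case (elim s)
    have "(\<integral>x. a x * f s x * g s x \<partial>M) = (\<integral>x. (a x * (f s x - f0 x)) * g s x + (g s x - g0 x) * (a x * f0 x) + a x * f0 x * g0 x \<partial>M)"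
      by (rule Bochner_Integration.integral_cong) (auto simp: algebra_simps)
    also have "\<dots> = (\<integral>x. (a x * (f s x - f0 x)) * g s x \<partial>M) + (\<integral>x. (g s x - g0 x) * (a x * f0 x) \<partial>M)
           + (\<integral>x. a x * f0 x * g0 x \<partial>M)"
      using sq_int_integrable_mult[OF elim(1,3)] sq_int_integrable_mult[OF elim(2) af0]
        sq_int_integrable_mult[OF af0 g0] by simp
    finally show ?case by simp
  qed
  ultimately show ?thesis
    using Lim_transform_eventually by fastforce
qed

section \<open>Absolutely continuous functions on the half line\<close>

text \<open>
  Local absolute continuity on $(0,\infty)$ with a prescribed a.e. derivative, stated as the
  fundamental theorem of calculus on every compact interval. No integrability up to
  \<open>0\<close> or \<open>\<infinity>\<close> is imposed: this is where boundary terms come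
  from.
\<close>

definition ac_pos :: "(real \<Rightarrow> complex) \<Rightarrow> (real \<Rightarrow> complex) \<Rightarrow> bool" where
  "ac_pos F G \<longleftrightarrow> (\<forall>a b. 0 < a \<longrightarrow> a \<le> b \<longrightarrow>
     set_integrable lborel {a..b} G \<and> F b - F a = (LINT r:{a..b}|lborel. G r))"

lemma ac_posD:
  assumes "ac_pos F G" "0 < a" "a \<le> b"
  shows "set_integrable lborel {a..b} G" "(LINT r:{a..b}|lborel. G r) = F b - F a"
  using assms by (auto simp: ac_pos_def)

lemma ac_pos_continuous:
  assumes "ac_pos F G" shows "continuous_on {0<..} F"
proof -
  have "isCont F r" if "r > 0" for r
  proof -
    let ?a = "r / 2" and ?b = "r + 1"
    note D = ac_posD[OF assms]
    have int: "G integrable_on {?a..?b}"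
      using D(1)[of ?a ?b] that set_borel_integral_eq_integral(1) by force
    have F: "F x = F ?a + integral {?a..x} G" if x: "x \<in> {?a..?b}" for x
    proof -
      have "(LINT r:{?a..x}|lborel. G r) = integral {?a..x} G"
        using D(1)[of ?a x] that \<open>r > 0\<close> set_borel_integral_eq_integral(2) by force
      thus ?thesis using D(2)[of ?a x] that \<open>r > 0\<close> by simp
    qed
    have "continuous_on {?a..?b} (\<lambda>x. F ?a + integral {?a..x} G)"
      by (intro continuous_intros indefinite_integral_continuous_1 int)
    hence "continuous_on {?a..?b} F"
      by (rule continuous_on_eq) (simp only: F)
    thus ?thesis using that by (intro continuous_on_interior) auto
  qed
  thus ?thesis by (intro continuous_at_imp_continuous_on) auto
qed

lemma ac_pos_has_vector_derivative:
  assumes "ac_pos F G" "continuous_on {0<..} G" "r > 0"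
  shows "(F has_vector_derivative G r) (at r)"
proof -
  let ?a = "r / 2" and ?b = "r + 1"
  note D = ac_posD[OF assms(1)]
  have F: "F x = F ?a + integral {?a..x} G" if x: "x \<in> {?a..?b}" for x
  proof -
    have "(LINT r:{?a..x}|lborel. G r) = integral {?a..x} G"
      using D(1)[of ?a x] that \<open>r > 0\<close> set_borel_integral_eq_integral(2) by force
    thus ?thesis using D(2)[of ?a x] that \<open>r > 0\<close> by simp
  qed
  have "((\<lambda>u. integral {?a..u} G) has_vector_derivative G r) (at r within {?a..?b})"
    by (rule integral_has_vector_derivative)
       (use assms in \<open>auto intro: continuous_on_subset\<close>)
  hence "((\<lambda>u. F ?a + integral {?a..u} G) has_vector_derivative (0 + G r)) (at r within {?a..?b})"
    by (intro has_vector_derivative_add has_vector_derivative_const)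
  hence "(F has_vector_derivative (0 + G r)) (at r within {?a..?b})"
    by (rule has_vector_derivative_transform[rotated 2]) (use assms(3) in \<open>simp, simp only: F\<close>)
  thus ?thesis using assms(3) 
    by (simp add: at_within_Icc_at)
qed

lemma ac_pos_C1:
  assumes "\<And>r. r > 0 \<Longrightarrow> (F has_vector_derivative G r) (at r)" "continuous_on {0<..} G"
  shows "ac_pos F G"
  unfolding ac_pos_def
proof (intro allI impI)
  fix a b :: real assume ab: "0 < a" "a \<le> b"
  have c: "continuous_on {a..b} G" by (rule continuous_on_subset[OF assms(2)]) (use ab in auto)
  have "(LINT r:{a..b}|lborel. G r) = F b - F a"
    unfolding set_lebesgue_integral_def
    by (rule integral_FTC_Icc[OF ab(2) _ c])
       (use ab in \<open>auto intro!: has_vector_derivative_at_within assms(1)\<close>)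
  thus "set_integrable lborel {a..b} G \<and> F b - F a = (LINT r:{a..b}|lborel. G r)"
    using borel_integrable_atLeastAtMost'[OF c] by simp
qed

lemma ac_pos_cong:
  assumes "ac_pos F G" "\<And>r. r > 0 \<Longrightarrow> F' r = F r" "\<And>r. r > 0 \<Longrightarrow> G' r = G r"
  shows "ac_pos F' G'"
  unfolding ac_pos_def
proof (intro allI impI)
  fix a b :: real assume ab: "0 < a" "a \<le> b"
  have "set_integrable lborel {a..b} G' = set_integrable lborel {a..b} G"
    by (rule set_integrable_cong) (use ab assms(3) in auto)
  moreover have "(LINT r:{a..b}|lborel. G' r) = (LINT r:{a..b}|lborel. G r)"
    by (rule set_lebesgue_integral_cong) (use ab assms(3) in auto)
  ultimately show "set_integrable lborel {a..b} G' \<and> F' b - F' a = (LINT r:{a..b}|lborel. G' r)"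
    using ac_posD[OF assms(1) ab] ab assms(2) by simp
qed

lemma ac_pos_add:
  assumes "ac_pos F F'" "ac_pos G G'" shows "ac_pos (\<lambda>r. F r + G r) (\<lambda>r. F' r + G' r)"
  unfolding ac_pos_def
proof (intro allI impI)
  fix a b :: real assume ab: "0 < a" "a \<le> b"
  note D = ac_posD[OF assms(1) ab] ac_posD[OF assms(2) ab]
  show "set_integrable lborel {a..b} (\<lambda>r. F' r + G' r) \<and>
        F b + G b - (F a + G a) = (LINT r:{a..b}|lborel. F' r + G' r)"
    using set_integral_add[OF D(1) D(3)] unfolding D(2) D(4) by simp
qed

lemma ac_pos_cmult:
  assumes "ac_pos F F'" shows "ac_pos (\<lambda>r. c * F r) (\<lambda>r. c * F' r)"
  unfolding ac_pos_def
proof (intro allI impI)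
  fix a b :: real assume ab: "0 < a" "a \<le> b"
  note D = ac_posD[OF assms ab]
  have "(LINT r:{a..b}|lborel. c * F' r) = c * (F b - F a)"
    unfolding D(2)[symmetric] by simp
  thus "set_integrable lborel {a..b} (\<lambda>r. c * F' r) \<and>
        c * F b - c * F a = (LINT r:{a..b}|lborel. c * F' r)"
    using D(1) by (simp add: right_diff_distrib)
qed

lemma ac_pos_diff:
  assumes "ac_pos F F'" "ac_pos G G'" shows "ac_pos (\<lambda>r. F r - G r) (\<lambda>r. F' r - G' r)"
  using ac_pos_add[OF assms(1) ac_pos_cmult[OF assms(2), of "-1"]] by simp

lemma ac_pos_cnj:
  assumes "ac_pos F F'" shows "ac_pos (\<lambda>r. cnj (F r)) (\<lambda>r. cnj (F' r))"
  unfolding ac_pos_def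
proof (intro allI impI)
  fix a b :: real assume ab: "0 < a" "a \<le> b"
  note D = ac_posD[OF assms ab]
  have "integrable lborel (\<lambda>x. cnj (indicator {a..b} x *\<^sub>R F' x))"
    using D(1) unfolding set_integrable_def by (rule integrable_cnj)
  moreover have "(\<integral>x. cnj (indicator {a..b} x *\<^sub>R F' x) \<partial>lborel) = cnj (F b - F a)"
    using D(2) unfolding set_lebesgue_integral_def by (subst Bochner_Integration.integral_cnj) simp
  ultimately show "set_integrable lborel {a..b} (\<lambda>r. cnj (F' r)) \<and>
        cnj (F b) - cnj (F a) = (CLINT r:{a..b}|lborel. cnj (F' r))"
    by (simp add: set_integrable_def set_lebesgue_integral_def complex_cnj_scaleR)
qed

lemma set_integrable_mult_continuous:
  fixes F G :: "real \<Rightarrow> complex"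
  assumes "set_integrable lborel {a..b} F" "continuous_on {a..b} G"
  shows "set_integrable lborel {a..b} (\<lambda>r. F r * G r)"
proof -
  obtain C where C: "\<And>r. r \<in> {a..b} \<Longrightarrow> cmod (G r) \<le> C"
    using compact_imp_bounded[OF compact_continuous_image[OF assms(2) compact_Icc]]
    unfolding bounded_iff by blast
  have m1: "(\<lambda>x. indicator {a..b} x *\<^sub>R F x) \<in> borel_measurable borel"
    using borel_measurable_integrable[OF assms(1)[unfolded set_integrable_def]] by simp
  have m2: "(\<lambda>x. indicator {a..b} x *\<^sub>R G x) \<in> borel_measurable borel"
    by (rule borel_measurable_continuous_on_indicator[OF _ assms(2)]) simp
  show ?thesis unfolding set_integrable_def
  proof (rule Bochner_Integration.integrable_bound)
    show "integrable lborel (\<lambda>x. C * norm (indicator {a..b} x *\<^sub>R F x))"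
      using assms(1) by (simp only: set_integrable_def integrable_mult_right integrable_norm)
    have "(\<lambda>x. (indicator {a..b} x *\<^sub>R F x) * (indicator {a..b} x *\<^sub>R G x)) \<in> borel_measurable borel"
      using m1 m2 by measurable
    also have "(\<lambda>x. (indicator {a..b} x *\<^sub>R F x) * (indicator {a..b} x *\<^sub>R G x)) = (\<lambda>x. indicator {a..b} x *\<^sub>R (F x * G x))"
      by (auto split: split_indicator)
    finally show "(\<lambda>x. indicator {a..b} x *\<^sub>R (F x * G x)) \<in> borel_measurable lborel" by simp
    show "AE x in lborel. norm (indicator {a..b} x *\<^sub>R (F x * G x)) \<le> norm (C * norm (indicator {a..b} x *\<^sub>R F x))"
    proof (rule AE_I2)
      fix x
      show "norm (indicator {a..b} x *\<^sub>R (F x * G x)) \<le> norm (C * norm (indicator {a..b} x *\<^sub>R F x))"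
      proof (cases "x \<in> {a..b}")
        case True
        hence "cmod (F x) * cmod (G x) \<le> cmod (F x) * C" "0 \<le> C"
          using C[OF True] norm_ge_zero[of "G x"] by (blast intro: mult_left_mono norm_ge_zero, linarith)
        thus ?thesis using True by (simp add: norm_mult mult.commute)
      qed simp
    qed
  qed
qed

text \<open>
  Write both factors as integrals of their derivatives. By Fubini's theorem the two resulting
  double integrals cover the regions above and below the diagonal of the square, and together give
  the product of the increments.
\<close>

lemma ac_pos_mult:
  assumes "ac_pos F F'" "ac_pos G G'"
  shows "ac_pos (\<lambda>r. F r * G r) (\<lambda>r. F' r * G r + F r * G' r)"
  unfolding ac_pos_def
proof (intro allI impI)
  fix a b :: real assume ab: "0 < a" "a \<le> b"
  have cF: "continuous_on {a..b} F" and cG: "continuous_on {a..b} G"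
    using ac_pos_continuous[OF assms(1)] ac_pos_continuous[OF assms(2)] ab
    by (auto intro: continuous_on_subset)
  define f where "f x = indicator {a..b} x *\<^sub>R F' x" for x
  define g where "g x = indicator {a..b} x *\<^sub>R G' x" for x
  have f: "integrable lborel f" and g: "integrable lborel g"
    using ac_posD(1)[OF assms(1) ab] ac_posD(1)[OF assms(2) ab]
    unfolding f_def g_def set_integrable_def by this+
  note [measurable] = borel_measurable_integrable[OF f] borel_measurable_integrable[OF g]
  have i1: "set_integrable lborel {a..b} (\<lambda>r. F' r * G r)"
    by (rule set_integrable_mult_continuous[OF ac_posD(1)[OF assms(1) ab] cG])
  have i2: "set_integrable lborel {a..b} (\<lambda>r. F r * G' r)"
    using set_integrable_mult_continuous[OF ac_posD(1)[OF assms(2) ab] cF] by (simp add: mult.commute)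
  have prod: "integrable (lborel \<Otimes>\<^sub>M lborel) (\<lambda>(x, y). f x * g y)"
  proof (rule lborel_pair.Fubini_integrable)
    show "integrable lborel (\<lambda>x. \<integral>y. norm (case (x, y) of (x, y) \<Rightarrow> f x * g y) \<partial>lborel)"
      using f g by (simp add: norm_mult)
    show "AE x in lborel. integrable lborel (\<lambda>y. case (x, y) of (x, y) \<Rightarrow> f x * g y)"
      using g by simp
  qed measurable
  have prod2: "integrable (lborel \<Otimes>\<^sub>M lborel) (\<lambda>(x, y). indicator {z. fst z \<le> snd z} (x, y) *\<^sub>R (f x * g y))" (is "integrable _ ?h")
  proof (rule Bochner_Integration.integrable_bound[OF prod])
    show "?h \<in> borel_measurable (lborel \<Otimes>\<^sub>M lborel)" by measurable
  qed (auto split: split_indicator)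
  have FI: "(\<integral>y. indicator {..r} y *\<^sub>R f y \<partial>lborel) = F r - F a" if "r \<in> {a..b}" for r
  proof -
    have "(\<integral>y. indicator {..r} y *\<^sub>R f y \<partial>lborel) = (LINT y:{a..r}|lborel. F' y)"
      unfolding set_lebesgue_integral_def f_def
      by (rule Bochner_Integration.integral_cong) (use that in \<open>auto split: split_indicator\<close>)
    thus ?thesis using ac_posD(2)[OF assms(1) ab(1), of r] that by simp
  qed
  have GI: "(\<integral>y. indicator {..r} y *\<^sub>R g y \<partial>lborel) = G r - G a" if "r \<in> {a..b}" for r
  proof -
    have "(\<integral>y. indicator {..r} y *\<^sub>R g y \<partial>lborel) = (LINT y:{a..r}|lborel. G' y)"
      unfolding set_lebesgue_integral_def g_def
      by (rule Bochner_Integration.integral_cong) (use that in \<open>auto split: split_indicator\<close>)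
    thus ?thesis using ac_posD(2)[OF assms(2) ab(1), of r] that by simp
  qed
  have fI: "(\<integral>y. f y \<partial>lborel) = F b - F a" and gI: "(\<integral>y. g y \<partial>lborel) = G b - G a"
    using ac_posD(2)[OF assms(1) ab] ac_posD(2)[OF assms(2) ab]
    by (simp_all add: f_def g_def set_lebesgue_integral_def)
  have e1: "(LINT r:{a..b}|lborel. F' r * G r) = G a * (F b - F a) + (\<integral>x. f x * (\<integral>y. indicator {..x} y *\<^sub>R g y \<partial>lborel) \<partial>lborel)"
  proof -
    have eq: "f x * (\<integral>y. indicator {..x} y *\<^sub>R g y \<partial>lborel) = indicator {a..b} x *\<^sub>R (F' x * G x) - G a * f x" for x
    proof (cases "x \<in> {a..b}")
      case True
      show ?thesis unfolding GI[OF True] using True by (simp add: f_def algebra_simps)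
    qed (simp add: f_def)
    show ?thesis unfolding eq using i1 f fI
      by (simp add: set_lebesgue_integral_def set_integrable_def)
  qed
  have e2: "(LINT r:{a..b}|lborel. F r * G' r) = F a * (G b - G a) + (\<integral>x. g x * (\<integral>y. indicator {..x} y *\<^sub>R f y \<partial>lborel) \<partial>lborel)"
  proof -
    have eq: "g x * (\<integral>y. indicator {..x} y *\<^sub>R f y \<partial>lborel) = indicator {a..b} x *\<^sub>R (F x * G' x) - F a * g x" for x
    proof (cases "x \<in> {a..b}")
      case True
      show ?thesis unfolding FI[OF True] using True by (simp add: g_def algebra_simps)
    qed (simp add: g_def)
    show ?thesis unfolding eq using i2 g gI
      by (simp add: set_lebesgue_integral_def set_integrable_def)
  qed
  have "(\<integral>x. g x * (\<integral>y. indicator {..x} y *\<^sub>R f y \<partial>lborel) \<partial>lborel)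
      = (\<integral>y. (\<integral>x. indicator {z. fst z \<le> snd z} (x, y) *\<^sub>R (f x * g y) \<partial>lborel) \<partial>lborel)"
  proof (rule Bochner_Integration.integral_cong[OF refl])
    fix y
    have "(\<integral>x. indicator {z. fst z \<le> snd z} (x, y) *\<^sub>R (f x * g y) \<partial>lborel)
        = (\<integral>x. g y * (indicator {..y} x *\<^sub>R f x) \<partial>lborel)"
      by (rule Bochner_Integration.integral_cong) (auto split: split_indicator)
    thus "g y * (\<integral>x. indicator {..y} x *\<^sub>R f x \<partial>lborel) = (\<integral>x. indicator {z. fst z \<le> snd z} (x, y) *\<^sub>R (f x * g y) \<partial>lborel)"
      by (simp only: integral_mult_right_zero)
  qed
  also have "\<dots> = (\<integral>x. (\<integral>y. indicator {z. fst z \<le> snd z} (x, y) *\<^sub>R (f x * g y) \<partial>lborel) \<partial>lborel)"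
    by (rule lborel_pair.Fubini_integral) (rule prod2)
  also have "\<dots> = (\<integral>x. f x * (\<integral>y. indicator {x..} y *\<^sub>R g y \<partial>lborel) \<partial>lborel)"
  proof (rule Bochner_Integration.integral_cong[OF refl])
    fix x
    have "(\<integral>y. indicator {z. fst z \<le> snd z} (x, y) *\<^sub>R (f x * g y) \<partial>lborel)
        = (\<integral>y. f x * (indicator {x..} y *\<^sub>R g y) \<partial>lborel)"
      by (rule Bochner_Integration.integral_cong) (auto split: split_indicator)
    thus "(\<integral>y. indicator {z. fst z \<le> snd z} (x, y) *\<^sub>R (f x * g y) \<partial>lborel) = f x * (\<integral>y. indicator {x..} y *\<^sub>R g y \<partial>lborel)"
      by (simp only: integral_mult_right_zero)
  qed
  also have "\<dots> = (\<integral>x. f x * (G b - G a) - f x * (\<integral>y. indicator {..x} y *\<^sub>R g y \<partial>lborel) \<partial>lborel)"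
  proof (rule Bochner_Integration.integral_cong[OF refl])
    fix x
    \<comment> \<open>The two half lines overlap in the single point \<open>x\<close>.\<close>
    have "(\<integral>y. indicator {x..} y *\<^sub>R g y \<partial>lborel) + (\<integral>y. indicator {..x} y *\<^sub>R g y \<partial>lborel)
        = (\<integral>y. indicator {x..} y *\<^sub>R g y + indicator {..x} y *\<^sub>R g y \<partial>lborel)"
      using g by (intro Bochner_Integration.integral_add[symmetric] integrable_mult_indicator) auto
    also have "\<dots> = (\<integral>y. g y \<partial>lborel)"
    proof (rule integral_cong_AE)
      show "AE y in lborel. indicator {x..} y *\<^sub>R g y + indicator {..x} y *\<^sub>R g y = g y"
        using AE_lborel_singleton[of x] by eventually_elim (auto split: split_indicator)
    qed measurable
    finally have "(\<integral>y. indicator {x..} y *\<^sub>R g y \<partial>lborel) = (G b - G a) - (\<integral>y. indicator {..x} y *\<^sub>R g y \<partial>lborel)"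
      using gI by (simp add: algebra_simps)
    thus "f x * (\<integral>y. indicator {x..} y *\<^sub>R g y \<partial>lborel) = f x * (G b - G a) - f x * (\<integral>y. indicator {..x} y *\<^sub>R g y \<partial>lborel)"
      by (simp only: right_diff_distrib)
  qed
  also have "\<dots> = (F b - F a) * (G b - G a) - (\<integral>x. f x * (\<integral>y. indicator {..x} y *\<^sub>R g y \<partial>lborel) \<partial>lborel)"
  proof (subst Bochner_Integration.integral_diff)
    have eq: "f x * (\<integral>y. indicator {..x} y *\<^sub>R g y \<partial>lborel) = indicator {a..b} x *\<^sub>R (F' x * G x) - G a * f x" for x
    proof (cases "x \<in> {a..b}")
      case True
      show ?thesis unfolding GI[OF True] using True by (simp add: f_def algebra_simps)
    qed (simp add: f_def)
    show "integrable lborel (\<lambda>x. f x * (\<integral>y. indicator {..x} y *\<^sub>R g y \<partial>lborel))"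
      unfolding eq using i1 f by (simp add: set_integrable_def)
  qed (use f fI in auto)
  finally have "(LINT r:{a..b}|lborel. F' r * G r) + (LINT r:{a..b}|lborel. F r * G' r) = F b * G b - F a * G a"
    unfolding e1 e2 by (simp add: algebra_simps)
  thus "set_integrable lborel {a..b} (\<lambda>r. F' r * G r + F r * G' r) \<and>
       F b * G b - F a * G a = (LINT r:{a..b}|lborel. F' r * G r + F r * G' r)"
    using i1 i2 by (simp add: set_integral_add)
qed

lemma set_integral_nonneg_mono_set:
  fixes f :: "'a \<Rightarrow> real"
  assumes "set_integrable M B f" "A \<in> sets M" "A \<subseteq> B" "\<And>x. 0 \<le> f x"
  shows "(LINT x:A|M. f x) \<le> (LINT x:B|M. f x)"
  unfolding set_lebesgue_integral_def
proof (rule integral_mono)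
  show "integrable M (\<lambda>x. indicator A x *\<^sub>R f x)"
    using set_integrable_subset[OF assms(1-3)] by (simp add: set_integrable_def)
  show "integrable M (\<lambda>x. indicator B x *\<^sub>R f x)"
    using assms(1) by (simp add: set_integrable_def)
  show "indicator A x *\<^sub>R f x \<le> indicator B x *\<^sub>R f x" for x
    using assms(3,4) by (auto split: split_indicator)
qed

text \<open>
  Otherwise $h(r) \ge \epsilon / r$ near the origin, and $1/r$ is not integrable there.
\<close>

lemma exists_small_near_0:
  fixes h :: "real \<Rightarrow> real"
  assumes "set_integrable lborel {0<..} h" "\<epsilon> > 0" "\<delta> > 0"
  shows "\<exists>r. 0 < r \<and> r < \<delta> \<and> r * h r < \<epsilon>"
proof (rule ccontr)
  assume *: "\<not> ?thesis"
  have low: "\<epsilon> * inverse r \<le> h r" if "0 < r" "r < \<delta>" for r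
  proof -
    have "\<epsilon> \<le> r * h r" using that * by (meson not_le)
    thus ?thesis using that by (simp add: field_simps)
  qed
  define I where "I = (LINT r:{0<..}|lborel. \<bar>h r\<bar>)"
  \<comment> \<open>chosen so that the integral of \<open>\<epsilon> / r\<close> over \<open>{a..\<delta>/2}\<close> is \<open>I + 1\<close>\<close>
  define a where "a = \<delta> / 2 * exp (- ((I + 1) / \<epsilon>))"
  have "I \<ge> 0" unfolding I_def set_lebesgue_integral_def by (intro Bochner_Integration.integral_nonneg) auto
  have habs: "set_integrable lborel {0<..} (\<lambda>r. \<bar>h r\<bar>)" by (rule set_integrable_abs[OF assms(1)])
  have "exp (- ((I + 1) / \<epsilon>)) \<le> 1" using assms \<open>I \<ge> 0\<close> by simp
  hence a: "0 < a" "a \<le> \<delta> / 2" using assms by (auto simp: a_def intro: mult_left_le)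
  have c: "continuous_on {a..\<delta>/2} (\<lambda>r. \<epsilon> * inverse r)" using a by (intro continuous_intros) auto
  have FTC: "(LINT r:{a..\<delta>/2}|lborel. \<epsilon> * inverse r) = \<epsilon> * ln (\<delta>/2) - \<epsilon> * ln a"
    unfolding set_lebesgue_integral_def
  proof (rule integral_FTC_Icc[OF a(2) _ c])
    fix x assume "a \<le> x" "x \<le> \<delta>/2"
    hence "((\<lambda>x. \<epsilon> * ln x) has_real_derivative \<epsilon> * inverse x) (at x)"
      using a(1) by (intro DERIV_cmult DERIV_ln) simp
    thus "((\<lambda>x. \<epsilon> * ln x) has_vector_derivative \<epsilon> * inverse x) (at x within {a..\<delta>/2})"
      by (simp add: has_real_derivative_iff_has_vector_derivative has_vector_derivative_at_within)
  qed
  have "(LINT r:{a..\<delta>/2}|lborel. \<epsilon> * inverse r) \<le> (LINT r:{a..\<delta>/2}|lborel. \<bar>h r\<bar>)"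
    using a(1) assms(3)
    by (intro set_integral_mono borel_integrable_atLeastAtMost' c set_integrable_subset[OF habs] order_trans[OF low abs_ge_self]) auto
  also have "\<dots> \<le> I" unfolding I_def
    by (intro set_integral_nonneg_mono_set habs) (use a in auto)
  finally have "\<epsilon> * ln (\<delta>/2) - \<epsilon> * ln a \<le> I" using FTC by simp
  moreover have "ln a = ln (\<delta>/2) - (I + 1) / \<epsilon>" unfolding a_def using assms by (subst ln_mult_pos) auto
  hence "\<epsilon> * ln a = \<epsilon> * ln (\<delta>/2) - (I + 1)" using assms by (simp only: right_diff_distrib) simp
  ultimately show False by linarith
qed

lemma exists_small_near_infinity:
  fixes h :: "real \<Rightarrow> real"
  assumes "set_integrable lborel {0<..} h" "\<epsilon> > 0" "N > 0"
  shows "\<exists>r. N < r \<and> r * h r < \<epsilon>"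
proof (rule ccontr)
  assume *: "\<not> ?thesis"
  have low: "\<epsilon> * inverse r \<le> h r" if "N < r" for r
  proof -
    have "\<epsilon> \<le> r * h r" using that * by (meson not_le)
    moreover have "r > 0" using that \<open>N > 0\<close> by simp
    ultimately show ?thesis by (simp add: field_simps)
  qed
  define I where "I = (LINT r:{0<..}|lborel. \<bar>h r\<bar>)"
  \<comment> \<open>chosen so that the integral of \<open>\<epsilon> / r\<close> over \<open>{N+1..b}\<close> is \<open>I + 1\<close>\<close>
  define b where "b = (N + 1) * exp ((I + 1) / \<epsilon>)"
  have "I \<ge> 0" unfolding I_def set_lebesgue_integral_def by (intro Bochner_Integration.integral_nonneg) auto
  have habs: "set_integrable lborel {0<..} (\<lambda>r. \<bar>h r\<bar>)" by (rule set_integrable_abs[OF assms(1)])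
  have b: "N + 1 \<le> b" using assms \<open>I \<ge> 0\<close> by (auto simp: b_def)
  have c: "continuous_on {N+1..b} (\<lambda>r. \<epsilon> * inverse r)" using assms by (intro continuous_intros) auto
  have FTC: "(LINT r:{N+1..b}|lborel. \<epsilon> * inverse r) = \<epsilon> * ln b - \<epsilon> * ln (N+1)"
    unfolding set_lebesgue_integral_def
    by (rule integral_FTC_Icc[OF b _ c])
       (use assms in \<open>auto intro!: derivative_eq_intros simp: has_real_derivative_iff_has_vector_derivative[symmetric] divide_inverse\<close>)
  have "(LINT r:{N+1..b}|lborel. \<epsilon> * inverse r) \<le> (LINT r:{N+1..b}|lborel. \<bar>h r\<bar>)"
    using assms
    by (intro set_integral_mono borel_integrable_atLeastAtMost' c set_integrable_subset[OF habs] order_trans[OF low abs_ge_self]) auto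
  also have "\<dots> \<le> I" unfolding I_def
    by (intro set_integral_nonneg_mono_set habs) (use assms in auto)
  finally have "\<epsilon> * ln b - \<epsilon> * ln (N+1) \<le> I" using FTC by simp
  moreover have "ln b = ln (N+1) + (I + 1) / \<epsilon>" unfolding b_def using assms by (subst ln_mult_pos) auto
  hence "\<epsilon> * ln b = \<epsilon> * ln (N+1) + (I + 1)" using assms by (simp only: distrib_left) simp
  ultimately show False by linarith
qed

text \<open>
  A total derivative has integral zero when its primitive vanishes at both ends. It suffices that
  the primitive \<open>F\<close> tends to zero along some sequences $r \to 0$ and $r \to \infty$,
  and these are supplied by an integrable density \<open>h\<close>: along suitable sequences $r
  h(r) \to 0$. In the applications \<open>h\<close> is the density of $|f|^2 + |f'|^2$, so no
  decay or regularity at the origin has to be known pointwise.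
\<close>

lemma zero_flux:
  fixes h :: "real \<Rightarrow> real"
  assumes ac: "ac_pos F G" and G: "set_integrable lborel {0<..} G"
    and h: "set_integrable lborel {0<..} h"
    and near0: "\<And>r. 0 < r \<Longrightarrow> r \<le> 1 \<Longrightarrow> cmod (F r) \<le> C * (r + sqrt (r * h r) + r * h r)"
    and nearinf: "\<And>r. R \<le> r \<Longrightarrow> cmod (F r) \<le> C * (r * h r)"
    and hnn: "\<And>r. 0 < r \<Longrightarrow> 0 \<le> h r"
  shows "(LINT r:{0<..}|lborel. G r) = 0"
proof -
  have "\<exists>r. 0 < r \<and> r < 1 / real (Suc n) \<and> r * h r < 1 / real (Suc n)" for n
    by (rule exists_small_near_0[OF h]) auto
  then obtain x where x: "\<And>n. 0 < x n" "\<And>n. x n < 1 / real (Suc n)" "\<And>n. x n * h (x n) < 1 / real (Suc n)"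
    by metis
  have "\<exists>r. real (Suc n) + \<bar>R\<bar> < r \<and> r * h r < 1 / real (Suc n)" for n
    by (rule exists_small_near_infinity[OF h]) auto
  then obtain y where y: "\<And>n. real (Suc n) + \<bar>R\<bar> < y n" "\<And>n. y n * h (y n) < 1 / real (Suc n)"
    by metis
  have lim0: "(\<lambda>n. 1 / real (Suc n)) \<longlonglongrightarrow> 0" 
    using LIMSEQ_inverse_real_of_nat by (simp add: inverse_eq_divide)
  have x0: "x \<longlonglongrightarrow> 0"
    by (rule tendsto_sandwich[OF _ _ tendsto_const lim0]) (use less_imp_le[OF x(1)] less_imp_le[OF x(2)] in auto)
  have xh0: "(\<lambda>n. x n * h (x n)) \<longlonglongrightarrow> 0"
    by (rule tendsto_sandwich[OF _ _ tendsto_const lim0]) (use x(1) hnn less_imp_le[OF x(3)] in \<open>auto intro!: always_eventually mult_nonneg_nonneg simp: less_imp_le\<close>)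
  have ypos: "y n > 0" for n using y(1)[of n] by linarith
  have yh0: "(\<lambda>n. y n * h (y n)) \<longlonglongrightarrow> 0"
    by (rule tendsto_sandwich[OF _ _ tendsto_const lim0]) (use ypos hnn less_imp_le[OF y(2)] in \<open>auto intro!: always_eventually mult_nonneg_nonneg simp: less_imp_le\<close>)
  have Fx: "(\<lambda>n. F (x n)) \<longlonglongrightarrow> 0"
  proof (rule Lim_null_comparison)
    have "x n \<le> 1" for n
    proof -
      have "1 / real (Suc n) \<le> 1" by simp
      thus ?thesis using x(2)[of n] by linarith
    qed
    thus "\<forall>\<^sub>F n in sequentially. norm (F (x n)) \<le> C * (x n + sqrt (x n * h (x n)) + x n * h (x n))"
      using near0 x by auto
    have "(\<lambda>n. C * (x n + sqrt (x n * h (x n)) + x n * h (x n))) \<longlonglongrightarrow> C * (0 + sqrt 0 + 0)"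
      by (intro tendsto_intros x0 xh0)
    thus "(\<lambda>n. C * (x n + sqrt (x n * h (x n)) + x n * h (x n))) \<longlonglongrightarrow> 0" by simp
  qed
  have Fy: "(\<lambda>n. F (y n)) \<longlonglongrightarrow> 0"
  proof (rule Lim_null_comparison)
    have "R \<le> y n" for n using y(1)[of n] by linarith
    thus "\<forall>\<^sub>F n in sequentially. norm (F (y n)) \<le> C * (y n * h (y n))"
      using nearinf by auto
    show "(\<lambda>n. C * (y n * h (y n))) \<longlonglongrightarrow> 0" using tendsto_mult[OF tendsto_const yh0] by simp
  qed
  have xy: "x n \<le> y n" for n
  proof -
    have "1 / real (Suc n) \<le> 1" "1 \<le> real (Suc n)" by simp_all
    thus ?thesis using y(1)[of n] x(2)[of n] by linarith
  qed
  have conv: "(\<lambda>n. LINT r:{x n..y n}|lborel. G r) \<longlonglongrightarrow> (LINT r:{0<..}|lborel. G r)"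
    unfolding set_lebesgue_integral_def
  proof (rule integral_dominated_convergence[where w="\<lambda>r. norm (indicator {0<..} r *\<^sub>R G r)"])
    have m: "(\<lambda>r. indicator {0<..} r *\<^sub>R G r) \<in> borel_measurable lborel"
      using G unfolding set_integrable_def by (rule borel_measurable_integrable)
    show "(\<lambda>r. indicator {0<..} r *\<^sub>R G r) \<in> borel_measurable lborel" by (rule m)
    show "(\<lambda>r. indicator {x n..y n} r *\<^sub>R G r) \<in> borel_measurable lborel" for n
      using ac_posD(1)[OF ac x(1) xy] unfolding set_integrable_def by (rule borel_measurable_integrable)
    show "integrable lborel (\<lambda>r. norm (indicator {0<..} r *\<^sub>R G r))"
      using G unfolding set_integrable_def by (rule integrable_norm)
    show "AE r in lborel. (\<lambda>n. indicator {x n..y n} r *\<^sub>R G r) \<longlonglongrightarrow> indicator {0<..} r *\<^sub>R G r"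
    proof (rule AE_I2)
      fix r :: real
      have "\<forall>\<^sub>F n in sequentially. indicator {x n..y n} r *\<^sub>R G r = indicator {0<..} r *\<^sub>R G r"
      proof (cases "r > 0")
        case True
        have "\<forall>\<^sub>F n in sequentially. x n < r" using x0 True by (rule order_tendstoD)
        moreover have "\<forall>\<^sub>F n in sequentially. r < real n" 
          using filterlim_real_sequentially by (simp add: filterlim_at_top_dense)
        ultimately show ?thesis
        proof eventually_elim
          case (elim n)
          have "r \<le> y n" using elim y(1)[of n] by simp
          thus ?case using elim True by simp
        qed
      next
        case False
        have "r \<notin> {x n..y n}" for n using x(1)[of n] False by auto
        thus ?thesis using False by simp
      qed
      thus "(\<lambda>n. indicator {x n..y n} r *\<^sub>R G r) \<longlonglongrightarrow> indicator {0<..} r *\<^sub>R G r"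
        by (rule tendsto_eventually)
    qed
    show "AE r in lborel. norm (indicator {x n..y n} r *\<^sub>R G r) \<le> norm (indicator {0<..} r *\<^sub>R G r)" for n
      using x(1)[of n] by (auto split: split_indicator)
  qed
  have "(LINT r:{x n..y n}|lborel. G r) = F (y n) - F (x n)" for n
    by (rule ac_posD(2)[OF ac x(1) xy])
  hence "(\<lambda>n. LINT r:{x n..y n}|lborel. G r) \<longlonglongrightarrow> 0 - 0"
    using tendsto_diff[OF Fy Fx] by simp
  thus ?thesis using conv LIMSEQ_unique by fastforce
qed

section \<open>Weak derivatives on the half line\<close>

text \<open>
  Test functions on $(0,\infty)$ together with their derivative and an interval carrying both.
\<close>

definition half_line_test :: "real \<Rightarrow> real \<Rightarrow> (real \<Rightarrow> real) \<Rightarrow> (real \<Rightarrow> real) \<Rightarrow> bool" where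
  "half_line_test a b \<phi> \<phi>' \<longleftrightarrow> 0 < a \<and> a \<le> b \<and> (\<forall>r. (\<phi> has_real_derivative \<phi>' r) (at r)) \<and>
     continuous_on UNIV \<phi>' \<and> (\<forall>r. r \<notin> {a..b} \<longrightarrow> \<phi> r = 0 \<and> \<phi>' r = 0)"

lemma half_line_test_C1:
  assumes "half_line_test a b \<phi> \<phi>'"
  shows "C1_test_function {0<..} \<phi>" "frechet_derivative \<phi> (at r) 1 = \<phi>' r"
proof -
  have d: "(\<phi> has_derivative (*) (\<phi>' r)) (at r)" for r
    using assms by (simp add: half_line_test_def has_field_derivative_def)
  have fd: "frechet_derivative \<phi> (at r) = (*) (\<phi>' r)" for r
    using frechet_derivative_at[OF d] by simp
  show "frechet_derivative \<phi> (at r) 1 = \<phi>' r" by (simp add: fd)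
  have sub: "closure {x. \<phi> x \<noteq> 0} \<subseteq> {a..b}"
    using assms by (intro closure_minimal) (auto simp: half_line_test_def)
  have "compact (closure {x. \<phi> x \<noteq> 0})"
    using compact_Int_closed[OF compact_Icc[of a b] closed_closure[of "{x. \<phi> x \<noteq> 0}"]] sub
    by (simp add: Int_absorb1)
  thus "C1_test_function {0<..} \<phi>"
    unfolding C1_test_function_def using assms sub d
    by (auto simp: fd half_line_test_def differentiable_def)
qed

text \<open>
  A primitive on the whole line: the integral from \<open>0\<close> is taken as zero for negative
  arguments, which is consistent because \<open>k\<close> vanishes up to \<open>a\<close>.
\<close>

lemma antiderivative_vanishing:
  fixes k :: "real \<Rightarrow> real"
  assumes "0 < a" "continuous_on UNIV k" "\<And>r. r \<notin> {a..b} \<Longrightarrow> k r = 0"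
  shows "\<exists>H. (\<forall>r. (H has_real_derivative k r) (at r)) \<and> (\<forall>r. r \<le> a \<longrightarrow> H r = 0)"
proof -
  define H where "H r = integral {0..r} k" for r
  have ck: "continuous_on S k" for S using assms(2) by (rule continuous_on_subset) simp
  have Hlow: "H r = 0" if "r \<le> a" for r
  proof -
    have "integral {0..r} k = integral {0..r} (\<lambda>_. 0)"
      by (rule integral_spike[of "{a}"]) (use that assms(3) in auto)
    thus ?thesis by (simp add: H_def)
  qed
  have D: "(H has_real_derivative k r) (at r)" for r
  proof (cases "r < a")
    case True
    have "((\<lambda>_. 0 :: real) has_real_derivative 0) (at r)" by simp
    hence "(H has_real_derivative 0) (at r)"
      by (rule DERIV_cong_ev[THEN iffD1, rotated -1])
         (use True in \<open>auto intro!: eventually_mono[OF eventually_nhds_in_open[of "{..<a}" r]] simp: Hlow\<close>)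
    thus ?thesis using assms(3)[of r] True by simp
  next
    case False
    have "((\<lambda>x. integral {0..x} k) has_real_derivative k r) (at r within {0..r+1})"
      by (rule integral_has_real_derivative) (use False assms(1) ck in auto)
    thus ?thesis unfolding H_def using False assms(1) by (simp add: at_within_Icc_at)
  qed
  thus ?thesis using Hlow by blast
qed

lemma half_line_test_antiderivative:
  assumes "0 < a" "a \<le> b" "continuous_on UNIV k" "\<And>r. r \<notin> {a..b} \<Longrightarrow> k r = 0"
    and "(\<integral>r. k r \<partial>lborel) = 0"
  shows "\<exists>\<phi>. half_line_test a b \<phi> k"
proof -
  obtain H where D: "\<And>r. (H has_real_derivative k r) (at r)" and low: "\<And>r. r \<le> a \<Longrightarrow> H r = 0"
    using antiderivative_vanishing[OF assms(1,3,4)] by blast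
  have "H r = 0" if "b < r" for r
  proof -
    have "H r - H 0 = (\<integral>x. indicator {0..r} x *\<^sub>R k x \<partial>lborel)"
      by (rule integral_FTC_Icc[symmetric])
         (use D that assms(1,2) continuous_on_subset[OF assms(3)] in
            \<open>auto simp: has_real_derivative_iff_has_vector_derivative intro: has_vector_derivative_at_within\<close>)
    also have "\<dots> = (\<integral>x. k x \<partial>lborel)"
    proof (rule Bochner_Integration.integral_cong[OF refl])
      fix x show "indicator {0..r} x *\<^sub>R k x = k x"
        using assms(4)[of x] assms(1,2) that by (cases "x \<in> {a..b}") auto
    qed
    finally show ?thesis using assms(5) low[of 0] assms(1) by simp
  qed
  hence "half_line_test a b H k"
    unfolding half_line_test_def using assms D low by auto
  thus ?thesis by blast
qed

text \<open>
  Continuous functions with value 1 on \<open>{a..b}\<close> that fall to 0 with slope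
  \<open>n\<close>; they approximate the indicator of the interval.
\<close>

definition trapezoid :: "nat \<Rightarrow> real \<Rightarrow> real \<Rightarrow> real \<Rightarrow> real" where
  "trapezoid n a b r = max 0 (1 - real n * max 0 (max (a - r) (r - b)))"

lemma continuous_trapezoid: "continuous_on S (trapezoid n a b)"
  unfolding trapezoid_def[abs_def] by (intro continuous_intros)

lemma trapezoid_bounds: "0 \<le> trapezoid n a b r" "trapezoid n a b r \<le> 1"
  by (auto simp: trapezoid_def)

lemma trapezoid_eq_1: "r \<in> {a..b} \<Longrightarrow> trapezoid n a b r = 1"
  by (auto simp: trapezoid_def)

lemma trapezoid_eq_0:
  assumes "1 \<le> real n * \<delta>" "r \<notin> {a-\<delta>..b+\<delta>}" shows "trapezoid n a b r = 0"
proof -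
  have "\<delta> \<le> max 0 (max (a - r) (r - b))" using assms(2) by auto
  hence "real n * \<delta> \<le> real n * max 0 (max (a - r) (r - b))" by (intro mult_left_mono) auto
  thus ?thesis using assms(1) by (simp add: trapezoid_def)
qed

lemma trapezoid_tendsto_indicator:
  shows "(\<lambda>n. trapezoid n a b r) \<longlonglongrightarrow> indicator {a..b} r"
proof (cases "r \<in> {a..b}")
  case True thus ?thesis by (simp add: trapezoid_eq_1)
next
  case False
  define \<delta> where "\<delta> = max (a - r) (r - b) / 2"
  have \<delta>: "\<delta> > 0" "r \<notin> {a-\<delta>..b+\<delta>}" using False unfolding \<delta>_def by (auto simp: field_simps)
  have "\<forall>\<^sub>F n in sequentially. 1 / \<delta> \<le> real n"
    using filterlim_real_sequentially by (simp add: filterlim_at_top)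
  hence "\<forall>\<^sub>F n in sequentially. trapezoid n a b r = 0"
  proof eventually_elim
    case (elim n)
    show ?case by (rule trapezoid_eq_0[OF _ \<delta>(2)]) (use elim \<delta>(1) in \<open>simp add: field_simps\<close>)
  qed
  hence "(\<lambda>n. trapezoid n a b r) \<longlonglongrightarrow> 0" by (rule tendsto_eventually)
  thus ?thesis using False by simp
qed

lemma integrable_compact_weight:
  fixes k :: "real \<Rightarrow> real" and h :: "real \<Rightarrow> complex"
  assumes "set_integrable lborel {a..b} h" "continuous_on UNIV k" "\<And>r. r \<notin> {a..b} \<Longrightarrow> k r = 0"
  shows "integrable lborel (\<lambda>r. k r *\<^sub>R h r)"
proof -
  have "set_integrable lborel {a..b} (\<lambda>r. h r * complex_of_real (k r))"
    by (rule set_integrable_mult_continuous[OF assms(1)])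
       (intro continuous_intros continuous_on_subset[OF assms(2)] subset_UNIV)
  also have "(\<lambda>r. indicator {a..b} r *\<^sub>R (h r * complex_of_real (k r))) = (\<lambda>r. k r *\<^sub>R h r)"
    using assms(3) by (auto simp: fun_eq_iff scaleR_conv_of_real mult.commute split: split_indicator)
  ultimately show ?thesis by (simp add: set_integrable_def)
qed

lemma integral_trapezoid_tendsto:
  fixes h :: "real \<Rightarrow> complex"
  assumes ab: "0 < a" and h: "\<And>a b. 0 < a \<Longrightarrow> a \<le> b \<Longrightarrow> set_integrable lborel {a..b} h" and "a \<le> b"
  shows "(\<lambda>n. \<integral>r. trapezoid n a b r *\<^sub>R h r \<partial>lborel) \<longlonglongrightarrow> (LINT r:{a..b}|lborel. h r)"
proof -
  define S where "S = {a/2..b+a/2}"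
  have S: "set_integrable lborel S h" unfolding S_def using assms by (intro h) auto
  define g where "g r = indicator S r *\<^sub>R h r" for r
  have g: "integrable lborel g" using S by (simp add: g_def[abs_def] set_integrable_def)
  note [measurable] = borel_measurable_integrable[OF g]
  have [measurable]: "(\<lambda>r. trapezoid n a b r) \<in> borel_measurable borel" for n
    by (rule borel_measurable_continuous_onI[OF continuous_trapezoid])
  have "(\<lambda>n. \<integral>r. trapezoid n a b r *\<^sub>R g r \<partial>lborel) \<longlonglongrightarrow> (\<integral>r. indicator {a..b} r *\<^sub>R g r \<partial>lborel)"
  proof (rule integral_dominated_convergence[where w="\<lambda>r. norm (g r)"])
    show "AE r in lborel. (\<lambda>n. trapezoid n a b r *\<^sub>R g r) \<longlonglongrightarrow> indicator {a..b} r *\<^sub>R g r"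
      by (intro AE_I2 tendsto_intros trapezoid_tendsto_indicator)
    show "AE r in lborel. norm (trapezoid n a b r *\<^sub>R g r) \<le> norm (g r)" for n
      by (intro AE_I2) (auto simp: trapezoid_bounds intro: mult_left_le_one_le)
  qed (use g in auto)
  moreover have "(\<integral>r. indicator {a..b} r *\<^sub>R g r \<partial>lborel) = (LINT r:{a..b}|lborel. h r)"
    unfolding set_lebesgue_integral_def g_def S_def
    by (rule Bochner_Integration.integral_cong) (use ab in \<open>auto split: split_indicator\<close>)
  moreover have "\<forall>\<^sub>F n in sequentially. (\<integral>r. trapezoid n a b r *\<^sub>R g r \<partial>lborel) = (\<integral>r. trapezoid n a b r *\<^sub>R h r \<partial>lborel)"
  proof -
    have "\<forall>\<^sub>F n in sequentially. 2 / a \<le> real n"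
      using filterlim_real_sequentially by (simp add: filterlim_at_top)
    thus ?thesis
    proof eventually_elim
      case (elim n)
      show ?case
      proof (rule Bochner_Integration.integral_cong[OF refl])
        fix r
        have "1 \<le> real n * (a / 2)" using elim ab by (simp add: field_simps)
        hence "trapezoid n a b r = 0" if "r \<notin> S"
          by (rule trapezoid_eq_0) (use that in \<open>auto simp: S_def\<close>)
        thus "trapezoid n a b r *\<^sub>R g r = trapezoid n a b r *\<^sub>R h r"
          by (cases "r \<in> S") (auto simp: g_def)
      qed
    qed
  qed
  ultimately show ?thesis using Lim_transform_eventually by fastforce
qed

text \<open>
  The half lines generate the Borel sets and are closed under intersection, so by Dynkin's
  argument the integral of \<open>f\<close> vanishes over every Borel set.
\<close>

lemma AE_zero_from_half_lines:
  fixes f :: "real \<Rightarrow> complex"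
  assumes f: "integrable lborel f" and z: "\<And>x. (LINT r:{..x}|lborel. f r) = 0"
  shows "AE r in lborel. f r = 0"
proof (rule sigma_finite_measure.density_zero[OF sigma_finite_lborel f])
  fix A :: "real set" assume "A \<in> sets lborel"
  hence "A \<in> sigma_sets UNIV (range (\<lambda>a::real. {..a}))"
    by (simp add: borel_eq_atMost)
  have int: "set_integrable lborel B f" if "B \<in> sets lborel" for B
    using f that unfolding set_integrable_def by (rule integrable_mult_indicator[rotated])
  have sb: "B \<in> sets lborel" if "B \<in> sigma_sets UNIV (range (\<lambda>a::real. {..a}))" for B
    using that by (simp add: borel_eq_atMost)
  have tot: "(LINT r|lborel. f r) = 0"
  proof -
    have "(\<lambda>n. LINT r:{..real n}|lborel. f r) \<longlonglongrightarrow> (LINT r|lborel. f r)"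
      unfolding set_lebesgue_integral_def
    proof (rule integral_dominated_convergence[where w="\<lambda>r. norm (f r)"])
      show "AE r in lborel. (\<lambda>n. indicator {..real n} r *\<^sub>R f r) \<longlonglongrightarrow> f r"
      proof (rule AE_I2)
        fix r :: real
        have "\<forall>\<^sub>F n in sequentially. r \<le> real n"
          using filterlim_real_sequentially by (simp add: filterlim_at_top)
        hence "\<forall>\<^sub>F n in sequentially. indicator {..real n} r *\<^sub>R f r = f r"
          by eventually_elim simp
        thus "(\<lambda>n. indicator {..real n} r *\<^sub>R f r) \<longlonglongrightarrow> f r" by (rule tendsto_eventually)
      qed
    qed (use f in \<open>auto split: split_indicator\<close>)
    thus ?thesis using z LIMSEQ_unique[OF tendsto_const] by fastforce
  qed
  show "(LINT r:A|lborel. f r) = 0"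
    using \<open>A \<in> sigma_sets UNIV (range (\<lambda>a::real. {..a}))\<close>
  proof (rule sigma_sets_induct_disjoint[rotated 2])
    show "Int_stable (range (\<lambda>a::real. {..a}))"
      by (auto simp: Int_stable_def)
    show "range (\<lambda>a::real. {..a}) \<subseteq> Pow UNIV" by simp
    show "(LINT r:B|lborel. f r) = 0" if "B \<in> range (\<lambda>a::real. {..a})" for B
      using that z by auto
    show "(LINT r:{}|lborel. f r) = 0" by (simp add: set_lebesgue_integral_def)
    show "(LINT r:UNIV - B|lborel. f r) = 0"
      if B: "B \<in> sigma_sets UNIV (range (\<lambda>a::real. {..a}))" and "(LINT r:B|lborel. f r) = 0" for B
    proof -
      have "(LINT r:B \<union> (UNIV - B)|lborel. f r) = (LINT r:B|lborel. f r) + (LINT r:UNIV - B|lborel. f r)"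
        using sb[OF B] by (intro set_integral_Un int) auto
      moreover have "(LINT r:B \<union> (UNIV - B)|lborel. f r) = 0"
        using tot by (simp add: set_lebesgue_integral_def)
      ultimately show ?thesis using that by simp
    qed
    show "(LINT r:(\<Union>i. B i)|lborel. f r) = 0"
      if dis: "disjoint_family B" and B: "range B \<subseteq> sigma_sets UNIV (range (\<lambda>a::real. {..a}))"
        and B0: "\<And>i::nat. (LINT r:B i|lborel. f r) = 0" for B
    proof -
      have "B i \<in> sets lborel" for i using B sb by auto
      hence "(\<Union>i. B i) \<in> sets lborel" by (intro sets.countable_UN) auto
      have "(LINT r:(\<Union>i. B i)|lborel. f r) = (\<Sum>i. (LINT r:B i|lborel. f r))"
        by (rule lebesgue_integral_countable_add)
           (use \<open>\<And>i. B i \<in> sets lborel\<close> dis int[OF \<open>(\<Union>i. B i) \<in> sets lborel\<close>] in \<open>auto simp: disjoint_family_on_def\<close>)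
      thus ?thesis by (simp add: B0)
    qed
  qed
qed

lemma AE_zero_from_intervals:
  fixes h :: "real \<Rightarrow> complex"
  assumes h: "\<And>a b. 0 < a \<Longrightarrow> a \<le> b \<Longrightarrow> set_integrable lborel {a..b} h"
    and z: "\<And>a b. 0 < a \<Longrightarrow> a \<le> b \<Longrightarrow> (LINT r:{a..b}|lborel. h r) = 0"
  shows "AE r in lborel. 0 < r \<longrightarrow> h r = 0"
proof -
  have "AE r in lborel. indicator {1 / real (Suc n)..real (Suc n)} r *\<^sub>R h r = 0" for n
  proof (rule AE_zero_from_half_lines)
    have le: "1 / real (Suc n) \<le> real (Suc n)" 
      using mult_mono[of 1 "real (Suc n)" 1 "real (Suc n)"] by (simp add: divide_le_eq)
    show "integrable lborel (\<lambda>r. indicator {1 / real (Suc n)..real (Suc n)} r *\<^sub>R h r)"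
      using h[OF _ le] by (simp add: set_integrable_def)
    fix x :: real
    define m where "m = min x (real (Suc n))"
    have "(LINT r:{..x}|lborel. indicator {1 / real (Suc n)..real (Suc n)} r *\<^sub>R h r) = (LINT r:{1 / real (Suc n)..m}|lborel. h r)"
      unfolding set_lebesgue_integral_def
      by (rule Bochner_Integration.integral_cong) (auto simp: m_def split: split_indicator)
    also have "\<dots> = 0"
    proof (cases "1 / real (Suc n) \<le> m")
      case True thus ?thesis by (intro z) auto
    next
      case False thus ?thesis by (simp add: set_lebesgue_integral_def)
    qed
    finally show "(LINT r:{..x}|lborel. indicator {1 / real (Suc n)..real (Suc n)} r *\<^sub>R h r) = 0" .
  qed
  hence "AE r in lborel. \<forall>n. indicator {1 / real (Suc n)..real (Suc n)} r *\<^sub>R h r = 0"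
    unfolding AE_all_countable by blast
  thus ?thesis
  proof eventually_elim
    case (elim r)
    show ?case
    proof
      assume "0 < r"
      obtain n where n: "max r (1 / r) < real n" using reals_Archimedean2 by blast
      hence "1 / r < real (Suc n)" "r \<le> real (Suc n)" by auto
      hence "r \<in> {1 / real (Suc n)..real (Suc n)}" using \<open>0 < r\<close> by (simp add: field_simps)
      thus "h r = 0" using elim by (metis indicator_simps(1) scaleR_one)
    qed
  qed
qed

text \<open>
  A continuous function \<open>k\<close> with compact support is the derivative of a test function
  iff its integral vanishes. Taking for \<open>k\<close> an approximate indicator of $[a,b]$ minus
  a multiple of one of $[1,2]$ shows that the mean of \<open>h\<close> over any interval equals
  its mean over $[1,2]$.
\<close>

lemma du_Bois_Reymond:
  fixes h :: "real \<Rightarrow> complex"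
  assumes h: "\<And>a b. 0 < a \<Longrightarrow> a \<le> b \<Longrightarrow> set_integrable lborel {a..b} h"
    and z: "\<And>a b \<phi> \<phi>'. half_line_test a b \<phi> \<phi>' \<Longrightarrow> (\<integral>r. \<phi>' r *\<^sub>R h r \<partial>lborel) = 0"
  shows "\<exists>c. AE r in lborel. 0 < r \<longrightarrow> h r = c"
proof -
  define c where "c = (LINT r:{1..2}|lborel. h r)"
  have one: "set_integrable lborel {a..b} (\<lambda>_. 1 :: complex)" for a b :: real
    by (rule borel_integrable_atLeastAtMost') simp
  have T1: "(\<lambda>n. \<integral>r. trapezoid n a b r \<partial>lborel) \<longlonglongrightarrow> b - a" if "0 < a" "a \<le> b" for a b
  proof -
    have "(\<lambda>n. \<integral>r. trapezoid n a b r *\<^sub>R (1::complex) \<partial>lborel) \<longlonglongrightarrow> (LINT r:{a..b}|lborel. 1)"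
      using that by (intro integral_trapezoid_tendsto one)
    hence "(\<lambda>n. complex_of_real (\<integral>r. trapezoid n a b r \<partial>lborel)) \<longlonglongrightarrow> complex_of_real (b - a)"
      using that by (simp add: scaleR_conv_of_real set_lebesgue_integral_def)
    thus ?thesis by (simp only: tendsto_of_real_iff)
  qed
  have key: "(LINT r:{a..b}|lborel. h r) = of_real (b - a) * c" if ab: "0 < a" "a \<le> b" for a b
  proof -
    define I where "I n a b = (\<integral>r. trapezoid n a b r \<partial>lborel)" for n a b
    define J where "J n a b = (\<integral>r. trapezoid n a b r *\<^sub>R h r \<partial>lborel)" for n a b
    \<comment> \<open>\<open>[A, B]\<close> carries both trapezoids once their slope is at least \<open>2 / a\<close> and \<open>2\<close>.\<close>
    define A where "A = min (a/2) (1/2)"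
    define B where "B = max (b+a/2) 3"
    have AB: "0 < A" "A \<le> B" using ab by (auto simp: A_def B_def)
    have I12: "(\<lambda>n. I n 1 2) \<longlonglongrightarrow> 1" using T1[of 1 2] by (simp add: I_def)
    have lim: "(\<lambda>n. J n a b - of_real (I n a b / I n 1 2) * J n 1 2) \<longlonglongrightarrow>
        (LINT r:{a..b}|lborel. h r) - of_real ((b - a) / 1) * c"
      unfolding c_def J_def I_def
      by (intro tendsto_intros integral_trapezoid_tendsto h T1 I12[unfolded I_def] ab) auto
    have "\<forall>\<^sub>F n in sequentially. max (2 / a) 2 \<le> real n"
      using filterlim_real_sequentially unfolding filterlim_at_top by blast
    moreover have "\<forall>\<^sub>F n in sequentially. I n 1 2 > 1/2"
      using I12 by (rule order_tendstoD) simp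
    ultimately have "\<forall>\<^sub>F n in sequentially. J n a b - of_real (I n a b / I n 1 2) * J n 1 2 = 0"
    proof eventually_elim
      case (elim n)
      have na: "1 \<le> real n * (a / 2)" using elim ab by (simp add: field_simps)
      have n1: "1 \<le> real n * (1 / 2)" using elim by simp
      have z1: "trapezoid n a b r = 0" if "r \<notin> {A..B}" for r
        by (rule trapezoid_eq_0[OF na]) (use that in \<open>auto simp: A_def B_def\<close>)
      have z2: "trapezoid n 1 2 r = 0" if "r \<notin> {A..B}" for r
        by (rule trapezoid_eq_0[OF n1]) (use that in \<open>auto simp: A_def B_def\<close>)
      define lam where "lam = I n a b / I n 1 2"
      define k where "k r = trapezoid n a b r - lam * trapezoid n 1 2 r" for r
      have int: "integrable lborel (trapezoid n a b)" "integrable lborel (trapezoid n 1 2)"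
      proof -
        have "integrable lborel (\<lambda>r. indicator {A..B} r *\<^sub>R trapezoid n a b r)"
          using borel_integrable_atLeastAtMost'[OF continuous_trapezoid] by (simp add: set_integrable_def)
        moreover have "(\<lambda>r. indicator {A..B} r *\<^sub>R trapezoid n a b r) = trapezoid n a b"
          using z1 by (auto simp: fun_eq_iff split: split_indicator)
        ultimately show "integrable lborel (trapezoid n a b)" by simp
        have "integrable lborel (\<lambda>r. indicator {A..B} r *\<^sub>R trapezoid n 1 2 r)"
          using borel_integrable_atLeastAtMost'[OF continuous_trapezoid] by (simp add: set_integrable_def)
        moreover have "(\<lambda>r. indicator {A..B} r *\<^sub>R trapezoid n 1 2 r) = trapezoid n 1 2"
          using z2 by (auto simp: fun_eq_iff split: split_indicator)
        ultimately show "integrable lborel (trapezoid n 1 2)" by simp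
      qed
      have "\<exists>\<phi>. half_line_test A B \<phi> k"
      proof (rule half_line_test_antiderivative[OF AB])
        show "continuous_on UNIV k" unfolding k_def by (intro continuous_intros continuous_trapezoid)
        show "k r = 0" if "r \<notin> {A..B}" for r using z1 z2 that by (simp add: k_def)
        show "(\<integral>r. k r \<partial>lborel) = 0"
          using int elim by (simp add: k_def lam_def I_def)
      qed
      hence "(\<integral>r. k r *\<^sub>R h r \<partial>lborel) = 0" using z by blast
      moreover have "(\<integral>r. k r *\<^sub>R h r \<partial>lborel) = (\<integral>r. trapezoid n a b r *\<^sub>R h r - of_real lam * (trapezoid n 1 2 r *\<^sub>R h r) \<partial>lborel)"
        by (rule Bochner_Integration.integral_cong) (auto simp: k_def scaleR_conv_of_real algebra_simps)
      moreover have "\<dots> = J n a b - of_real lam * J n 1 2"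
      proof -
        have "integrable lborel (\<lambda>r. trapezoid n a b r *\<^sub>R h r)" "integrable lborel (\<lambda>r. trapezoid n 1 2 r *\<^sub>R h r)"
          by (rule integrable_compact_weight[OF h[OF AB] continuous_trapezoid]; simp add: z1 z2)+
        thus ?thesis
          unfolding J_def by (simp only: Bochner_Integration.integral_diff integrable_mult_right integral_mult_right_zero)
      qed
      ultimately show ?case by (simp add: lam_def)
    qed
    hence "(\<lambda>n. J n a b - of_real (I n a b / I n 1 2) * J n 1 2) \<longlonglongrightarrow> 0" by (rule tendsto_eventually)
    from LIMSEQ_unique[OF lim this] show ?thesis by simp
  qed
  have "AE r in lborel. 0 < r \<longrightarrow> h r - c = 0"
  proof (rule AE_zero_from_intervals)
    have ci: "set_integrable lborel {a..b} (\<lambda>_. c)" for a b :: real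
      by (rule borel_integrable_atLeastAtMost') simp
    show "set_integrable lborel {a..b} (\<lambda>r. h r - c)" if "0 < a" "a \<le> b" for a b
      using h[OF that] ci by (rule set_integral_diff)
    show "(LINT r:{a..b}|lborel. h r - c) = 0" if "0 < a" "a \<le> b" for a b
      using set_integral_diff(2)[OF h[OF that] ci] key[OF that] that
      by (simp add: set_lebesgue_integral_def scaleR_conv_of_real)
  qed
  hence "AE r in lborel. 0 < r \<longrightarrow> h r = c" by simp
  thus ?thesis by blast
qed

lemma set_integral_Icc_combine:
  fixes g :: "real \<Rightarrow> complex"
  assumes "set_integrable lborel {a..b} g" "a \<le> c" "c \<le> b"
  shows "(LINT r:{a..b}|lborel. g r) = (LINT r:{a..c}|lborel. g r) + (LINT r:{c..b}|lborel. g r)"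
proof -
  have s: "set_integrable lborel {a..c} g" "set_integrable lborel {c..b} g"
    using assms by (auto intro: set_integrable_subset)
  show ?thesis
    using Henstock_Kurzweil_Integration.integral_combine[OF assms(2,3) set_borel_integral_eq_integral(1)[OF assms(1)]]
    by (simp add: set_borel_integral_eq_integral(2) assms(1) s)
qed

lemma ac_pos_primitive:
  fixes g :: "real \<Rightarrow> complex"
  assumes g: "\<And>a b. 0 < a \<Longrightarrow> a \<le> b \<Longrightarrow> set_integrable lborel {a..b} g"
  shows "\<exists>F. ac_pos F g"
proof -
  define F where "F r = (if 1 \<le> r then (LINT x:{1..r}|lborel. g x) else - (LINT x:{r..1}|lborel. g x))" for r
  have "ac_pos F g"
    unfolding ac_pos_def
  proof (intro allI impI)
    fix a b :: real assume ab: "0 < a" "a \<le> b"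
    consider "1 \<le> a" | "a < 1" "1 \<le> b" | "b < 1" by linarith
    hence "F b - F a = (LINT x:{a..b}|lborel. g x)"
    proof cases
      case 1
      thus ?thesis using set_integral_Icc_combine[of 1 b g a] g[of 1 b] ab by (simp add: F_def)
    next
      case 2
      thus ?thesis using set_integral_Icc_combine[of a b g 1] g[of a b] ab by (simp add: F_def)
    next
      case 3
      thus ?thesis using set_integral_Icc_combine[of a 1 g b] g[of a 1] ab by (simp add: F_def)
    qed
    thus "set_integrable lborel {a..b} g \<and> F b - F a = (LINT x:{a..b}|lborel. g x)"
      using g[OF ab] by simp
  qed
  thus ?thesis by blast
qed

lemma half_line_test_ac:
  assumes "half_line_test a b \<phi> \<phi>'"
  shows "ac_pos (\<lambda>r. complex_of_real (\<phi> r)) (\<lambda>r. complex_of_real (\<phi>' r))"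
proof (rule ac_pos_C1)
  show "continuous_on {0<..} (\<lambda>r. complex_of_real (\<phi>' r))"
    using assms unfolding half_line_test_def
    by (intro continuous_intros) (auto intro: continuous_on_subset)
  show "((\<lambda>r. complex_of_real (\<phi> r)) has_vector_derivative complex_of_real (\<phi>' r)) (at r)" for r
    using assms unfolding half_line_test_def 
    by (intro has_vector_derivative_of_real) (auto simp: has_real_derivative_iff_has_vector_derivative[symmetric])
qed

lemma integration_by_parts_test:
  assumes t: "half_line_test a b \<phi> \<phi>'" and F: "ac_pos F g"
  shows "(\<integral>r. \<phi>' r *\<^sub>R F r \<partial>lborel) = - (\<integral>r. \<phi> r *\<^sub>R g r \<partial>lborel)"
    "integrable lborel (\<lambda>r. \<phi>' r *\<^sub>R F r)" "integrable lborel (\<lambda>r. \<phi> r *\<^sub>R g r)"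
proof -
  define A where "A = a / 2"
  define B where "B = b + 1"
  have ab: "0 < a" "a \<le> b" and zero: "\<And>r. r \<notin> {a..b} \<Longrightarrow> \<phi> r = 0 \<and> \<phi>' r = 0"
    and c': "continuous_on UNIV \<phi>'" and d: "\<And>r. (\<phi> has_real_derivative \<phi>' r) (at r)"
    using t by (auto simp: half_line_test_def)
  have c: "continuous_on UNIV \<phi>" by (rule DERIV_continuous_on[OF d])
  have AB: "0 < A" "A \<le> B" using ab by (auto simp: A_def B_def)
  have z: "\<phi> r = 0" "\<phi>' r = 0" if "r \<notin> {A..B}" for r
    using zero[of r] that ab by (auto simp: A_def B_def)
  have intF: "set_integrable lborel {A..B} F"
    by (rule borel_integrable_atLeastAtMost') (use AB in \<open>auto intro: continuous_on_subset[OF ac_pos_continuous[OF F]]\<close>)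
  show i1: "integrable lborel (\<lambda>r. \<phi>' r *\<^sub>R F r)"
    by (rule integrable_compact_weight[OF intF c' z(2)])
  show i2: "integrable lborel (\<lambda>r. \<phi> r *\<^sub>R g r)"
    by (rule integrable_compact_weight[OF ac_posD(1)[OF F AB] c z(1)])
  have "(LINT r:{A..B}|lborel. complex_of_real (\<phi>' r) * F r + complex_of_real (\<phi> r) * g r)
      = of_real (\<phi> B) * F B - of_real (\<phi> A) * F A"
    by (rule ac_posD(2)[OF ac_pos_mult[OF half_line_test_ac[OF t] F] AB])
  also have "\<dots> = 0" using zero[of A] zero[of B] ab by (simp add: A_def B_def)
  also have "(LINT r:{A..B}|lborel. complex_of_real (\<phi>' r) * F r + complex_of_real (\<phi> r) * g r)
      = (\<integral>r. \<phi>' r *\<^sub>R F r + \<phi> r *\<^sub>R g r \<partial>lborel)"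
    unfolding set_lebesgue_integral_def
  proof (rule Bochner_Integration.integral_cong[OF refl])
    fix r show "indicator {A..B} r *\<^sub>R (complex_of_real (\<phi>' r) * F r + complex_of_real (\<phi> r) * g r) = \<phi>' r *\<^sub>R F r + \<phi> r *\<^sub>R g r"
      using z[of r] by (cases "r \<in> {A..B}") (auto simp: scaleR_conv_of_real)
  qed
  also have "\<dots> = (\<integral>r. \<phi>' r *\<^sub>R F r \<partial>lborel) + (\<integral>r. \<phi> r *\<^sub>R g r \<partial>lborel)"
    using i1 i2 by simp
  finally show "(\<integral>r. \<phi>' r *\<^sub>R F r \<partial>lborel) = - (\<integral>r. \<phi> r *\<^sub>R g r \<partial>lborel)"
    by (simp add: eq_neg_iff_add_eq_0)
qed

text \<open>
  A primitive of the weak derivative has the same weak derivative by the product rule, so it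
  differs from \<open>u\<close> by a constant.
\<close>

theorem weak_derivative_ac:
  assumes "has_weak_derivative {0<..} (1::real) u g"
  shows "\<exists>F. ac_pos F g \<and> (AE r in lborel. 0 < r \<longrightarrow> u r = F r)"
proof -
  have u: "set_integrable lborel {a..b} u" and g: "set_integrable lborel {a..b} g" if "0 < a" "a \<le> b" for a b
  proof -
    have "compact {a..b}" "{a..b} \<subseteq> {0<..}" using that by auto
    thus "set_integrable lborel {a..b} u" "set_integrable lborel {a..b} g"
      using assms unfolding has_weak_derivative_def locally_integrable_def by blast+
  qed
  obtain F where F: "ac_pos F g" using ac_pos_primitive[OF g] by blast
  have Fi: "set_integrable lborel {a..b} F" if "0 < a" "a \<le> b" for a b
    by (rule borel_integrable_atLeastAtMost') (use that in \<open>auto intro: continuous_on_subset[OF ac_pos_continuous[OF F]]\<close>)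
  have "\<exists>c. AE r in lborel. 0 < r \<longrightarrow> u r - F r = c"
  proof (rule du_Bois_Reymond)
    show "set_integrable lborel {a..b} (\<lambda>r. u r - F r)" if "0 < a" "a \<le> b" for a b
      using u[OF that] Fi[OF that] by (rule set_integral_diff)
    show "(\<integral>r. \<phi>' r *\<^sub>R (u r - F r) \<partial>lborel) = 0" if t: "half_line_test a b \<phi> \<phi>'" for a b \<phi> \<phi>'
    proof -
      have ab: "0 < a" "a \<le> b" and c': "continuous_on UNIV \<phi>'" and z: "\<And>r. r \<notin> {a..b} \<Longrightarrow> \<phi>' r = 0"
        using t by (auto simp: half_line_test_def)
      have "integrable lborel (\<lambda>r. \<phi>' r *\<^sub>R u r)"
        by (rule integrable_compact_weight[OF u[OF ab] c' z])
      hence "(\<integral>r. \<phi>' r *\<^sub>R (u r - F r) \<partial>lborel) = (\<integral>r. \<phi>' r *\<^sub>R u r \<partial>lborel) - (\<integral>r. \<phi>' r *\<^sub>R F r \<partial>lborel)"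
        using integration_by_parts_test(2)[OF t F] by (simp add: scaleR_diff_right)
      also have "(\<integral>r. \<phi>' r *\<^sub>R u r \<partial>lborel) = - (\<integral>r. \<phi> r *\<^sub>R g r \<partial>lborel)"
        using assms half_line_test_C1(1)[OF t] unfolding has_weak_derivative_def half_line_test_C1(2)[OF t, symmetric] by blast
      finally show ?thesis using integration_by_parts_test(1)[OF t F] by simp
    qed
  qed
  then obtain c where c: "AE r in lborel. 0 < r \<longrightarrow> u r - F r = c" by blast
  have const: "ac_pos (\<lambda>_. c) (\<lambda>_. 0)" by (simp add: ac_pos_def set_lebesgue_integral_def set_integrable_def)
  have "ac_pos (\<lambda>r. F r + c) g" using ac_pos_add[OF F const] by simp
  moreover have "AE r in lborel. 0 < r \<longrightarrow> u r = F r + c"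
    using c by eventually_elim (auto simp: algebra_simps)
  ultimately show ?thesis by blast
qed

lemma ac_pos_AE_cong:
  assumes "ac_pos F g" "AE r in lborel. 0 < r \<longrightarrow> g r = g' r" "\<And>a b. 0 < a \<Longrightarrow> a \<le> b \<Longrightarrow> set_integrable lborel {a..b} g'"
  shows "ac_pos F g'"
  unfolding ac_pos_def
proof (intro allI impI)
  fix a b :: real assume ab: "0 < a" "a \<le> b"
  note D = ac_posD[OF assms(1) ab]
  have "(LINT r:{a..b}|lborel. g r) = (LINT r:{a..b}|lborel. g' r)"
    unfolding set_lebesgue_integral_def
  proof (rule integral_cong_AE)
    show "(\<lambda>r. indicator {a..b} r *\<^sub>R g r) \<in> borel_measurable lborel"
      using D(1) unfolding set_integrable_def by (rule borel_measurable_integrable)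
    show "(\<lambda>r. indicator {a..b} r *\<^sub>R g' r) \<in> borel_measurable lborel"
      using assms(3)[OF ab] unfolding set_integrable_def by (rule borel_measurable_integrable)
    show "AE r in lborel. indicator {a..b} r *\<^sub>R g r = indicator {a..b} r *\<^sub>R g' r"
      using assms(2) by eventually_elim (use ab in \<open>auto split: split_indicator\<close>)
  qed
  thus "set_integrable lborel {a..b} g' \<and> F b - F a = (LINT r:{a..b}|lborel. g' r)"
    using D(2) assms(3)[OF ab] by simp
qed

section \<open>The radial measure\<close>

text \<open>
  Fatou's lemma in the form that also yields integrability of the limit.
\<close>

lemma Fatou_bounded:
  fixes u :: "'a \<Rightarrow> real"
  assumes f: "\<And>n. integrable M (f n)" "\<And>n x. 0 \<le> f n x" "\<And>n::nat. (\<integral>x. f n x \<partial>M) \<le> C"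
    and lim: "AE x in M. (\<lambda>n. f n x) \<longlonglongrightarrow> u x" and u: "u \<in> borel_measurable M" 
  shows "integrable M u" "(\<integral>x. u x \<partial>M) \<le> C"
proof -
  have C: "0 \<le> C" using f(3)[of 0] Bochner_Integration.integral_nonneg[of M "f 0"] f(2) by (meson order_trans)
  have u0: "AE x in M. 0 \<le> u x"
    using lim by eventually_elim (rule LIMSEQ_le_const, auto simp: f(2))
  have "(\<integral>\<^sup>+x. ennreal (u x) \<partial>M) = (\<integral>\<^sup>+x. liminf (\<lambda>n. ennreal (f n x)) \<partial>M)"
  proof (rule nn_integral_cong_AE)
    show "AE x in M. ennreal (u x) = liminf (\<lambda>n. ennreal (f n x))"
      using lim
    proof eventually_elim
      case (elim x)
      hence "(\<lambda>n. ennreal (f n x)) \<longlonglongrightarrow> ennreal (u x)" by (rule tendsto_ennrealI)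
      thus ?case by (rule lim_imp_Liminf[OF sequentially_bot, symmetric])
    qed
  qed
  also have "\<dots> \<le> liminf (\<lambda>n. \<integral>\<^sup>+x. ennreal (f n x) \<partial>M)"
    by (rule nn_integral_liminf) (use f(1) in auto)
  also have "\<dots> \<le> ennreal C"
  proof -
    have "liminf (\<lambda>n. \<integral>\<^sup>+x. ennreal (f n x) \<partial>M) \<le> liminf (\<lambda>n::nat. ennreal C)"
      by (rule Liminf_mono, rule always_eventually) (use f in \<open>auto simp: nn_integral_eq_integral ennreal_leI\<close>)
    thus ?thesis by (simp add: Liminf_const)
  qed
  finally have le: "(\<integral>\<^sup>+x. ennreal (u x) \<partial>M) \<le> ennreal C" .
  show "integrable M u"
  proof (rule integrableI_bounded[OF u])
    have "(\<integral>\<^sup>+x. ennreal (norm (u x)) \<partial>M) = (\<integral>\<^sup>+x. ennreal (u x) \<partial>M)"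
      by (rule nn_integral_cong_AE) (use u0 in \<open>eventually_elim, auto\<close>)
    thus "(\<integral>\<^sup>+x. ennreal (norm (u x)) \<partial>M) < \<infinity>" using le by (simp add: le_less_trans)
  qed
  hence "ennreal (\<integral>x. u x \<partial>M) \<le> ennreal C" using le u0 by (simp add: nn_integral_eq_integral)
  thus "(\<integral>x. u x \<partial>M) \<le> C" using C by simp
qed

text \<open>
  For $c = d \, |B_1|$ and $k = d - 1$ this is the image of Lebesgue measure on $d$-space under
  the norm.
\<close>

definition radial_measure :: "real \<Rightarrow> nat \<Rightarrow> real measure" where
  "radial_measure c k = density lborel (\<lambda>r. ennreal (indicator {0<..} r * (c * r ^ k)))"

lemma sets_radial_measure [simp, measurable_cong]: "sets (radial_measure c k) = sets borel"
  by (simp add: radial_measure_def)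

lemma space_radial_measure [simp]: "space (radial_measure c k) = UNIV"
  by (simp add: radial_measure_def)

lemma borel_measurable_radial_measure: "borel_measurable (radial_measure c k) = borel_measurable borel"
  by (rule measurable_cong_sets) auto

text \<open>
  It suffices to compare the two measures on half lines, that is, to know the volume of balls.
\<close>

lemma distr_norm_lborel:
  "distr (lborel :: 'a::euclidean_space measure) borel norm
     = radial_measure (DIM('a) * unit_ball_vol DIM('a)) (DIM('a) - 1)" (is "?L = ?R")
proof (rule measure_eqI_generator_eq[where E="range (\<lambda>a::real. {..a})" and \<Omega>=UNIV and A="\<lambda>n. {..real n}"])
  let ?c = "real DIM('a) * unit_ball_vol DIM('a)"
  have DIM: "Suc (DIM('a) - 1) = DIM('a)" using DIM_positive[where 'a='a] by simp
  have L: "emeasure ?L {..a} = (if a \<ge> 0 then ennreal (unit_ball_vol DIM('a) * a ^ DIM('a)) else 0)" for a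
  proof -
    have "emeasure ?L {..a} = emeasure lborel (norm -` {..a} \<inter> space (lborel :: 'a measure))"
      by (rule emeasure_distr) auto
    also have "norm -` {..a} \<inter> space (lborel :: 'a measure) = (cball 0 a :: 'a set)" by auto
    also have "emeasure lborel \<dots> = (if a \<ge> 0 then ennreal (unit_ball_vol DIM('a) * a ^ DIM('a)) else 0)"
      by (simp add: emeasure_cball)
    finally show ?thesis .
  qed
  have R: "emeasure ?R {..a} = (if a \<ge> 0 then ennreal (unit_ball_vol DIM('a) * a ^ DIM('a)) else 0)" for a
  proof -
    have "emeasure ?R {..a} = (\<integral>\<^sup>+r. ennreal (indicator {0<..} r * (?c * r ^ (DIM('a) - 1))) * indicator {..a} r \<partial>lborel)"
      unfolding radial_measure_def by (subst emeasure_density) auto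
    also have "\<dots> = (if a \<ge> 0 then ennreal (unit_ball_vol DIM('a) * a ^ DIM('a)) else 0)"
    proof (cases "a \<ge> 0")
      case True
      have "(\<integral>\<^sup>+r. ennreal (indicator {0<..} r * (?c * r ^ (DIM('a) - 1))) * indicator {..a} r \<partial>lborel)
        = (\<integral>\<^sup>+r. ennreal (?c * r ^ (DIM('a) - 1)) * indicator {0..a} r \<partial>lborel)"
      proof (rule nn_integral_cong_AE)
        show "AE r in lborel. ennreal (indicator {0<..} r * (?c * r ^ (DIM('a) - 1))) * indicator {..a} r
            = ennreal (?c * r ^ (DIM('a) - 1)) * indicator {0..a} r"
          using AE_lborel_singleton[of 0] by eventually_elim (auto split: split_indicator)
      qed
      also have "\<dots> = ennreal (unit_ball_vol DIM('a) * a ^ DIM('a) - unit_ball_vol DIM('a) * 0 ^ DIM('a))"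
        by (rule nn_integral_FTC_Icc) (use True in \<open>auto intro!: derivative_eq_intros\<close>)
      finally show ?thesis using True by simp
    next
      case False
      hence "(\<integral>\<^sup>+r. ennreal (indicator {0<..} r * (?c * r ^ (DIM('a) - 1))) * indicator {..a} r \<partial>lborel) = (\<integral>\<^sup>+r. 0 \<partial>(lborel :: real measure))"
        by (intro nn_integral_cong) (auto split: split_indicator)
      thus ?thesis using False by simp
    qed
    finally show ?thesis .
  qed
  show "emeasure ?L X = emeasure ?R X" if "X \<in> range (\<lambda>a::real. {..a})" for X
    using that L R by auto
  show "emeasure ?L {..real n} \<noteq> \<infinity>" for n by (simp add: L)
  show "(\<Union>n. {..real n}) = UNIV" by (auto intro: real_arch_simple)
qed (auto simp: Int_stable_def borel_eq_atMost)

text \<open>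
  The condition \<open>1 \<le> k\<close> says that the dimension is at least 2. It makes the
  weight vanish at the origin at least linearly, and with it the boundary terms there.
\<close>

locale radial_weight =
  fixes c :: real and k :: nat
  assumes c_pos: "0 < c" and k_pos: "1 \<le> k"
begin

definition weight :: "real \<Rightarrow> real" where "weight r = c * r ^ k"

abbreviation \<mu> :: "real measure" where "\<mu> \<equiv> radial_measure c k"

lemma weight_pos: "0 < r \<Longrightarrow> 0 < weight r" by (simp add: weight_def c_pos)

lemma measurable_\<mu> [simp]: "borel_measurable \<mu> = borel_measurable borel"
  by (rule borel_measurable_radial_measure)

lemma AE_\<mu>: "(AE r in \<mu>. P r) \<longleftrightarrow> (AE r in lborel. 0 < r \<longrightarrow> P r)"
  unfolding radial_measure_def
  by (subst AE_density) (use weight_pos in \<open>auto simp: weight_def indicator_def intro!: AE_cong\<close>)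

lemma integrable_\<mu>:
  fixes f :: "real \<Rightarrow> 'b::{banach, second_countable_topology}"
  assumes [measurable]: "f \<in> borel_measurable borel"
  shows "integrable \<mu> f \<longleftrightarrow> set_integrable lborel {0<..} (\<lambda>r. weight r *\<^sub>R f r)"
proof -
  have "integrable \<mu> f \<longleftrightarrow> integrable lborel (\<lambda>r. (indicator {0<..} r * (c * r ^ k)) *\<^sub>R f r)"
    unfolding radial_measure_def
    by (rule integrable_density) (use c_pos in \<open>auto split: split_indicator\<close>)
  thus ?thesis by (simp add: set_integrable_def weight_def)
qed

lemma integral_\<mu>:
  fixes f :: "real \<Rightarrow> 'b::{banach, second_countable_topology}"
  assumes [measurable]: "f \<in> borel_measurable borel"
  shows "(\<integral>r. f r \<partial>\<mu>) = (LINT r:{0<..}|lborel. weight r *\<^sub>R f r)"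
proof -
  have "(\<integral>r. f r \<partial>\<mu>) = (\<integral>r. (indicator {0<..} r * (c * r ^ k)) *\<^sub>R f r \<partial>lborel)"
    unfolding radial_measure_def
    by (rule integral_density) (use c_pos in \<open>auto split: split_indicator\<close>)
  thus ?thesis by (simp add: set_lebesgue_integral_def weight_def)
qed

end

text \<open>
  The approximations are the forward means $h^{-1} \int_r^{r+h} \zeta$; as difference quotients of
  a primitive they converge pointwise, and by the mean value theorem they respect bounds and
  supports.
\<close>

lemma half_line_test_approximation:
  fixes \<zeta> :: "real \<Rightarrow> real"
  assumes a: "0 < a" "a \<le> b" and cont: "continuous_on UNIV \<zeta>" and z: "\<And>r. r \<notin> {a..b} \<Longrightarrow> \<zeta> r = 0"
    and bd: "\<And>r. \<bar>\<zeta> r\<bar> \<le> C"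
  shows "\<exists>\<eta> \<eta>'. (\<forall>n. half_line_test (a/2) b (\<eta> n) (\<eta>' n)) \<and> (\<forall>n r. \<bar>\<eta> n r\<bar> \<le> C) \<and>
     (\<forall>r. (\<lambda>n::nat. \<eta> n r) \<longlonglongrightarrow> \<zeta> r)"
proof -
  obtain H where D: "\<And>r. (H has_real_derivative \<zeta> r) (at r)" and low: "\<And>r. r \<le> a \<Longrightarrow> H r = 0"
    using antiderivative_vanishing[OF a(1) cont z] by blast
  \<comment> \<open>at most \<open>a / 2\<close>, so that the means still vanish below \<open>a / 2\<close>\<close>
  define h where "h n = min (a / 2) (1 / real (Suc n))" for n
  have h: "0 < h n" "h n \<le> a / 2" for n using a by (auto simp: h_def)
  have h0: "h \<longlonglongrightarrow> 0"
  proof (rule tendsto_sandwich[OF _ _ tendsto_const])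
    show "(\<lambda>n. 1 / real (Suc n)) \<longlonglongrightarrow> 0" using LIMSEQ_inverse_real_of_nat by (simp add: inverse_eq_divide)
    show "\<forall>\<^sub>F n in sequentially. 0 \<le> h n" using less_imp_le[OF h(1)] by simp
    show "\<forall>\<^sub>F n in sequentially. h n \<le> 1 / real (Suc n)" by (simp add: h_def)
  qed
  define \<eta> where "\<eta> n r = (H (r + h n) - H r) / h n" for n r
  define \<eta>' where "\<eta>' n r = (\<zeta> (r + h n) - \<zeta> r) / h n" for n r
  have mvt: "\<exists>z. r < z \<and> z < r + h n \<and> \<eta> n r = \<zeta> z" for n r
  proof -
    obtain z where "r < z" "z < r + h n" "H (r + h n) - H r = (r + h n - r) * \<zeta> z"
      using MVT2[of r "r + h n" H \<zeta>] D h(1)[of n] by auto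
    thus ?thesis using h(1)[of n] by (intro exI[of _ z]) (simp add: \<eta>_def)
  qed
  have "half_line_test (a/2) b (\<eta> n) (\<eta>' n)" for n
    unfolding half_line_test_def
  proof (intro conjI allI impI)
    show "(\<eta> n has_real_derivative \<eta>' n r) (at r)" for r
    proof -
      have "((\<lambda>r. H (r + h n)) has_real_derivative \<zeta> (r + h n)) (at r)"
        using D[of "r + h n"] by (simp add: DERIV_shift)
      thus ?thesis unfolding \<eta>_def \<eta>'_def by (intro DERIV_cdivide DERIV_diff D)
    qed
    show "continuous_on UNIV (\<eta>' n)"
      unfolding \<eta>'_def using h(1)[of n]
      by (intro continuous_intros continuous_on_compose2[OF cont]) auto
    fix r assume r: "r \<notin> {a/2..b}"
    hence out: "s \<notin> {a..b}" if "r < s" "s < r + h n" for s using that h(2)[of n] by auto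
    show "\<eta> n r = 0"
    proof -
      obtain z where "r < z" "z < r + h n" "\<eta> n r = \<zeta> z" using mvt by blast
      thus ?thesis using out z by auto
    qed
    have "\<zeta> r = 0" using r a by (intro z) auto
    moreover have "\<zeta> (r + h n) = 0"
    proof (cases "r > b")
      case True thus ?thesis using h(1)[of n] by (intro z) auto
    next
      case False
      hence "r < a / 2" using r by auto
      thus ?thesis using h(2)[of n] by (intro z) auto
    qed
    ultimately show "\<eta>' n r = 0" by (simp add: \<eta>'_def)
  qed (use a in auto)
  moreover have "\<bar>\<eta> n r\<bar> \<le> C" for n r using mvt[of r n] bd by auto
  moreover have "(\<lambda>n. \<eta> n r) \<longlonglongrightarrow> \<zeta> r" for r
  proof -
    have "((\<lambda>h. (H (r + h) - H r) / h) \<longlongrightarrow> \<zeta> r) (at 0)"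
      using D[of r] by (simp add: DERIV_def)
    moreover have "filterlim h (at 0) sequentially"
      using h0 h(1) by (auto simp: filterlim_at intro!: always_eventually) (metis less_irrefl)
    ultimately show ?thesis unfolding \<eta>_def by (rule filterlim_compose)
  qed
  ultimately show ?thesis by blast
qed

section \<open>The radial derivative and the full gradient\<close>

lemma radial_test_derivative:
  fixes x v :: "'a::euclidean_space"
  assumes t: "half_line_test a b \<zeta> \<zeta>'"
  shows "((\<lambda>x. \<zeta> (norm x) * (x \<bullet> v)) has_derivative
           (\<lambda>h. \<zeta>' (norm x) * (h \<bullet> sgn x) * (x \<bullet> v) + \<zeta> (norm x) * (h \<bullet> v))) (at x)"
proof (cases "x = 0")
  case True
  have ab: "0 < a" and z: "\<And>r. r < a \<Longrightarrow> \<zeta> r = 0 \<and> \<zeta>' r = 0"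
    using t by (auto simp: half_line_test_def)
  have "((\<lambda>_. 0 :: real) has_derivative (\<lambda>_. 0)) (at x)" by simp
  hence "((\<lambda>x. \<zeta> (norm x) * (x \<bullet> v)) has_derivative (\<lambda>_. 0)) (at x)"
    by (rule has_derivative_transform_within_open[where s="ball 0 a"]) (use ab True z in auto)
  thus ?thesis using True z ab by simp
next
  case False
  have d: "(\<zeta> has_derivative (*) (\<zeta>' (norm x))) (at (norm x))"
    using t by (simp add: half_line_test_def has_field_derivative_def)
  have "((\<lambda>x. \<zeta> (norm x)) has_derivative (\<lambda>h. \<zeta>' (norm x) * (h \<bullet> sgn x))) (at x)"
    by (rule has_derivative_compose[OF has_derivative_norm[OF False] d])
  hence "((\<lambda>x. \<zeta> (norm x) * (x \<bullet> v)) has_derivative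
           (\<lambda>h. \<zeta> (norm x) * (h \<bullet> v) + \<zeta>' (norm x) * (h \<bullet> sgn x) * (x \<bullet> v))) (at x)"
    by (intro has_derivative_mult has_derivative_inner_left has_derivative_ident)
  thus ?thesis by (simp add: add.commute)
qed

lemma radial_test_function:
  fixes v h :: "'a::euclidean_space"
  assumes t: "half_line_test a b \<zeta> \<zeta>'"
  shows "C1_test_function UNIV (\<lambda>x. \<zeta> (norm x) * (x \<bullet> v))" (is ?C1)
    and "frechet_derivative (\<lambda>x. \<zeta> (norm x) * (x \<bullet> v)) (at x) h
           = \<zeta>' (norm x) * (h \<bullet> sgn x) * (x \<bullet> v) + \<zeta> (norm x) * (h \<bullet> v)" (is "?fd x h = ?D x h")
    and "continuous_on UNIV (\<lambda>x. \<zeta>' (norm x) * (h \<bullet> sgn x) * (x \<bullet> v) + \<zeta> (norm x) * (h \<bullet> v))"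
proof -
  show fd: "?fd x h = ?D x h" for x h
    using frechet_derivative_at[OF radial_test_derivative[OF t, of v x]] by metis
  have ab: "0 < a" and z: "\<And>r. r \<notin> {a..b} \<Longrightarrow> \<zeta> r = 0 \<and> \<zeta>' r = 0"
    and c': "continuous_on UNIV \<zeta>'" and d: "\<And>r. (\<zeta> has_real_derivative \<zeta>' r) (at r)"
    using t by (auto simp: half_line_test_def)
  have c: "continuous_on UNIV \<zeta>" by (rule DERIV_continuous_on[OF d])
  have cont: "continuous_on UNIV (\<lambda>x. ?D x h)" for h
  proof -
    \<comment> \<open>The factor \<open>inverse (max (norm x) (a/2))\<close> is a continuous substitute for \<open>1 / norm x\<close>;
      the two differ only where \<open>\<zeta>'\<close> vanishes.\<close>
    have eq: "?D x h = \<zeta>' (norm x) * inverse (max (norm x) (a/2)) * (h \<bullet> x) * (x \<bullet> v) + \<zeta> (norm x) * (h \<bullet> v)" for x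
    proof (cases "norm x < a")
      case True thus ?thesis using z[of "norm x"] by simp
    next
      case False
      hence "max (norm x) (a/2) = norm x" using ab by simp
      thus ?thesis by (simp add: sgn_div_norm)
    qed
    show ?thesis unfolding eq
      by (intro continuous_intros continuous_on_compose2[OF c'] continuous_on_compose2[OF c])
         (use ab in \<open>auto simp: max_def\<close>)
  qed
  show "continuous_on UNIV (\<lambda>x. ?D x h)" by (rule cont)
  have sub: "closure {x. \<zeta> (norm x) * (x \<bullet> v) \<noteq> 0} \<subseteq> cball 0 b"
  proof (rule closure_minimal)
    show "{x. \<zeta> (norm x) * (x \<bullet> v) \<noteq> 0} \<subseteq> cball 0 b"
    proof
      fix x assume "x \<in> {x. \<zeta> (norm x) * (x \<bullet> v) \<noteq> 0}"
      hence "\<zeta> (norm x) \<noteq> 0" by auto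
      thus "x \<in> cball 0 b" using z[of "norm x"] by auto
    qed
  qed auto
  have "compact (closure {x. \<zeta> (norm x) * (x \<bullet> v) \<noteq> 0})"
    using compact_Int_closed[OF compact_cball[of 0 b] closed_closure[of "{x. \<zeta> (norm x) * (x \<bullet> v) \<noteq> 0}"]] sub
    by (simp add: Int_absorb1)
  thus ?C1
    unfolding C1_test_function_def using radial_test_derivative[OF t, of v]
    by (auto simp: fd intro!: cont simp: differentiable_def)
qed

text \<open>
  A radial function \<open>F\<close> with profile \<open>f\<close>, its weak partial derivatives
  \<open>G b\<close>, and the classical derivative \<open>g\<close> of the profile.
\<close>

locale radial_gradient = radial_weight c k for c k +
  fixes F :: "'a::euclidean_space \<Rightarrow> complex" and G :: "'a \<Rightarrow> 'a \<Rightarrow> complex"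
    and f g :: "real \<Rightarrow> complex"
  assumes c_def: "c = DIM('a) * unit_ball_vol DIM('a)" and k_def: "k = DIM('a) - 1"
    and weak: "\<And>b. b \<in> Basis \<Longrightarrow> has_weak_derivative UNIV b F (G b)"
    and G_L2: "\<And>b. b \<in> Basis \<Longrightarrow> in_L2 (G b)"
    and F_rad: "AE x in lborel. F x = f (norm x)"
    and fg: "\<And>r. 0 < r \<Longrightarrow> (f has_vector_derivative g r) (at r)"
    and f_meas [measurable]: "f \<in> borel_measurable borel"
    and g_meas [measurable]: "g \<in> borel_measurable borel" and g_cont: "continuous_on {0<..} g"
begin

lemma DIM_k: "DIM('a) = k + 1" using k_def DIM_positive[where 'a='a] by simp

lemma distr_norm: "distr (lborel :: 'a measure) borel norm = \<mu>"
  using distr_norm_lborel[where 'a='a] by (simp add: c_def k_def)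

lemma integral_norm: 
  fixes h :: "real \<Rightarrow> 'b::{banach, second_countable_topology}"
  assumes "h \<in> borel_measurable borel"
  shows "(\<integral>x. h (norm x) \<partial>(lborel :: 'a measure)) = (\<integral>r. h r \<partial>\<mu>)"
  unfolding distr_norm[symmetric] by (rule integral_distr[symmetric]) (use assms in auto)

lemma integrable_norm_iff: 
  fixes h :: "real \<Rightarrow> 'b::{banach, second_countable_topology}"
  assumes "h \<in> borel_measurable borel"
  shows "integrable (lborel :: 'a measure) (\<lambda>x. h (norm x)) \<longleftrightarrow> integrable \<mu> h"
  unfolding distr_norm[symmetric] by (rule integrable_distr_eq[symmetric]) (use assms in auto)

lemma G_meas [measurable]: "b \<in> Basis \<Longrightarrow> G b \<in> borel_measurable borel"
  using G_L2 by (simp add: in_L2_def)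

lemma integrable_test_F:
  assumes "continuous_on UNIV \<phi>" "\<And>x. b < norm x \<Longrightarrow> \<phi> x = 0"
  shows "integrable lborel (\<lambda>x. \<phi> x *\<^sub>R F x)"
proof -
  obtain i :: 'a where i: "i \<in> Basis" using nonempty_Basis by blast
  have loc: "set_integrable lborel (cball 0 b) F"
    using weak[OF i] by (simp add: has_weak_derivative_def locally_integrable_def)
  obtain C where C: "\<And>x. x \<in> cball 0 b \<Longrightarrow> norm (\<phi> x) \<le> C"
    using compact_imp_bounded[OF compact_continuous_image[OF continuous_on_subset[OF assms(1)] compact_cball]]
    unfolding bounded_iff by (metis imageI subset_UNIV)
  have [measurable]: "\<phi> \<in> borel_measurable borel" using assms(1) by (rule borel_measurable_continuous_onI)
  have Fm: "(\<lambda>x. indicator (cball 0 b) x *\<^sub>R F x) \<in> borel_measurable borel"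
    using borel_measurable_integrable[OF loc[unfolded set_integrable_def]] by simp
  have eq: "\<phi> x *\<^sub>R F x = \<phi> x *\<^sub>R (indicator (cball 0 b) x *\<^sub>R F x)" for x
    using assms(2)[of x] by (auto split: split_indicator)
  show ?thesis
  proof (rule Bochner_Integration.integrable_bound)
    show "integrable lborel (\<lambda>x. C * norm (indicator (cball 0 b) x *\<^sub>R F x))"
      using loc by (simp only: set_integrable_def integrable_mult_right integrable_norm)
    show "(\<lambda>x. \<phi> x *\<^sub>R F x) \<in> borel_measurable lborel" unfolding eq using Fm by measurable
    show "AE x in lborel. norm (\<phi> x *\<^sub>R F x) \<le> norm (C * norm (indicator (cball 0 b) x *\<^sub>R F x))"
    proof (rule AE_I2)
      fix x show "norm (\<phi> x *\<^sub>R F x) \<le> norm (C * norm (indicator (cball 0 b) x *\<^sub>R F x))"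
      proof (cases "x \<in> cball 0 b")
        case True
        hence "\<bar>\<phi> x\<bar> \<le> \<bar>C\<bar>" using C[of x] by auto
        thus ?thesis using True by (simp add: abs_mult mult_right_mono)
      next
        case False thus ?thesis using assms(2)[of x] by simp
      qed
    qed
  qed
qed

text \<open>
  Test the weak partial derivatives with the components of the radial vector field $\zeta(|x|) x$.
  Its divergence is the radial function $r \zeta' + d \zeta$, so that the left-hand side of the
  definition of a weak derivative becomes an integral over the half line, where $(r^d \zeta)' =
  r^{d-1} (r \zeta' + d \zeta)$.
\<close>

lemma test_identity_C1:
  assumes t: "half_line_test a b \<zeta> \<zeta>'"
  shows "(\<integral>r. (r * \<zeta> r) *\<^sub>R g r \<partial>\<mu>) = (\<Sum>i\<in>Basis. \<integral>x. (\<zeta> (norm x) * (x \<bullet> i)) *\<^sub>R G i x \<partial>lborel)"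
proof -
  define D where "D i x = \<zeta>' (norm x) * (i \<bullet> sgn x) * (x \<bullet> i) + \<zeta> (norm x) * (i \<bullet> i)" for i x :: 'a
  have ab: "0 < a" "a \<le> b" and z: "\<And>r. r \<notin> {a..b} \<Longrightarrow> \<zeta> r = 0 \<and> \<zeta>' r = 0"
    and c': "continuous_on UNIV \<zeta>'" and d: "\<And>r. (\<zeta> has_real_derivative \<zeta>' r) (at r)"
    using t by (auto simp: half_line_test_def)
  have cz: "continuous_on UNIV \<zeta>" by (rule DERIV_continuous_on[OF d])
  have [measurable]: "\<zeta> \<in> borel_measurable borel" "\<zeta>' \<in> borel_measurable borel" 
    using c' cz by (auto intro: borel_measurable_continuous_onI)
  have m1: "(\<lambda>r. (r * \<zeta>' r + DIM('a) * \<zeta> r) *\<^sub>R f r) \<in> borel_measurable borel"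
    and m2: "(\<lambda>r. (r * \<zeta> r) *\<^sub>R g r) \<in> borel_measurable borel" by measurable
  have weakD: "(\<integral>x. D i x *\<^sub>R F x \<partial>lborel) = - (\<integral>x. (\<zeta> (norm x) * (x \<bullet> i)) *\<^sub>R G i x \<partial>lborel)"
    if "i \<in> Basis" for i
    using weak[OF that] radial_test_function(1)[OF t, of i]
    unfolding has_weak_derivative_def D_def radial_test_function(2)[OF t, symmetric] by blast
  have intD: "integrable lborel (\<lambda>x. D i x *\<^sub>R F x)" for i
    unfolding D_def
    by (rule integrable_test_F[OF radial_test_function(3)[OF t], where b=b]) (use z in auto)
  have "(\<Sum>i\<in>Basis. \<integral>x. (\<zeta> (norm x) * (x \<bullet> i)) *\<^sub>R G i x \<partial>lborel) = - (\<Sum>i\<in>Basis. \<integral>x. D i x *\<^sub>R F x \<partial>lborel)"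
    by (simp add: weakD sum_negf)
  also have "(\<Sum>i\<in>Basis. \<integral>x. D i x *\<^sub>R F x \<partial>lborel) = (\<integral>x. (\<Sum>i\<in>Basis. D i x *\<^sub>R F x) \<partial>lborel)"
    by (rule Bochner_Integration.integral_sum[symmetric]) (rule intD)
  also have "\<dots> = (\<integral>x. (norm x * \<zeta>' (norm x) + DIM('a) * \<zeta> (norm x)) *\<^sub>R f (norm x) \<partial>(lborel :: 'a measure))"
  proof (rule integral_cong_AE)
    show "(\<lambda>x. \<Sum>i\<in>Basis. D i x *\<^sub>R F x) \<in> borel_measurable lborel"
      using intD by (intro borel_measurable_sum) (rule borel_measurable_integrable)
    show "(\<lambda>x::'a. (norm x * \<zeta>' (norm x) + DIM('a) * \<zeta> (norm x)) *\<^sub>R f (norm x)) \<in> borel_measurable lborel"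
      by measurable
    have sumD: "(\<Sum>i\<in>Basis. D i x) = norm x * \<zeta>' (norm x) + DIM('a) * \<zeta> (norm x)" for x :: 'a
    proof -
      have "(\<Sum>i\<in>Basis. (i \<bullet> sgn x) * (x \<bullet> i)) = sgn x \<bullet> x"
        by (subst euclidean_inner[of "sgn x" x]) (simp add: inner_commute)
      also have "\<dots> = norm x" by (cases "x = 0") (auto simp: sgn_div_norm dot_square_norm power2_eq_square)
      finally have "\<zeta>' (norm x) * (\<Sum>i\<in>Basis. (i \<bullet> sgn x) * (x \<bullet> i)) = \<zeta>' (norm x) * norm x" by simp
      thus ?thesis by (simp add: D_def sum.distrib sum_distrib_left mult_ac)
    qed
    show "AE x in lborel. (\<Sum>i\<in>Basis. D i x *\<^sub>R F x) = (norm x * \<zeta>' (norm x) + DIM('a) * \<zeta> (norm x)) *\<^sub>R f (norm x)"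
      using F_rad by eventually_elim (simp add: scaleR_sum_left[symmetric] sumD)
  qed
  also have "\<dots> = (\<integral>r. (r * \<zeta>' r + DIM('a) * \<zeta> r) *\<^sub>R f r \<partial>\<mu>)"
    by (rule integral_norm[of "\<lambda>r. (r * \<zeta>' r + DIM('a) * \<zeta> r) *\<^sub>R f r"]) measurable
  also have "\<dots> = (\<integral>r. (c * (r ^ (k+1) * \<zeta>' r + (k+1) * r ^ k * \<zeta> r)) *\<^sub>R f r \<partial>lborel)"
    unfolding integral_\<mu>[OF m1] set_lebesgue_integral_def
  proof (rule Bochner_Integration.integral_cong[OF refl])
    fix r :: real
    show "indicator {0<..} r *\<^sub>R (weight r *\<^sub>R ((r * \<zeta>' r + DIM('a) * \<zeta> r) *\<^sub>R f r))
       = (c * (r ^ (k+1) * \<zeta>' r + (k+1) * r ^ k * \<zeta> r)) *\<^sub>R f r"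
      using z[of r] ab by (cases "r > 0") (auto simp: weight_def DIM_k algebra_simps)
  qed
  also have "\<dots> = - (\<integral>r. (c * (r ^ (k+1) * \<zeta> r)) *\<^sub>R g r \<partial>lborel)"
  proof (rule integration_by_parts_test(1))
    show "half_line_test a b (\<lambda>r. c * (r ^ (k+1) * \<zeta> r)) (\<lambda>r. c * (r ^ (k+1) * \<zeta>' r + (k+1) * r ^ k * \<zeta> r))"
      unfolding half_line_test_def
    proof (intro conjI allI impI)
      show "((\<lambda>r. c * (r ^ (k+1) * \<zeta> r)) has_real_derivative c * (r ^ (k+1) * \<zeta>' r + (k+1) * r ^ k * \<zeta> r)) (at r)" for r :: real
      proof -
        have "((\<lambda>r. r ^ (k+1) * \<zeta> r) has_real_derivative (real (k+1) * r ^ (k+1 - Suc 0)) * \<zeta> r + \<zeta>' r * r ^ (k+1)) (at r)"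
          by (intro DERIV_mult DERIV_pow d)
        from DERIV_cmult[OF this, of c] show ?thesis by (simp add: algebra_simps)
      qed
      show "continuous_on UNIV (\<lambda>r::real. c * (r ^ (k+1) * \<zeta>' r + (k+1) * r ^ k * \<zeta> r))"
        by (intro continuous_intros c' cz)
    qed (use ab z in auto)
    show "ac_pos f g" using fg g_cont by (rule ac_pos_C1)
  qed
  also have "(\<integral>r. (c * (r ^ (k+1) * \<zeta> r)) *\<^sub>R g r \<partial>lborel) = (\<integral>r. (r * \<zeta> r) *\<^sub>R g r \<partial>\<mu>)"
    unfolding integral_\<mu>[OF m2] set_lebesgue_integral_def
  proof (rule Bochner_Integration.integral_cong[OF refl])
    fix r :: real
    show "(c * (r ^ (k+1) * \<zeta> r)) *\<^sub>R g r = indicator {0<..} r *\<^sub>R (weight r *\<^sub>R ((r * \<zeta> r) *\<^sub>R g r))"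
      using z[of r] ab by (cases "r > 0") (auto simp: weight_def algebra_simps)
  qed
  finally show ?thesis by simp
qed

lemma integrable_G_ball:
  assumes "i \<in> Basis" shows "set_integrable lborel (cball 0 b) (G i)"
  using weak[OF assms] by (simp add: has_weak_derivative_def locally_integrable_def)

lemma test_identity:
  fixes \<zeta> :: "real \<Rightarrow> real"
  assumes ab: "0 < a" "a \<le> b" and cont: "continuous_on UNIV \<zeta>" and z: "\<And>r. r \<notin> {a..b} \<Longrightarrow> \<zeta> r = 0"
  shows "(\<integral>r. (r * \<zeta> r) *\<^sub>R g r \<partial>\<mu>) = (\<Sum>i\<in>Basis. \<integral>x. (\<zeta> (norm x) * (x \<bullet> i)) *\<^sub>R G i x \<partial>lborel)"
    "integrable \<mu> (\<lambda>r. (r * \<zeta> r) *\<^sub>R g r)"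
    "i \<in> Basis \<Longrightarrow> integrable lborel (\<lambda>x. (\<zeta> (norm x) * (x \<bullet> i)) *\<^sub>R G i x)"
proof -
  obtain C where C0: "\<And>r. r \<in> {a..b} \<Longrightarrow> norm (\<zeta> r) \<le> C"
    using compact_imp_bounded[OF compact_continuous_image[OF continuous_on_subset[OF cont] compact_Icc]]
    unfolding bounded_iff by (metis imageI subset_UNIV)
  have C: "\<bar>\<zeta> r\<bar> \<le> \<bar>C\<bar>" for r
    using C0[of r] z[of r] by (cases "r \<in> {a..b}") auto
  obtain \<eta> \<eta>' where \<eta>: "\<And>n. half_line_test (a/2) b (\<eta> n) (\<eta>' n)" "\<And>n r. \<bar>\<eta> n r\<bar> \<le> \<bar>C\<bar>"
      "\<And>r. (\<lambda>n::nat. \<eta> n r) \<longlonglongrightarrow> \<zeta> r"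
    using half_line_test_approximation[OF ab cont z C] by blast
  have \<eta>0: "\<eta> n r = 0" if "r \<notin> {a/2..b}" for n r
    using \<eta>(1)[of n] that by (simp add: half_line_test_def)
  have [measurable]: "\<zeta> \<in> borel_measurable borel" using cont by (rule borel_measurable_continuous_onI)
  have [measurable]: "\<eta> n \<in> borel_measurable borel" for n
  proof -
    have "\<And>r. (\<eta> n has_real_derivative \<eta>' n r) (at r)" using \<eta>(1)[of n] by (simp add: half_line_test_def)
    thus ?thesis by (intro borel_measurable_continuous_onI DERIV_continuous_on)
  qed
  have wi: "integrable \<mu> (\<lambda>r. indicator {a/2..b} r *\<^sub>R g r)"
  proof -
    have "set_integrable lborel {a/2..b} (\<lambda>r. weight r *\<^sub>R g r)"
      unfolding weight_def by (intro borel_integrable_atLeastAtMost' continuous_intros continuous_on_subset[OF g_cont]) (use ab in auto)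
    moreover have "(\<lambda>r. indicator {0<..} r *\<^sub>R (weight r *\<^sub>R (indicator {a/2..b} r *\<^sub>R g r))) = (\<lambda>r. indicator {a/2..b} r *\<^sub>R (weight r *\<^sub>R g r))"
      using ab by (auto simp: fun_eq_iff split: split_indicator)
    ultimately show ?thesis by (subst integrable_\<mu>) (measurable, simp add: set_integrable_def)
  qed
  have wi': "integrable \<mu> (\<lambda>r. b * \<bar>C\<bar> * norm (indicator {a/2..b} r *\<^sub>R g r))"
    by (intro integrable_mult_right integrable_norm wi)
  have bl: "norm ((r * y) *\<^sub>R g r) \<le> b * \<bar>C\<bar> * norm (indicator {a/2..b} r *\<^sub>R g r)"
    if "\<bar>y\<bar> \<le> \<bar>C\<bar>" "r \<notin> {a/2..b} \<Longrightarrow> y = 0" for r y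
  proof (cases "r \<in> {a/2..b}")
    case True
    hence "\<bar>r\<bar> * \<bar>y\<bar> \<le> b * \<bar>C\<bar>" using that ab by (intro mult_mono) auto
    thus ?thesis using True by (simp add: abs_mult mult_right_mono)
  qed (use that in auto)
  have br: "norm ((y * (x \<bullet> i)) *\<^sub>R G i x) \<le> b * \<bar>C\<bar> * norm (indicator (cball 0 b) x *\<^sub>R G i x)"
    if "\<bar>y\<bar> \<le> \<bar>C\<bar>" "norm x \<notin> {a/2..b} \<Longrightarrow> y = 0" "i \<in> Basis" for x y i
  proof (cases "norm x \<in> {a/2..b}")
    case True
    have "\<bar>x \<bullet> i\<bar> \<le> norm x" using Basis_le_norm[OF that(3)] by simp
    hence "\<bar>y\<bar> * \<bar>x \<bullet> i\<bar> \<le> \<bar>C\<bar> * b" using that True ab by (intro mult_mono) auto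
    hence "\<bar>y\<bar> * \<bar>x \<bullet> i\<bar> * cmod (G i x) \<le> b * \<bar>C\<bar> * cmod (G i x)" by (simp only: mult_right_mono norm_ge_zero mult.commute[of b])
    thus ?thesis using True by (simp add: abs_mult)
  qed (use that ab in auto)
  have gi: "integrable lborel (\<lambda>x. b * \<bar>C\<bar> * norm (indicator (cball 0 b) x *\<^sub>R G i x))" if "i \<in> Basis" for i
    using integrable_G_ball[OF that] unfolding set_integrable_def by (intro integrable_mult_right integrable_norm)
  have z2: "r \<notin> {a/2..b} \<Longrightarrow> \<zeta> r = 0" for r using z[of r] ab by auto
  show "integrable \<mu> (\<lambda>r. (r * \<zeta> r) *\<^sub>R g r)"
    by (rule Bochner_Integration.integrable_bound[OF wi']) (use bl[OF C z2] ab in \<open>auto intro!: AE_I2 intro: order_trans[OF _ abs_ge_self]\<close>)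
  show "integrable lborel (\<lambda>x. (\<zeta> (norm x) * (x \<bullet> i)) *\<^sub>R G i x)" if i: "i \<in> Basis" for i
  proof (rule Bochner_Integration.integrable_bound[OF gi[OF i]])
    note [measurable] = G_meas[OF i]
    show "(\<lambda>x. (\<zeta> (norm x) * (x \<bullet> i)) *\<^sub>R G i x) \<in> borel_measurable lborel" by measurable
  qed (use br[OF C z2 i] in \<open>auto intro!: AE_I2 intro: order_trans[OF _ abs_ge_self]\<close>)
  have L: "(\<lambda>n. \<integral>r. (r * \<eta> n r) *\<^sub>R g r \<partial>\<mu>) \<longlonglongrightarrow> (\<integral>r. (r * \<zeta> r) *\<^sub>R g r \<partial>\<mu>)"
  proof (rule integral_dominated_convergence[OF _ _ wi'])
    show "AE r in \<mu>. (\<lambda>n. (r * \<eta> n r) *\<^sub>R g r) \<longlonglongrightarrow> (r * \<zeta> r) *\<^sub>R g r"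
      by (intro AE_I2 tendsto_intros \<eta>)
    show "AE r in \<mu>. norm ((r * \<eta> n r) *\<^sub>R g r) \<le> b * \<bar>C\<bar> * norm (indicator {a/2..b} r *\<^sub>R g r)" for n
      by (intro AE_I2 bl \<eta> \<eta>0)
  qed simp_all
  have R: "(\<lambda>n. \<Sum>i\<in>Basis. \<integral>x. (\<eta> n (norm x) * (x \<bullet> i)) *\<^sub>R G i x \<partial>lborel)
      \<longlonglongrightarrow> (\<Sum>i\<in>Basis. \<integral>x. (\<zeta> (norm x) * (x \<bullet> i)) *\<^sub>R G i x \<partial>lborel)"
  proof (rule tendsto_sum)
    fix i :: 'a assume i: "i \<in> Basis"
    note [measurable] = G_meas[OF i]
    show "(\<lambda>n. \<integral>x. (\<eta> n (norm x) * (x \<bullet> i)) *\<^sub>R G i x \<partial>lborel) \<longlonglongrightarrow> (\<integral>x. (\<zeta> (norm x) * (x \<bullet> i)) *\<^sub>R G i x \<partial>lborel)"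
    proof (rule integral_dominated_convergence[OF _ _ gi[OF i]])
      show "AE x in lborel. (\<lambda>n. (\<eta> n (norm x) * (x \<bullet> i)) *\<^sub>R G i x) \<longlonglongrightarrow> (\<zeta> (norm x) * (x \<bullet> i)) *\<^sub>R G i x"
        by (intro AE_I2 tendsto_intros \<eta>)
      show "AE x in lborel. norm ((\<eta> n (norm x) * (x \<bullet> i)) *\<^sub>R G i x) \<le> b * \<bar>C\<bar> * norm (indicator (cball 0 b) x *\<^sub>R G i x)" for n
        by (intro AE_I2 br \<eta> \<eta>0 i)
    qed measurable
  qed
  show "(\<integral>r. (r * \<zeta> r) *\<^sub>R g r \<partial>\<mu>) = (\<Sum>i\<in>Basis. \<integral>x. (\<zeta> (norm x) * (x \<bullet> i)) *\<^sub>R G i x \<partial>lborel)"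
    using L R unfolding test_identity_C1[OF \<eta>(1)] by (rule LIMSEQ_unique)
qed

text \<open>
  Take $\zeta = \chi \bar g / r$ with the cutoff $\chi$, that is \<open>cut\<close>, in the test
  identity. The left-hand side becomes $\int \chi |g|^2$; on the right the inequality $|uv| \le
  (|u|^2 + |v|^2)/2$ leaves half of $\int \chi^2 |g|^2$, which is absorbed since $\chi^2 \le
  \chi$, and half of the squared norm of the gradient.
\<close>

lemma local_gradient_bound:
  fixes cut :: "real \<Rightarrow> real"
  assumes ab: "0 < a" "a \<le> b" and cont: "continuous_on UNIV cut" and z: "\<And>r. r \<notin> {a..b} \<Longrightarrow> cut r = 0"
    and cut: "\<And>r. 0 \<le> cut r" "\<And>r. cut r \<le> 1"
  shows "integrable \<mu> (\<lambda>r. cut r * (cmod (g r))\<^sup>2)"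
    "(\<integral>r. cut r * (cmod (g r))\<^sup>2 \<partial>\<mu>) \<le> (\<Sum>i\<in>Basis. (L2_norm (G i))\<^sup>2)"
proof -
  have [measurable]: "cut \<in> borel_measurable borel" using cont by (rule borel_measurable_continuous_onI)
  define e where "e r = cut r / r" for r
  \<comment> \<open>real and imaginary part of \<open>\<zeta>\<close>, because test functions are real\<close>
  define re where "re r = e r * Re (g r)" for r
  define im where "im r = e r * - Im (g r)" for r
  have e0: "e r = 0" if "r \<notin> {a..b}" for r using z[OF that] by (simp add: e_def)
  have cont_ext: "continuous_on UNIV (\<lambda>r. e r * h r)" if "continuous_on {0<..} h" for h :: "real \<Rightarrow> real"
  proof -
    have "continuous_on ({0<..} \<union> {..<a}) (\<lambda>r. e r * h r)"
    proof (rule continuous_on_open_Un)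
      show "continuous_on {0<..} (\<lambda>r. e r * h r)" unfolding e_def
        by (intro continuous_intros that continuous_on_subset[OF cont]) auto
      have "continuous_on {..<a} (\<lambda>_. 0 :: real)" by simp
      thus "continuous_on {..<a} (\<lambda>r. e r * h r)"
        by (rule continuous_on_eq) (simp add: e0)
    qed auto
    moreover have "{0<..} \<union> {..<a} = UNIV" using ab by auto
    ultimately show ?thesis by simp
  qed
  have cre: "continuous_on UNIV re" unfolding re_def by (intro cont_ext continuous_intros g_cont)
  have cim: "continuous_on UNIV im" unfolding im_def by (intro cont_ext continuous_intros g_cont)
  have z1: "re r = 0" "im r = 0" if "r \<notin> {a..b}" for r using e0[OF that] by (simp_all add: re_def im_def)
  have T1: "(\<integral>r. (r * re r) *\<^sub>R g r \<partial>\<mu>) = (\<Sum>i\<in>Basis. \<integral>x. (re (norm x) * (x \<bullet> i)) *\<^sub>R G i x \<partial>lborel)"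
    "integrable \<mu> (\<lambda>r. (r * re r) *\<^sub>R g r)"
    "\<And>i. i \<in> Basis \<Longrightarrow> integrable lborel (\<lambda>x. (re (norm x) * (x \<bullet> i)) *\<^sub>R G i x)"
    by (rule test_identity[OF ab cre z1(1)]; assumption)+
  have T2: "(\<integral>r. (r * im r) *\<^sub>R g r \<partial>\<mu>) = (\<Sum>i\<in>Basis. \<integral>x. (im (norm x) * (x \<bullet> i)) *\<^sub>R G i x \<partial>lborel)"
    "integrable \<mu> (\<lambda>r. (r * im r) *\<^sub>R g r)"
    "\<And>i. i \<in> Basis \<Longrightarrow> integrable lborel (\<lambda>x. (im (norm x) * (x \<bullet> i)) *\<^sub>R G i x)"
    by (rule test_identity[OF ab cim z1(2)]; assumption)+
  define Z where "Z r = complex_of_real (re r) + \<i> * complex_of_real (im r)" for r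
  have Zg: "Z r * g r = complex_of_real (e r * (cmod (g r))\<^sup>2)" for r
    unfolding cmod_power2
    by (simp add: Z_def re_def im_def complex_eq_iff algebra_simps power2_eq_square)
  have Zsq: "(cmod (Z r))\<^sup>2 = (e r)\<^sup>2 * (cmod (g r))\<^sup>2" for r
    unfolding cmod_power2 by (simp add: Z_def re_def im_def algebra_simps power2_eq_square)
  have eqL: "(r * re r) *\<^sub>R g r + \<i> * ((r * im r) *\<^sub>R g r) = complex_of_real (cut r * (cmod (g r))\<^sup>2)" for r
  proof -
    have "(r * re r) *\<^sub>R g r + \<i> * ((r * im r) *\<^sub>R g r) = complex_of_real r * (Z r * g r)"
      by (simp add: Z_def scaleR_conv_of_real algebra_simps)
    also have "\<dots> = complex_of_real (cut r * (cmod (g r))\<^sup>2)"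
      unfolding Zg using z[of 0] ab by (cases "r = 0") (auto simp: e_def)
    finally show ?thesis .
  qed
  have ic: "integrable \<mu> (\<lambda>r. complex_of_real (cut r * (cmod (g r))\<^sup>2))"
    unfolding eqL[symmetric] by (intro Bochner_Integration.integrable_add integrable_mult_right T1(2) T2(2))
  show int: "integrable \<mu> (\<lambda>r. cut r * (cmod (g r))\<^sup>2)"
    using integrable_Re[OF ic] by simp
  let ?I = "\<integral>r. cut r * (cmod (g r))\<^sup>2 \<partial>\<mu>"
  have "complex_of_real ?I = (\<integral>r. (r * re r) *\<^sub>R g r \<partial>\<mu>) + \<i> * (\<integral>r. (r * im r) *\<^sub>R g r \<partial>\<mu>)"
  proof -
    have "complex_of_real ?I = (\<integral>r. (r * re r) *\<^sub>R g r + \<i> * ((r * im r) *\<^sub>R g r) \<partial>\<mu>)"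
      unfolding eqL by (rule integral_complex_of_real[symmetric])
    thus ?thesis using T1(2) T2(2)
      by (simp only: Bochner_Integration.integral_add integrable_mult_right integral_mult_right_zero)
  qed
  also have "\<dots> = (\<Sum>i\<in>Basis. (\<integral>x. (re (norm x) * (x \<bullet> i)) *\<^sub>R G i x \<partial>lborel) + \<i> * (\<integral>x. (im (norm x) * (x \<bullet> i)) *\<^sub>R G i x \<partial>lborel))"
    unfolding T1(1) T2(1) by (simp add: sum_distrib_left sum.distrib)
  also have "\<dots> = (\<Sum>i\<in>Basis. \<integral>x. (Z (norm x) * (x \<bullet> i)) * G i x \<partial>lborel)"
  proof (rule sum.cong[OF refl])
    fix i :: 'a assume i: "i \<in> Basis"
    have "(\<integral>x. (Z (norm x) * (x \<bullet> i)) * G i x \<partial>lborel) 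
      = (\<integral>x. (re (norm x) * (x \<bullet> i)) *\<^sub>R G i x + \<i> * ((im (norm x) * (x \<bullet> i)) *\<^sub>R G i x) \<partial>lborel)"
      by (rule Bochner_Integration.integral_cong) (auto simp: Z_def scaleR_conv_of_real algebra_simps)
    also have "\<dots> = (\<integral>x. (re (norm x) * (x \<bullet> i)) *\<^sub>R G i x \<partial>lborel) + \<i> * (\<integral>x. (im (norm x) * (x \<bullet> i)) *\<^sub>R G i x \<partial>lborel)"
      using T1(3)[OF i] T2(3)[OF i]
      by (simp only: Bochner_Integration.integral_add integrable_mult_right integral_mult_right_zero)
    finally show "(\<integral>x. (re (norm x) * (x \<bullet> i)) *\<^sub>R G i x \<partial>lborel) + \<i> * (\<integral>x. (im (norm x) * (x \<bullet> i)) *\<^sub>R G i x \<partial>lborel)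
      = (\<integral>x. (Z (norm x) * (x \<bullet> i)) * G i x \<partial>lborel)" by simp
  qed
  finally have I1: "complex_of_real ?I = (\<Sum>i\<in>Basis. \<integral>x. (Z (norm x) * (x \<bullet> i)) * G i x \<partial>lborel)" .
  have I0: "0 \<le> ?I" using cut by (intro Bochner_Integration.integral_nonneg) simp
  have Z_int: "integrable (lborel :: 'a measure) (\<lambda>x. (norm x)\<^sup>2 * (cmod (Z (norm x)))\<^sup>2)"
    and Z_le: "(\<integral>x. (norm x)\<^sup>2 * (cmod (Z (norm x)))\<^sup>2 \<partial>(lborel :: 'a measure)) \<le> ?I"
  proof -
    have eq: "r\<^sup>2 * (cmod (Z r))\<^sup>2 = (cut r)\<^sup>2 * (cmod (g r))\<^sup>2" for r
      unfolding Zsq using z[of 0] ab by (cases "r = 0") (auto simp: e_def power2_eq_square)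
    have le: "(cut r)\<^sup>2 * (cmod (g r))\<^sup>2 \<le> cut r * (cmod (g r))\<^sup>2" for r
      using cut[of r] by (intro mult_right_mono) (auto simp: power2_eq_square mult_left_le)
    have i2: "integrable \<mu> (\<lambda>r. (cut r)\<^sup>2 * (cmod (g r))\<^sup>2)"
      by (rule Bochner_Integration.integrable_bound[OF int]) (use le cut in auto)
    show "integrable (lborel :: 'a measure) (\<lambda>x. (norm x)\<^sup>2 * (cmod (Z (norm x)))\<^sup>2)"
      unfolding eq using i2 by (subst integrable_norm_iff[of "\<lambda>r. (cut r)\<^sup>2 * (cmod (g r))\<^sup>2"]) auto
    have "(\<integral>x. (norm x)\<^sup>2 * (cmod (Z (norm x)))\<^sup>2 \<partial>(lborel :: 'a measure)) = (\<integral>r. (cut r)\<^sup>2 * (cmod (g r))\<^sup>2 \<partial>\<mu>)"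
      unfolding eq by (rule integral_norm[of "\<lambda>r. (cut r)\<^sup>2 * (cmod (g r))\<^sup>2"]) measurable
    also have "\<dots> \<le> ?I" by (intro integral_mono i2 int le)
    finally show "(\<integral>x. (norm x)\<^sup>2 * (cmod (Z (norm x)))\<^sup>2 \<partial>(lborel :: 'a measure)) \<le> ?I" .
  qed
  have [measurable]: "re \<in> borel_measurable borel" "im \<in> borel_measurable borel"
    using cre cim by (auto intro: borel_measurable_continuous_onI)
  have Zm [measurable]: "Z \<in> borel_measurable borel" unfolding Z_def[abs_def] by measurable
  have tmb: "cmod (\<integral>x. (Z (norm x) * (x \<bullet> i)) * G i x \<partial>lborel)
     \<le> (\<integral>x. (cmod (Z (norm x)))\<^sup>2 * (x \<bullet> i)\<^sup>2 / 2 \<partial>lborel) + (L2_norm (G i))\<^sup>2 / 2"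
    and tm_int: "integrable (lborel :: 'a measure) (\<lambda>x. (cmod (Z (norm x)))\<^sup>2 * (x \<bullet> i)\<^sup>2 / 2)" if i: "i \<in> Basis" for i
  proof -
    have Gi: "integrable lborel (\<lambda>x. (cmod (G i x))\<^sup>2)" using G_L2[OF i] by (simp add: in_L2_def)
    have L2: "(L2_norm (G i))\<^sup>2 = (\<integral>x. (cmod (G i x))\<^sup>2 \<partial>lborel)" by (simp add: L2_norm_def)
    show ti: "integrable (lborel :: 'a measure) (\<lambda>x. (cmod (Z (norm x)))\<^sup>2 * (x \<bullet> i)\<^sup>2 / 2)"
    proof (rule Bochner_Integration.integrable_bound[OF Z_int])
      show "AE x in lborel. norm ((cmod (Z (norm x)))\<^sup>2 * (x \<bullet> i)\<^sup>2 / 2) \<le> norm ((norm x)\<^sup>2 * (cmod (Z (norm x)))\<^sup>2)"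
      proof (rule AE_I2)
        fix x :: 'a
        have "\<bar>x \<bullet> i\<bar>\<^sup>2 \<le> (norm x)\<^sup>2" by (intro power_mono Basis_le_norm i) auto
        hence "(cmod (Z (norm x)))\<^sup>2 * (x \<bullet> i)\<^sup>2 \<le> (cmod (Z (norm x)))\<^sup>2 * (norm x)\<^sup>2" by (intro mult_left_mono) auto
        moreover have "0 \<le> (cmod (Z (norm x)))\<^sup>2 * (x \<bullet> i)\<^sup>2" by simp
        ultimately show "norm ((cmod (Z (norm x)))\<^sup>2 * (x \<bullet> i)\<^sup>2 / 2) \<le> norm ((norm x)\<^sup>2 * (cmod (Z (norm x)))\<^sup>2)"
          by (simp only: real_norm_def abs_of_nonneg mult.commute[of "(norm x)\<^sup>2"])
      qed
    qed measurable
    have pt: "cmod ((Z (norm x) * (x \<bullet> i)) * G i x) \<le> (cmod (Z (norm x)))\<^sup>2 * (x \<bullet> i)\<^sup>2 / 2 + (cmod (G i x))\<^sup>2 / 2" for x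
      using sum_squares_bound[of "cmod (Z (norm x)) * \<bar>x \<bullet> i\<bar>" "cmod (G i x)"]
      by (simp add: norm_mult power_mult_distrib)
    have pi: "integrable lborel (\<lambda>x. cmod ((Z (norm x) * (x \<bullet> i)) * G i x))"
    proof (rule Bochner_Integration.integrable_bound)
      show "integrable lborel (\<lambda>x. (cmod (Z (norm x)))\<^sup>2 * (x \<bullet> i)\<^sup>2 / 2 + (cmod (G i x))\<^sup>2 / 2)"
        by (intro Bochner_Integration.integrable_add ti integrable_divide Gi)
      note [measurable] = G_meas[OF i]
      show "(\<lambda>x. cmod ((Z (norm x) * (x \<bullet> i)) * G i x)) \<in> borel_measurable lborel" by measurable
      show "AE x in lborel. norm (cmod ((Z (norm x) * (x \<bullet> i)) * G i x)) \<le> norm ((cmod (Z (norm x)))\<^sup>2 * (x \<bullet> i)\<^sup>2 / 2 + (cmod (G i x))\<^sup>2 / 2)"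
        using pt by (auto intro!: AE_I2 intro: order_trans[OF _ abs_ge_self])
    qed
    have "cmod (\<integral>x. (Z (norm x) * (x \<bullet> i)) * G i x \<partial>lborel) \<le> (\<integral>x. cmod ((Z (norm x) * (x \<bullet> i)) * G i x) \<partial>lborel)"
      by (rule integral_norm_bound)
    also have "\<dots> \<le> (\<integral>x. (cmod (Z (norm x)))\<^sup>2 * (x \<bullet> i)\<^sup>2 / 2 + (cmod (G i x))\<^sup>2 / 2 \<partial>lborel)"
      by (intro integral_mono pi pt Bochner_Integration.integrable_add ti integrable_divide Gi)
    also have "\<dots> = (\<integral>x. (cmod (Z (norm x)))\<^sup>2 * (x \<bullet> i)\<^sup>2 / 2 \<partial>lborel) + (\<integral>x. (cmod (G i x))\<^sup>2 / 2 \<partial>lborel)"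
      by (intro Bochner_Integration.integral_add ti integrable_divide Gi)
    finally show "cmod (\<integral>x. (Z (norm x) * (x \<bullet> i)) * G i x \<partial>lborel)
     \<le> (\<integral>x. (cmod (Z (norm x)))\<^sup>2 * (x \<bullet> i)\<^sup>2 / 2 \<partial>lborel) + (L2_norm (G i))\<^sup>2 / 2" by (simp add: L2)
  qed
  have "?I = cmod (complex_of_real ?I)" using I0 by simp
  also have "\<dots> \<le> (\<Sum>i\<in>Basis. (\<integral>x. (cmod (Z (norm x)))\<^sup>2 * (x \<bullet> i)\<^sup>2 / 2 \<partial>lborel) + (L2_norm (G i))\<^sup>2 / 2)"
    unfolding I1 by (rule order_trans[OF norm_sum sum_mono[OF tmb]])
  also have "\<dots> = (\<integral>x. (\<Sum>i\<in>Basis. (cmod (Z (norm x)))\<^sup>2 * (x \<bullet> i)\<^sup>2 / 2) \<partial>(lborel :: 'a measure)) + (\<Sum>i\<in>Basis. (L2_norm (G i))\<^sup>2) / 2"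
    by (subst Bochner_Integration.integral_sum) (auto simp: sum.distrib sum_divide_distrib intro: tm_int)
  also have "(\<integral>x. (\<Sum>i\<in>Basis. (cmod (Z (norm x)))\<^sup>2 * (x \<bullet> i)\<^sup>2 / 2) \<partial>(lborel :: 'a measure)) = (\<integral>x. (norm x)\<^sup>2 * (cmod (Z (norm x)))\<^sup>2 \<partial>(lborel :: 'a measure)) / 2"
  proof -
    have "(\<Sum>i\<in>Basis. (cmod (Z (norm x)))\<^sup>2 * (x \<bullet> i)\<^sup>2 / 2) = (norm x)\<^sup>2 * (cmod (Z (norm x)))\<^sup>2 / 2" for x :: 'a
    proof -
      have "(\<Sum>i\<in>Basis. (x \<bullet> i)\<^sup>2) = (norm x)\<^sup>2"
        unfolding power2_norm_eq_inner euclidean_inner[of x x] by (simp add: power2_eq_square)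
      thus ?thesis by (simp add: sum_divide_distrib[symmetric] sum_distrib_right[symmetric] mult.commute)
    qed
    thus ?thesis by (simp only: integral_divide_zero)
  qed
  finally show "?I \<le> (\<Sum>i\<in>Basis. (L2_norm (G i))\<^sup>2)" using Z_le by simp
qed

text \<open>
  The inequality follows by duality from the test identity, without identifying the weak partial
  derivatives.
\<close>

theorem radial_derivative_L2:
  shows "sq_int \<mu> g" "sq_norm \<mu> g \<le> (\<Sum>i\<in>Basis. (L2_norm (G i))\<^sup>2)"
proof -
  define h where "h n = 1 / real (Suc n)" for n
  define cut where "cut n = trapezoid (2 * (n + 1)) (h n) (real (Suc n))" for n
  have z: "cut n r = 0" if "r \<notin> {h n / 2..real (Suc n) + h n / 2}" for n r
    unfolding cut_def by (rule trapezoid_eq_0[where \<delta>="h n / 2"]) (use that in \<open>auto simp: h_def field_simps\<close>)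
  have le: "h n / 2 \<le> real (Suc n) + h n / 2" for n by simp
  have pos: "0 < h n / 2" for n by (simp add: h_def)
  note B = local_gradient_bound[OF pos le continuous_trapezoid z[unfolded cut_def] trapezoid_bounds]
  have lim: "(\<lambda>n. cut n r * (cmod (g r))\<^sup>2) \<longlonglongrightarrow> (cmod (g r))\<^sup>2" if r: "r > 0" for r
  proof -
    obtain N where N: "max r (1 / r) < real N" using reals_Archimedean2 by blast
    have "\<forall>\<^sub>F n in sequentially. cut n r = 1"
      using eventually_ge_at_top[of N]
    proof eventually_elim
      case (elim n)
      have "1 / r < real (Suc n)" "r \<le> real (Suc n)" using N elim by auto
      hence "r \<in> {h n..real (Suc n)}" using r by (simp add: h_def field_simps)
      thus ?case unfolding cut_def by (rule trapezoid_eq_1)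
    qed
    hence "\<forall>\<^sub>F n in sequentially. cut n r * (cmod (g r))\<^sup>2 = (cmod (g r))\<^sup>2" by eventually_elim simp
    thus ?thesis by (rule tendsto_eventually)
  qed
  have AE: "AE r in \<mu>. (\<lambda>n. cut n r * (cmod (g r))\<^sup>2) \<longlonglongrightarrow> (cmod (g r))\<^sup>2"
    unfolding AE_\<mu> using lim by simp
  have gm: "(\<lambda>r. (cmod (g r))\<^sup>2) \<in> borel_measurable \<mu>" by simp
  have nn: "0 \<le> cut n r * (cmod (g r))\<^sup>2" for n r unfolding cut_def by (simp add: trapezoid_bounds)
  note Fat = Fatou_bounded[of \<mu> "\<lambda>n r. cut n r * (cmod (g r))\<^sup>2", OF B(1)[folded cut_def] nn B(2)[folded cut_def] AE gm]
  show "sq_int \<mu> g" using Fat(1) by (simp add: sq_int_def)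
  show "sq_norm \<mu> g \<le> (\<Sum>i\<in>Basis. (L2_norm (G i))\<^sup>2)" using Fat(2) by (simp add: sq_norm_def)
qed

end

section \<open>Truncated multipliers\<close>

lemma DERIV_pos_part_power:
  "((\<lambda>y::real. max 0 y ^ (n + 2)) has_real_derivative real (n + 2) * max 0 y ^ (n + 1)) (at y)"
proof -
  consider "y > 0" | "y < 0" | "y = 0" by linarith
  thus ?thesis
  proof cases
    case 1
    have "((\<lambda>y::real. y ^ (n + 2)) has_real_derivative real (n + 2) * y ^ (n + 2 - Suc 0)) (at y)"
      by (rule DERIV_pow)
    hence "((\<lambda>y::real. max 0 y ^ (n + 2)) has_real_derivative real (n + 2) * y ^ (n + 2 - Suc 0)) (at y)"
      by (rule has_field_derivative_transform_within_open[where S="{0<..}"]) (use 1 in auto)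
    thus ?thesis using 1 by simp
  next
    case 2
    have "((\<lambda>y::real. 0) has_real_derivative 0) (at y)" by simp
    hence "((\<lambda>y::real. max 0 y ^ (n + 2)) has_real_derivative 0) (at y)"
      by (rule has_field_derivative_transform_within_open[where S="{..<0}"]) (use 2 in auto)
    thus ?thesis using 2 by simp
  next
    case 3
    have "((\<lambda>h::real. max 0 h ^ (n + 2) / h) \<longlongrightarrow> 0) (at 0)"
    proof (rule Lim_null_comparison)
      show "\<forall>\<^sub>F h in at 0. norm (max 0 h ^ (n + 2) / h) \<le> \<bar>h\<bar> ^ (n + 1)"
      proof (rule always_eventually, rule allI)
        fix h :: real
        show "norm (max 0 h ^ (n + 2) / h) \<le> \<bar>h\<bar> ^ (n + 1)"
        proof (cases "h > 0")
          case False
          hence "max 0 h = 0" by simp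
          hence "norm (max 0 h ^ (n + 2) / h) = 0" by simp
          also have "0 \<le> \<bar>h\<bar> ^ (n + 1)" by (rule zero_le_power) simp
          finally show ?thesis .
        qed simp
      qed
      have "((\<lambda>h::real. \<bar>h\<bar> ^ (n + 1)) \<longlongrightarrow> \<bar>0\<bar> ^ (n + 1)) (at 0)" by (intro tendsto_intros)
      thus "((\<lambda>h::real. \<bar>h\<bar> ^ (n + 1)) \<longlongrightarrow> 0) (at 0)" by simp
    qed
    thus ?thesis using 3 by (simp add: DERIV_def)
  qed
qed

text \<open>
  A power \<open>n + 1\<close> of this function is \<open>n\<close> times continuously
  differentiable, and its derivatives are again explicit.
\<close>

definition cutoff :: "real \<Rightarrow> real \<Rightarrow> real" where
  "cutoff R r = max 0 (1 - (r / R)\<^sup>2)"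

lemma cutoff_bounds: "0 \<le> cutoff R r" "cutoff R r \<le> 1"
  by (auto simp: cutoff_def)

lemma cutoff_power_bounds: "0 \<le> cutoff R r ^ n" "cutoff R r ^ n \<le> 1"
  by (auto simp: cutoff_bounds power_le_one)

lemma cutoff_zero:
  assumes "0 < R" "R \<le> r" shows "cutoff R r = 0"
proof -
  have "1 \<le> (r / R)\<^sup>2" using assms by (intro one_le_power) simp
  thus ?thesis by (simp add: cutoff_def)
qed

lemma one_minus_cutoff_power_le: "1 - cutoff R r ^ n \<le> real n * (r / R)\<^sup>2"
proof (cases "(r / R)\<^sup>2 \<le> 1")
  case True
  hence "1 + real n * (- (r / R)\<^sup>2) \<le> (1 + - (r / R)\<^sup>2) ^ n" by (intro Bernoulli_inequality) simp
  thus ?thesis using True by (simp add: cutoff_def)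
next
  case False
  hence c: "cutoff R r = 0" by (simp add: cutoff_def)
  show ?thesis
  proof (cases n)
    case (Suc m)
    have "1 * 1 \<le> real n * (r / R)\<^sup>2" using False Suc by (intro mult_mono) auto
    thus ?thesis using c Suc by simp
  qed simp
qed

lemma DERIV_cutoff_power:
  assumes "R \<noteq> 0"
  shows "((\<lambda>r. cutoff R r ^ (n + 2)) has_real_derivative - 2 * real (n + 2) * (r / R\<^sup>2) * cutoff R r ^ (n + 1)) (at r)"
proof -
  have "((\<lambda>r. 1 - (r / R)\<^sup>2) has_real_derivative - 2 * (r / R\<^sup>2)) (at r)"
    using assms by (auto intro!: derivative_eq_intros simp: power2_eq_square)
  from DERIV_chain2[OF DERIV_pos_part_power this, of n]
  show ?thesis by (simp add: cutoff_def[abs_def] algebra_simps)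
qed

lemma cutoff_support:
  assumes "0 < R" "0 < r" "0 < n"
  shows "(r / R) * cutoff R r ^ n \<le> 1" "(r / R)\<^sup>2 * cutoff R r ^ n \<le> 1"
proof -
  have *: "(r / R) ^ j * cutoff R r ^ n \<le> 1" for j
  proof (cases "R \<le> r")
    case True thus ?thesis using assms by (simp add: cutoff_zero zero_power)
  next
    case False
    hence "(r / R) ^ j * cutoff R r ^ n \<le> 1 * 1"
      using assms by (intro mult_mono power_le_one cutoff_power_bounds) auto
    thus ?thesis by simp
  qed
  show "(r / R) * cutoff R r ^ n \<le> 1" "(r / R)\<^sup>2 * cutoff R r ^ n \<le> 1" using *[of 1] *[of 2] by auto
qed

context radial_weight
begin

text \<open>
  \<open>mfield R\<close> is the truncation of the radial field $r$, \<open>mdiv R\<close> its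
  divergence \<open>mfield' R r + k / r * mfield R r\<close>, and \<open>mweight R\<close> the
  truncation of $r^2$ with derivative \<open>2 * mfield R\<close>. The cube is the least power of
  the cutoff for which the divergence is $C^1$. Three properties matter: \<open>mfield'\<close> is
  at most 1, \<open>mdiv\<close> is at least $d - C r^2/R^2$, and \<open>mdiv'\<close> is at most
  of order $1/R$.
\<close>

definition mfield :: "real \<Rightarrow> real \<Rightarrow> real" where
  "mfield R r = r * cutoff R r ^ 3"
definition mfield' :: "real \<Rightarrow> real \<Rightarrow> real" where
  "mfield' R r = cutoff R r ^ 3 - 6 * (r / R)\<^sup>2 * cutoff R r ^ 2"
definition mdiv :: "real \<Rightarrow> real \<Rightarrow> real" where
  "mdiv R r = (real k + 1) * cutoff R r ^ 3 - 6 * (r / R)\<^sup>2 * cutoff R r ^ 2"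
definition mdiv' :: "real \<Rightarrow> real \<Rightarrow> real" where
  "mdiv' R r = - 6 * (real k + 1) * (r / R\<^sup>2) * cutoff R r ^ 2 - 12 * (r / R\<^sup>2) * cutoff R r ^ 2
     + 24 * (r / R)\<^sup>2 * (r / R\<^sup>2) * cutoff R r"
definition mweight :: "real \<Rightarrow> real \<Rightarrow> real" where
  "mweight R r = R\<^sup>2 / 4 * (1 - cutoff R r ^ 4)"

lemma mfield_deriv: assumes "R \<noteq> 0" shows "(mfield R has_real_derivative mfield' R r) (at r)"
proof -
  have "((\<lambda>r. r * cutoff R r ^ (1+2)) has_real_derivative
     1 * cutoff R r ^ (1+2) + (- 2 * real (1 + 2) * (r / R\<^sup>2) * cutoff R r ^ (1 + 1)) * r) (at r)"
    by (rule DERIV_mult[OF DERIV_ident DERIV_cutoff_power[OF assms]])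
  thus ?thesis by (simp add: mfield_def[abs_def] mfield'_def power2_eq_square algebra_simps numeral_3_eq_3 numeral_2_eq_2)
qed

lemma mdiv_deriv: assumes "R \<noteq> 0" shows "(mdiv R has_real_derivative mdiv' R r) (at r)"
proof -
  have sq: "((\<lambda>r. (r / R)\<^sup>2) has_real_derivative 2 * (r / R\<^sup>2)) (at r)"
    using assms by (auto intro!: derivative_eq_intros simp: power2_eq_square)
  have "((\<lambda>r. (real k + 1) * cutoff R r ^ (1+2) - 6 * ((r / R)\<^sup>2 * cutoff R r ^ (0+2))) has_real_derivative
     (real k + 1) * (- 2 * real (1 + 2) * (r / R\<^sup>2) * cutoff R r ^ (1 + 1))
     - 6 * (2 * (r / R\<^sup>2) * cutoff R r ^ (0+2) + (- 2 * real (0 + 2) * (r / R\<^sup>2) * cutoff R r ^ (0 + 1)) * (r / R)\<^sup>2)) (at r)"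
    by (intro DERIV_diff DERIV_cmult DERIV_mult DERIV_cutoff_power assms sq)
  moreover have "(real k + 1) * (- 2 * real (1 + 2) * (r / R\<^sup>2) * cutoff R r ^ (1 + 1))
     - 6 * (2 * (r / R\<^sup>2) * cutoff R r ^ (0+2) + (- 2 * real (0 + 2) * (r / R\<^sup>2) * cutoff R r ^ (0 + 1)) * (r / R)\<^sup>2) = mdiv' R r"
    unfolding mdiv'_def one_add_one add_0 power_one_right by (simp add: algebra_simps add_divide_distrib)
  moreover have "(\<lambda>r. (real k + 1) * cutoff R r ^ (1+2) - 6 * ((r / R)\<^sup>2 * cutoff R r ^ (0+2))) = mdiv R"
    by (simp add: mdiv_def fun_eq_iff numeral_3_eq_3 power2_eq_square mult.assoc)
  ultimately show ?thesis by simp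
qed

lemma mweight_deriv: assumes "R \<noteq> 0" shows "(mweight R has_real_derivative 2 * mfield R r) (at r)"
proof -
  have "((\<lambda>r. R\<^sup>2 / 4 * (1 - cutoff R r ^ (2+2))) has_real_derivative
     R\<^sup>2 / 4 * (0 - (- 2 * real (2 + 2) * (r / R\<^sup>2) * cutoff R r ^ (2 + 1)))) (at r)"
    by (intro DERIV_diff DERIV_cmult DERIV_const DERIV_cutoff_power assms)
  moreover have "R\<^sup>2 / 4 * (0 - (- 2 * real (2 + 2) * (r / R\<^sup>2) * cutoff R r ^ (2 + 1))) = 2 * mfield R r"
    using assms by (simp add: mfield_def numeral_3_eq_3 numeral_2_eq_2)
  ultimately show ?thesis by (simp add: mweight_def[abs_def])
qed

lemma continuous_cutoff: "continuous_on S (cutoff R)"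
  unfolding cutoff_def[abs_def] divide_inverse by (intro continuous_intros)

lemma continuous_multipliers: 
  "continuous_on S (mfield R)" "continuous_on S (mfield' R)" "continuous_on S (mdiv R)" "continuous_on S (mdiv' R)" "continuous_on S (mweight R)"
  unfolding mfield_def[abs_def] mfield'_def[abs_def] mdiv_def[abs_def] mdiv'_def[abs_def] mweight_def[abs_def] divide_inverse
  by (intro continuous_intros continuous_cutoff)+

lemma measurable_multipliers [measurable]:
  "mfield R \<in> borel_measurable borel" "mfield' R \<in> borel_measurable borel" "mdiv R \<in> borel_measurable borel"
  "mdiv' R \<in> borel_measurable borel" "mweight R \<in> borel_measurable borel"
  by (intro borel_measurable_continuous_onI continuous_multipliers)+

lemma mfield_bounds:
  assumes "0 < R" "0 < r"
  shows "0 \<le> mfield R r" "mfield R r \<le> r" "mfield R r \<le> R" "R \<le> r \<Longrightarrow> mfield R r = 0"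
proof -
  show "0 \<le> mfield R r" "mfield R r \<le> r" using assms cutoff_power_bounds[of R r 3]
    by (auto simp: mfield_def mult_left_le)
  show "mfield R r \<le> R" using cutoff_support(1)[OF assms, of 3] assms by (simp add: mfield_def field_simps)
  show "R \<le> r \<Longrightarrow> mfield R r = 0" using assms by (simp add: mfield_def cutoff_zero)
qed

lemma mfield'_bounds:
  assumes "0 < R" "0 < r" shows "mfield' R r \<le> 1" "\<bar>mfield' R r\<bar> \<le> 7"
proof -
  have "0 \<le> (r / R)\<^sup>2 * cutoff R r ^ 2" by (intro mult_nonneg_nonneg cutoff_power_bounds) simp
  moreover have "(r / R)\<^sup>2 * cutoff R r ^ 2 \<le> 1" by (rule cutoff_support(2)[OF assms]) simp
  moreover have "mfield' R r = cutoff R r ^ 3 - 6 * ((r / R)\<^sup>2 * cutoff R r ^ 2)" by (simp add: mfield'_def)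
  ultimately show "mfield' R r \<le> 1" "\<bar>mfield' R r\<bar> \<le> 7" using cutoff_power_bounds[of R r 3] by linarith+
qed

lemma mdiv_bounds:
  assumes "0 < R" "0 < r" shows "\<bar>mdiv R r\<bar> \<le> real k + 7" 
    "real k + 1 - (3 * (real k + 1) + 6) * (r / R)\<^sup>2 \<le> mdiv R r"
proof -
  have 1: "0 \<le> (r / R)\<^sup>2 * cutoff R r ^ 2" by (intro mult_nonneg_nonneg cutoff_power_bounds) simp
  have 2: "(r / R)\<^sup>2 * cutoff R r ^ 2 \<le> 1" by (rule cutoff_support(2)[OF assms]) simp
  have 3: "(r / R)\<^sup>2 * cutoff R r ^ 2 \<le> (r / R)\<^sup>2" by (intro mult_left_le cutoff_power_bounds) simp
  have e: "mdiv R r = (real k + 1) * cutoff R r ^ 3 - 6 * ((r / R)\<^sup>2 * cutoff R r ^ 2)" by (simp add: mdiv_def)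
  have 4: "0 \<le> (real k + 1) * cutoff R r ^ 3" by (intro mult_nonneg_nonneg cutoff_power_bounds) simp
  have 5: "(real k + 1) * cutoff R r ^ 3 \<le> real k + 1" by (intro mult_left_le cutoff_power_bounds) simp
  show "\<bar>mdiv R r\<bar> \<le> real k + 7" unfolding e using 1 2 4 5 by linarith
  have "(real k + 1) * (1 - cutoff R r ^ 3) \<le> (real k + 1) * (real 3 * (r / R)\<^sup>2)"
    by (intro mult_left_mono one_minus_cutoff_power_le) simp
  thus "real k + 1 - (3 * (real k + 1) + 6) * (r / R)\<^sup>2 \<le> mdiv R r" unfolding e using 3 by (simp add: algebra_simps)
qed

lemma mdiv'_bounds:
  assumes "0 < R" "0 < r" shows "\<bar>mdiv' R r\<bar> \<le> (6 * real k + 42) / R"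
proof -
  define x where "x = (r / R) * cutoff R r ^ 2"
  define y where "y = ((r / R)\<^sup>2 * ((r / R) * cutoff R r))"
  have 1: "0 \<le> x" "x \<le> 1" using cutoff_power_bounds cutoff_support(1)[OF assms, of 2] assms by (auto simp: x_def)
  have y: "0 \<le> y" "y \<le> 1"
  proof -
    show "0 \<le> y" using cutoff_bounds assms by (simp add: y_def)
    show "y \<le> 1"
    proof (cases "R \<le> r")
      case True thus ?thesis using assms by (simp add: y_def cutoff_zero)
    next
      case False
      hence "y \<le> 1 * 1" unfolding y_def using assms cutoff_support(1)[OF assms, of 1] cutoff_bounds[of R r]
        by (intro mult_mono power_le_one) auto
      thus ?thesis by simp
    qed
  qed
  have "mdiv' R r * R = - (6 * (real k + 1) + 12) * x + 24 * y"
    using assms by (simp add: mdiv'_def x_def y_def power2_eq_square field_simps)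
  hence "\<bar>mdiv' R r * R\<bar> = \<bar>24 * y - (6 * real k + 18) * x\<bar>" by (simp add: algebra_simps)
  moreover have "0 \<le> (6 * real k + 18) * x" "(6 * real k + 18) * x \<le> 6 * real k + 18"
    using 1 by (auto intro: mult_left_le)
  ultimately have "\<bar>mdiv' R r * R\<bar> \<le> 6 * real k + 42" using y by linarith
  thus ?thesis using assms by (simp add: abs_mult field_simps)
qed

lemma mweight_bounds:
  assumes "0 < R" shows "0 \<le> mweight R r" "mweight R r \<le> r\<^sup>2" "mweight R r \<le> R\<^sup>2 / 4"
proof -
  show "0 \<le> mweight R r" "mweight R r \<le> R\<^sup>2 / 4" using cutoff_power_bounds[of R r 4] by (auto simp: mweight_def mult_left_le)
  have "R\<^sup>2 / 4 * (1 - cutoff R r ^ 4) \<le> R\<^sup>2 / 4 * (real 4 * (r / R)\<^sup>2)"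
    by (intro mult_left_mono one_minus_cutoff_power_le) simp
  also have "\<dots> = r\<^sup>2" using assms by (simp add: power2_eq_square)
  finally show "mweight R r \<le> r\<^sup>2" by (simp add: mweight_def)
qed

text \<open>
  With $x = r^2/R^2 \le 1$ the weight is $R^2 (1 - (1-x)^4)/4 = r^2 + O(r^4/R^2)$.
\<close>

lemma mweight_tendsto: "(\<lambda>n. mweight (real (Suc n)) r) \<longlonglongrightarrow> r\<^sup>2"
proof -
  have bd: "r\<^sup>2 - 3/2 * r^4 / R\<^sup>2 \<le> mweight R r" if R: "0 < R" "\<bar>r\<bar> \<le> R" for R
  proof -
    define x where "x = (r / R)\<^sup>2"
    have x: "0 \<le> x" "x \<le> 1" using R by (simp_all add: x_def abs_square_le_1)
    have "(1 - x) ^ 4 \<le> 1 - 4 * x + 6 * x\<^sup>2"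
    proof -
      have "(1 - 4 * x + 6 * x\<^sup>2) - (1 - x) ^ 4 = x ^ 3 * (4 - x)" by (simp add: power2_eq_square power3_eq_cube power4_eq_xxxx algebra_simps)
      moreover have "0 \<le> x ^ 3 * (4 - x)" using x by simp
      ultimately show ?thesis by linarith
    qed
    hence "R\<^sup>2 / 4 * (4 * x - 6 * x\<^sup>2) \<le> R\<^sup>2 / 4 * (1 - (1 - x) ^ 4)" by (intro mult_left_mono) auto
    moreover have "R\<^sup>2 / 4 * (4 * x - 6 * x\<^sup>2) = r\<^sup>2 - 3/2 * r^4 / R\<^sup>2"
      using R by (simp add: x_def power2_eq_square power4_eq_xxxx field_simps)
    moreover have "cutoff R r = 1 - x" using x by (simp add: cutoff_def x_def)
    ultimately show ?thesis by (simp add: mweight_def)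
  qed
  have eq: "r\<^sup>2 - 3/2 * r^4 / (real (Suc n))\<^sup>2 = r\<^sup>2 - 3/2 * r^4 * (inverse (real (Suc n)))\<^sup>2" for n
    by (simp only: divide_inverse power_inverse)
  show ?thesis
  proof (rule tendsto_sandwich)
    have "\<forall>\<^sub>F n in sequentially. \<bar>r\<bar> \<le> real (Suc n)"
      using filterlim_compose[OF filterlim_real_sequentially filterlim_Suc] unfolding filterlim_at_top by blast
    thus "\<forall>\<^sub>F n in sequentially. r\<^sup>2 - 3/2 * r^4 / (real (Suc n))\<^sup>2 \<le> mweight (real (Suc n)) r"
      by eventually_elim (rule bd, auto)
    show "\<forall>\<^sub>F n in sequentially. mweight (real (Suc n)) r \<le> r\<^sup>2" by (intro always_eventually allI mweight_bounds) simp
    have "(\<lambda>n. r\<^sup>2 - 3/2 * r^4 * (inverse (real (Suc n)))\<^sup>2) \<longlonglongrightarrow> r\<^sup>2 - 3/2 * r^4 * 0\<^sup>2"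
      by (intro tendsto_intros LIMSEQ_inverse_real_of_nat)
    thus "(\<lambda>n. r\<^sup>2 - 3/2 * r^4 / (real (Suc n))\<^sup>2) \<longlonglongrightarrow> r\<^sup>2"
      unfolding eq by (simp only: zero_power2 mult_zero_right diff_zero)
  qed (rule tendsto_const)
qed

end

section \<open>Flux identities for radial profiles\<close>

text \<open>
  Away from zeros of \<open>f\<close> this is the chain rule for $(|f|^2)^{\sigma+1}$. At a zero,
  write the function as the product of $|f|^2$, which is differentiable there, and
  $|f|^{2\sigma}$, which is merely continuous but is all that the difference quotient of the
  product needs, since $|f|^2$ vanishes at the point.
\<close>

lemma DERIV_cmod_powr:
  fixes f :: "real \<Rightarrow> complex"
  assumes f: "(f has_vector_derivative g) (at r)" and s: "0 < \<sigma>"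
  shows "((\<lambda>r. cmod (f r) powr (2 * \<sigma> + 2)) has_real_derivative
           (2 * \<sigma> + 2) * cmod (f r) powr (2 * \<sigma>) * Re (cnj (f r) * g)) (at r)"
proof -
  have re: "((\<lambda>r. Re (f r)) has_real_derivative Re g) (at r)"
    using bounded_linear.has_vector_derivative[OF bounded_linear_Re f] unfolding has_real_derivative_iff_has_vector_derivative .
  have im: "((\<lambda>r. Im (f r)) has_real_derivative Im g) (at r)"
    using bounded_linear.has_vector_derivative[OF bounded_linear_Im f] unfolding has_real_derivative_iff_has_vector_derivative .
  have sq: "((\<lambda>r. (cmod (f r))\<^sup>2) has_real_derivative 2 * Re (cnj (f r) * g)) (at r)"
    using DERIV_add[OF DERIV_power[OF re, of 2] DERIV_power[OF im, of 2]]
    unfolding cmod_power2 by (simp add: algebra_simps)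
  have eq: "x powr (2 * \<sigma> + 2) = (x\<^sup>2) powr (\<sigma> + 1)" if "0 \<le> x" for x :: real
    using that powr_powr[of x 2 "\<sigma> + 1"] by (simp add: algebra_simps)
  show ?thesis
  proof (cases "f r = 0")
    case False
    have "((\<lambda>r. ((cmod (f r))\<^sup>2) powr (\<sigma> + 1)) has_real_derivative
        ((\<sigma> + 1) * ((cmod (f r))\<^sup>2) powr (\<sigma> + 1 - 1)) * (2 * Re (cnj (f r) * g))) (at r)"
      by (rule DERIV_fun_powr[OF sq, THEN DERIV_cong]) (use False in auto)
    moreover have "((cmod (f r))\<^sup>2) powr \<sigma> = cmod (f r) powr (2 * \<sigma>)"
      using powr_powr[of "cmod (f r)" 2 \<sigma>] by simp
    moreover have "(\<lambda>r. cmod (f r) powr (2 * \<sigma> + 2)) = (\<lambda>r. ((cmod (f r))\<^sup>2) powr (\<sigma> + 1))"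
      by (simp only: eq[OF norm_ge_zero])
    ultimately show ?thesis by (simp add: algebra_simps)
  next
    case True
    have split: "cmod z powr (2 * \<sigma> + 2) = (cmod z)\<^sup>2 * cmod z powr (2 * \<sigma>)" for z
      by (simp add: powr_add)
    have cont: "((\<lambda>x. cmod (f x) powr (2 * \<sigma>)) \<longlongrightarrow> cmod (f r) powr (2 * \<sigma>)) (at r)"
    proof (rule tendsto_powr')
      have "isCont f r" using f by (rule has_vector_derivative_continuous)
      thus "((\<lambda>x. cmod (f x)) \<longlongrightarrow> cmod (f r)) (at r)" by (intro tendsto_norm) (simp add: isCont_def)
    qed (use s in auto)
    have "((\<lambda>x. ((cmod (f x))\<^sup>2 - (cmod (f r))\<^sup>2) / (x - r) * cmod (f x) powr (2 * \<sigma>)) \<longlongrightarrow>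
        2 * Re (cnj (f r) * g) * cmod (f r) powr (2 * \<sigma>)) (at r)"
      by (intro tendsto_mult cont sq[unfolded has_field_derivative_iff])
    moreover have "(\<lambda>x. ((cmod (f x))\<^sup>2 - (cmod (f r))\<^sup>2) / (x - r) * cmod (f x) powr (2 * \<sigma>))
       = (\<lambda>x. (cmod (f x) powr (2 * \<sigma> + 2) - cmod (f r) powr (2 * \<sigma> + 2)) / (x - r))"
      using True by (auto simp: split)
    ultimately have "((\<lambda>r. cmod (f r) powr (2 * \<sigma> + 2)) has_real_derivative
        2 * Re (cnj (f r) * g) * cmod (f r) powr (2 * \<sigma>)) (at r)"
      by (simp only: has_field_derivative_iff)
    thus ?thesis using True by simp
  qed
qed

context radial_weight
begin

text \<open>
  The Laplacian of a radial function with radial derivative \<open>g\<close> and second radial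
  derivative \<open>q\<close>.
\<close>

definition radial_laplacian :: "(real \<Rightarrow> complex) \<Rightarrow> (real \<Rightarrow> complex) \<Rightarrow> real \<Rightarrow> complex" where
  "radial_laplacian g q r = q r + of_real (k / r) * g r"

text \<open>
  Profiles of bounded radial functions whose gradient and Laplacian are square integrable. The
  second derivative \<open>q\<close> exists only almost everywhere.
\<close>

definition profile :: "(real \<Rightarrow> complex) \<Rightarrow> (real \<Rightarrow> complex) \<Rightarrow> (real \<Rightarrow> complex) \<Rightarrow> bool" where
  "profile f g q \<longleftrightarrow> (\<forall>r>0. (f has_vector_derivative g r) (at r)) \<and> ac_pos g q \<and>
     sq_int \<mu> f \<and> sq_int \<mu> g \<and> sq_int \<mu> (radial_laplacian g q) \<and> (\<exists>B. \<forall>r>0. cmod (f r) \<le> B)"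

lemma profile_diff:
  assumes "profile f1 g1 q1" "profile f2 g2 q2"
  shows "profile (\<lambda>r. f1 r - f2 r) (\<lambda>r. g1 r - g2 r) (\<lambda>r. q1 r - q2 r)"
proof -
  obtain B1 B2 where B: "\<forall>r>0. cmod (f1 r) \<le> B1" "\<forall>r>0. cmod (f2 r) \<le> B2"
    using assms by (auto simp: profile_def)
  have "\<forall>r>0. cmod (f1 r - f2 r) \<le> B1 + B2"
    using B by (metis add_mono norm_triangle_ineq4 order_trans)
  moreover have "radial_laplacian (\<lambda>r. g1 r - g2 r) (\<lambda>r. q1 r - q2 r) = (\<lambda>r. radial_laplacian g1 q1 r - radial_laplacian g2 q2 r)"
    by (simp add: radial_laplacian_def fun_eq_iff algebra_simps diff_divide_distrib)
  ultimately show ?thesis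
    using assms unfolding profile_def
    by (auto intro!: has_vector_derivative_diff ac_pos_diff sq_int_diff)
qed

lemma profile_ac:
  assumes "profile f g q" shows "ac_pos f g" "ac_pos g q"
proof -
  show g: "ac_pos g q" using assms by (simp add: profile_def)
  show "ac_pos f g"
    by (rule ac_pos_C1) (use assms ac_pos_continuous[OF g] in \<open>auto simp: profile_def\<close>)
qed

lemma ac_weight: "ac_pos (\<lambda>r. of_real (weight r)) (\<lambda>r. of_real (weight r * (k / r)))"
proof (rule ac_pos_C1)
  show "((\<lambda>r. complex_of_real (weight r)) has_vector_derivative complex_of_real (weight r * (k / r))) (at r)" if "0 < r" for r
  proof -
    have "(weight has_real_derivative c * (real k * r ^ (k - Suc 0))) (at r)"
      unfolding weight_def[abs_def] by (intro DERIV_cmult DERIV_pow)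
    moreover have "r ^ k = r * r ^ (k - Suc 0)" using k_pos by (cases k) auto
    hence "c * (real k * r ^ (k - Suc 0)) = weight r * (k / r)" unfolding weight_def using that by simp
    ultimately have "(weight has_real_derivative weight r * (k / r)) (at r)" by simp
    thus ?thesis
      by (intro has_vector_derivative_of_real) (simp add: has_real_derivative_iff_has_vector_derivative[symmetric])
  qed
  show "continuous_on {0<..} (\<lambda>r. complex_of_real (weight r * (k / r)))"
    unfolding weight_def by (intro continuous_intros) auto
qed

lemma ac_weight_mult:
  assumes "ac_pos g q" shows "ac_pos (\<lambda>r. of_real (weight r) * g r) (\<lambda>r. of_real (weight r) * radial_laplacian g q r)"
  by (rule ac_pos_cong[OF ac_pos_mult[OF ac_weight assms]]) (auto simp: radial_laplacian_def algebra_simps)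

lemma ac_of_real:
  assumes "\<And>r. (A has_real_derivative A' r) (at r)" "continuous_on {0<..} A'"
  shows "ac_pos (\<lambda>r. complex_of_real (A r)) (\<lambda>r. complex_of_real (A' r))"
proof (rule ac_pos_C1)
  show "((\<lambda>r. complex_of_real (A r)) has_vector_derivative complex_of_real (A' r)) (at r)" for r
    using assms(1)[of r]
    by (intro has_vector_derivative_of_real) (simp add: has_real_derivative_iff_has_vector_derivative[symmetric])
qed (intro continuous_intros assms)

text \<open>
  The vanishing-flux principle for the radial measure, with the density of the form weight times
  \<open>H\<close>.
\<close>

lemma flux_zero:
  assumes ac: "ac_pos (\<lambda>r. of_real (weight r) * \<Phi> r) (\<lambda>r. of_real (weight r) * \<Gamma> r)"
    and \<Gamma>: "integrable \<mu> \<Gamma>" and H: "integrable \<mu> H" and H0: "\<And>r. 0 \<le> H r"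
    and near0: "\<And>r. 0 < r \<Longrightarrow> r \<le> 1 \<Longrightarrow> weight r * cmod (\<Phi> r) \<le> C * (r + sqrt (r * (weight r * H r)) + r * (weight r * H r))"
    and nearinf: "\<And>r. R \<le> r \<Longrightarrow> 0 < r \<Longrightarrow> weight r * cmod (\<Phi> r) \<le> C * (r * (weight r * H r))"
  shows "(\<integral>r. \<Gamma> r \<partial>\<mu>) = 0"
proof -
  have m: "\<Gamma> \<in> borel_measurable borel" "H \<in> borel_measurable borel"
    using borel_measurable_integrable[OF \<Gamma>] borel_measurable_integrable[OF H] by simp_all
  have "(LINT r:{0<..}|lborel. of_real (weight r) * \<Gamma> r) = 0"
  proof (rule zero_flux[OF ac, where h="\<lambda>r. weight r * H r" and C=C and R="max R 1"])
    show "set_integrable lborel {0<..} (\<lambda>r. of_real (weight r) * \<Gamma> r)"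
      using \<Gamma> by (simp add: integrable_\<mu>[OF m(1)] scaleR_conv_of_real)
    show "set_integrable lborel {0<..} (\<lambda>r. weight r * H r)"
      using H by (simp add: integrable_\<mu>[OF m(2)])
    show "cmod (of_real (weight r) * \<Phi> r) \<le> C * (r + sqrt (r * (weight r * H r)) + r * (weight r * H r))" if "0 < r" "r \<le> 1" for r
      using near0[OF that] weight_pos[of r] that by (simp add: norm_mult)
    show "cmod (of_real (weight r) * \<Phi> r) \<le> C * (r * (weight r * H r))" if "max R 1 \<le> r" for r
      using nearinf[of r] weight_pos[of r] that by (simp add: norm_mult)
    show "0 \<le> weight r * H r" if "0 < r" for r using weight_pos[OF that] H0[of r] by simp
  qed
  thus ?thesis by (simp add: integral_\<mu>[OF m(1)] scaleR_conv_of_real)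
qed

lemma weight_le: "0 < r \<Longrightarrow> r \<le> 1 \<Longrightarrow> weight r \<le> c * r" "0 < r \<Longrightarrow> r \<le> 1 \<Longrightarrow> weight r \<le> c"
proof -
  assume r: "0 < r" "r \<le> 1"
  have "r ^ k \<le> r ^ 1" using r k_pos by (intro power_decreasing) auto
  thus "weight r \<le> c * r" using c_pos by (simp add: weight_def)
  also have "\<dots> \<le> c" using r c_pos by (simp add: mult_left_le)
  finally show "weight r \<le> c" .
qed

lemma profile_H:
  assumes "profile f g q" 
  shows "integrable \<mu> (\<lambda>r. (cmod (f r))\<^sup>2 + (cmod (g r))\<^sup>2)"
  using assms by (auto simp: profile_def sq_int_def)

text \<open>
  The total derivative of $w A \bar f g$. At infinity it is dominated by $|f|^2 + |g|^2$; near the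
  origin boundedness of \<open>f\<close> and $w \le c r$ give $|w A \bar f g| \le C \sqrt{r \cdot
  w |g|^2}$.
\<close>

lemma flux_fg:
  assumes P: "profile f g q" and A: "\<And>r. (A has_real_derivative A' r) (at r)" 
    and A'c: "continuous_on UNIV A'"
    and Ab: "\<And>r. 0 < r \<Longrightarrow> \<bar>A r\<bar> \<le> K" and A'b: "\<And>r. 0 < r \<Longrightarrow> \<bar>A' r\<bar> \<le> K"
  shows "(\<integral>r. of_real (A' r) * (cnj (f r) * g r) + of_real (A r) * (of_real ((cmod (g r))\<^sup>2) + cnj (f r) * radial_laplacian g q r) \<partial>\<mu>) = 0"
    "integrable \<mu> (\<lambda>r. of_real (A' r) * (cnj (f r) * g r))"
    "integrable \<mu> (\<lambda>r. of_real (A r) * (of_real ((cmod (g r))\<^sup>2) + cnj (f r) * radial_laplacian g q r))"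
proof -
  have f: "sq_int \<mu> f" and g: "sq_int \<mu> g" and l: "sq_int \<mu> (radial_laplacian g q)"
    using P by (auto simp: profile_def)
  obtain B where B: "\<And>r. r > 0 \<Longrightarrow> cmod (f r) \<le> B" using P by (auto simp: profile_def)
  have B0: "0 \<le> B" using B[of 1] by (meson norm_ge_zero order_trans zero_less_one)
  have K0: "0 \<le> K" using Ab[of 1] by (meson abs_ge_zero order_trans zero_less_one)
  have Ac: "continuous_on UNIV A" by (rule DERIV_continuous_on[OF A])
  have [measurable]: "A \<in> borel_measurable borel" "A' \<in> borel_measurable borel"
    using Ac A'c by (auto intro: borel_measurable_continuous_onI)
  have bA: "AE r in \<mu>. cmod (of_real (A r)) \<le> K" "AE r in \<mu>. cmod (of_real (A' r)) \<le> K"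
    unfolding AE_\<mu> using Ab A'b by auto
  have i1: "integrable \<mu> (\<lambda>r. of_real (A' r) * cnj (f r) * g r)"
    by (rule sq_int_integrable_mult3[OF sq_int_cnj[OF f] g _ bA(2)]) simp
  show I1: "integrable \<mu> (\<lambda>r. of_real (A' r) * (cnj (f r) * g r))" using i1 by (simp add: mult.assoc)
  have i2: "integrable \<mu> (\<lambda>r. of_real (A r) * cnj (g r) * g r)"
    by (rule sq_int_integrable_mult3[OF sq_int_cnj[OF g] g _ bA(1)]) simp
  have i3: "integrable \<mu> (\<lambda>r. of_real (A r) * cnj (f r) * radial_laplacian g q r)"
    by (rule sq_int_integrable_mult3[OF sq_int_cnj[OF f] l _ bA(1)]) simp
  have gg: "of_real ((cmod z)\<^sup>2) = cnj z * z" for z by (simp add: complex_norm_square[symmetric] mult.commute)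
  show I2: "integrable \<mu> (\<lambda>r. of_real (A r) * (of_real ((cmod (g r))\<^sup>2) + cnj (f r) * radial_laplacian g q r))"
    using Bochner_Integration.integrable_add[OF i2 i3] unfolding gg by (simp add: algebra_simps)
  have ac: "ac_pos (\<lambda>r. of_real (weight r) * (of_real (A r) * cnj (f r) * g r)) 
     (\<lambda>r. of_real (weight r) * (of_real (A' r) * (cnj (f r) * g r) + of_real (A r) * (of_real ((cmod (g r))\<^sup>2) + cnj (f r) * radial_laplacian g q r)))"
    by (rule ac_pos_cong[OF ac_pos_mult[OF ac_pos_mult[OF ac_of_real[OF A continuous_on_subset[OF A'c subset_UNIV]] ac_pos_cnj[OF profile_ac(1)[OF P]]] ac_weight_mult[OF profile_ac(2)[OF P]]]])
       (unfold gg, auto simp: algebra_simps)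
  let ?H = "\<lambda>r. (cmod (f r))\<^sup>2 + (cmod (g r))\<^sup>2"
  show "(\<integral>r. of_real (A' r) * (cnj (f r) * g r) + of_real (A r) * (of_real ((cmod (g r))\<^sup>2) + cnj (f r) * radial_laplacian g q r) \<partial>\<mu>) = 0"
  proof (rule flux_zero[OF ac _ profile_H[OF P], where C="K * B * sqrt c + K" and R=1])
    have n: "cmod (of_real (A r) * cnj (f r) * g r) = \<bar>A r\<bar> * cmod (f r) * cmod (g r)" for r
      by (simp add: norm_mult)
    show "weight r * cmod (of_real (A r) * cnj (f r) * g r)
         \<le> (K * B * sqrt c + K) * (r + sqrt (r * (weight r * ?H r)) + r * (weight r * ?H r))" if r: "0 < r" "r \<le> 1" for r
    proof -
      have "\<bar>A r\<bar> * cmod (f r) * cmod (g r) \<le> K * B * cmod (g r)"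
        using Ab[OF r(1)] B[OF r(1)] K0 B0 by (intro mult_mono) auto
      hence "weight r * (\<bar>A r\<bar> * cmod (f r) * cmod (g r)) \<le> weight r * (K * B * cmod (g r))"
        using weight_pos[OF r(1)] by (intro mult_left_mono) auto
      also have "\<dots> = K * B * (weight r * cmod (g r))" by simp
      also have "weight r * cmod (g r) \<le> sqrt (c * (r * (weight r * ?H r)))"
      proof (rule real_le_rsqrt)
        have "(weight r * cmod (g r))\<^sup>2 = weight r * (weight r * (cmod (g r))\<^sup>2)" by (simp add: power2_eq_square)
        also have "\<dots> \<le> (c * r) * (weight r * ?H r)"
          using weight_le(1)[OF r] weight_pos[OF r(1)] r c_pos by (intro mult_mono mult_left_mono) auto
        finally show "(weight r * cmod (g r))\<^sup>2 \<le> c * (r * (weight r * ?H r))" by simp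
      qed
      hence "K * B * (weight r * cmod (g r)) \<le> K * B * sqrt (c * (r * (weight r * ?H r)))"
        using K0 B0 by (intro mult_left_mono) auto
      also have "\<dots> = K * B * sqrt c * sqrt (r * (weight r * ?H r))" by (simp add: real_sqrt_mult)
      also have "\<dots> \<le> (K * B * sqrt c + K) * (r + sqrt (r * (weight r * ?H r)) + r * (weight r * ?H r))"
        using K0 B0 c_pos r weight_pos[OF r(1)] by (intro mult_mono) auto
      finally show ?thesis unfolding n .
    qed
    show "weight r * cmod (of_real (A r) * cnj (f r) * g r) \<le> (K * B * sqrt c + K) * (r * (weight r * ?H r))" 
      if r: "1 \<le> r" "0 < r" for r
    proof -
      have "2 * (cmod (f r) * cmod (g r)) \<le> ?H r" using sum_squares_bound[of "cmod (f r)" "cmod (g r)"] by simp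
      moreover have "0 \<le> cmod (f r) * cmod (g r)" by simp
      ultimately have fg: "cmod (f r) * cmod (g r) \<le> ?H r" by linarith
      have "\<bar>A r\<bar> * (cmod (f r) * cmod (g r)) \<le> K * ?H r"
        using Ab[OF r(2)] fg K0 by (intro mult_mono) auto
      hence "weight r * (\<bar>A r\<bar> * cmod (f r) * cmod (g r)) \<le> weight r * (K * ?H r)"
        using weight_pos[OF r(2)] by (intro mult_left_mono) (auto simp: mult.assoc)
      also have "\<dots> = K * (1 * (weight r * ?H r))" by simp
      also have "\<dots> \<le> (K * B * sqrt c + K) * (r * (weight r * ?H r))"
        using K0 B0 c_pos weight_pos[OF r(2)] r by (intro mult_mono mult_right_mono) auto
      finally show ?thesis unfolding n .
    qed
  qed (use Bochner_Integration.integrable_add[OF I1 I2] in auto)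
qed

text \<open>
  The case $A = 1$: integration by parts against the Laplacian.
\<close>

lemma gradient_interpolation:
  assumes P: "profile f g q"
  shows "sq_norm \<mu> g \<le> sqrt (sq_norm \<mu> f) * sqrt (sq_norm \<mu> (radial_laplacian g q))"
proof -
  have f: "sq_int \<mu> f" and g: "sq_int \<mu> g" and l: "sq_int \<mu> (radial_laplacian g q)"
    using P by (auto simp: profile_def)
  have il: "integrable \<mu> (\<lambda>r. cnj (f r) * radial_laplacian g q r)" by (rule sq_int_integrable_mult[OF sq_int_cnj[OF f] l])
  have ig: "integrable \<mu> (\<lambda>r. complex_of_real ((cmod (g r))\<^sup>2))"
    by (rule integrable_of_real) (use g in \<open>simp add: sq_int_def\<close>)
  have "(\<integral>r. of_real ((cmod (g r))\<^sup>2) + cnj (f r) * radial_laplacian g q r \<partial>\<mu>) = 0"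
    using flux_fg(1)[OF P, of "\<lambda>_. 1" "\<lambda>_. 0" 1] by simp
  hence "(\<integral>r. complex_of_real ((cmod (g r))\<^sup>2) \<partial>\<mu>) + (\<integral>r. cnj (f r) * radial_laplacian g q r \<partial>\<mu>) = 0"
    using il ig by (simp only: Bochner_Integration.integral_add)
  moreover have "(\<integral>r. complex_of_real ((cmod (g r))\<^sup>2) \<partial>\<mu>) = of_real (sq_norm \<mu> g)"
    unfolding sq_norm_def by (rule integral_complex_of_real)
  ultimately have "of_real (sq_norm \<mu> g) = - (\<integral>r. cnj (f r) * radial_laplacian g q r \<partial>\<mu>)"
    by (simp add: eq_neg_iff_add_eq_0)
  hence "cmod (of_real (sq_norm \<mu> g)) = cmod (\<integral>r. cnj (f r) * radial_laplacian g q r \<partial>\<mu>)" by simp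
  also have "\<dots> \<le> sqrt (sq_norm \<mu> (\<lambda>r. cnj (f r))) * sqrt (sq_norm \<mu> (radial_laplacian g q))"
    by (rule L2_Cauchy_Schwarz[OF sq_int_cnj[OF f] l])
  finally show ?thesis by (simp add: sq_norm_def)
qed

text \<open>
  The total derivative of $w X |g|^2$ for the field $X$, that is \<open>mfield R\<close>. It
  equals $(X/w) |w g|^2$, and $(wg)' = w \Delta f$. The boundary term at the origin is at most $r
  \cdot w |g|^2$.
\<close>

lemma flux_gg:
  assumes P: "profile f g q" and R: "0 < R"
  shows "(\<integral>r. of_real ((2 * mfield' R r - mdiv R r) * (cmod (g r))\<^sup>2) + of_real (mfield R r) * (cnj (radial_laplacian g q r) * g r + cnj (g r) * radial_laplacian g q r) \<partial>\<mu>) = 0"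
    "integrable \<mu> (\<lambda>r. complex_of_real ((2 * mfield' R r - mdiv R r) * (cmod (g r))\<^sup>2))"
    "integrable \<mu> (\<lambda>r. of_real (mfield R r) * (cnj (radial_laplacian g q r) * g r + cnj (g r) * radial_laplacian g q r))"
proof -
  have f: "sq_int \<mu> f" and g: "sq_int \<mu> g" and l: "sq_int \<mu> (radial_laplacian g q)"
    using P by (auto simp: profile_def)
  have gg: "of_real ((cmod z)\<^sup>2) = cnj z * z" for z by (simp add: complex_norm_square[symmetric] mult.commute)
  have bA: "AE r in \<mu>. cmod (of_real (mfield R r)) \<le> R"
    unfolding AE_\<mu> using mfield_bounds[OF R] by auto
  have bE: "AE r in \<mu>. cmod (of_real (2 * mfield' R r - mdiv R r)) \<le> real k + 21"
  proof -
    have "\<bar>2 * mfield' R r - mdiv R r\<bar> \<le> real k + 21" if "r > 0" for r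
      using mfield'_bounds(2)[OF R that] mdiv_bounds(1)[OF R that] by linarith
    thus ?thesis unfolding AE_\<mu> norm_of_real by auto
  qed
  have "integrable \<mu> (\<lambda>r. of_real (2 * mfield' R r - mdiv R r) * cnj (g r) * g r)"
    by (rule sq_int_integrable_mult3[OF sq_int_cnj[OF g] g _ bE]) simp
  thus I1: "integrable \<mu> (\<lambda>r. complex_of_real ((2 * mfield' R r - mdiv R r) * (cmod (g r))\<^sup>2))"
    unfolding of_real_mult gg by (simp add: mult.assoc)
  have i2: "integrable \<mu> (\<lambda>r. of_real (mfield R r) * cnj (radial_laplacian g q r) * g r)"
    by (rule sq_int_integrable_mult3[OF sq_int_cnj[OF l] g _ bA]) simp
  have i3: "integrable \<mu> (\<lambda>r. of_real (mfield R r) * cnj (g r) * radial_laplacian g q r)"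
    by (rule sq_int_integrable_mult3[OF sq_int_cnj[OF g] l _ bA]) simp
  show I2: "integrable \<mu> (\<lambda>r. of_real (mfield R r) * (cnj (radial_laplacian g q r) * g r + cnj (g r) * radial_laplacian g q r))"
    using Bochner_Integration.integrable_add[OF i2 i3] by (simp add: algebra_simps)
  have e_eq: "mdiv R r = mfield' R r + k / r * mfield R r" if "r > 0" for r
    using that by (simp add: mdiv_def mfield'_def mfield_def algebra_simps)
  have ac: "ac_pos (\<lambda>r. of_real (weight r) * (of_real (mfield R r) * cnj (g r) * g r))
    (\<lambda>r. of_real (weight r) * (of_real ((2 * mfield' R r - mdiv R r) * (cmod (g r))\<^sup>2) + of_real (mfield R r) * (cnj (radial_laplacian g q r) * g r + cnj (g r) * radial_laplacian g q r)))"
  proof (rule ac_pos_cong[OF ac_pos_mult[OF ac_pos_mult[OF ac_of_real[OF mfield_deriv continuous_multipliers(2)] ac_pos_cnj[OF profile_ac(2)[OF P]]] ac_weight_mult[OF profile_ac(2)[OF P]]]])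
    show "R \<noteq> 0" using R by simp
    show "of_real (weight r) * (of_real (mfield R r) * cnj (g r) * g r) = of_real (mfield R r) * cnj (g r) * (of_real (weight r) * g r)" for r
      by simp
    show "of_real (weight r) * (of_real ((2 * mfield' R r - mdiv R r) * (cmod (g r))\<^sup>2) + of_real (mfield R r) * (cnj (radial_laplacian g q r) * g r + cnj (g r) * radial_laplacian g q r))
      = (of_real (mfield' R r) * cnj (g r) + of_real (mfield R r) * cnj (q r)) * (of_real (weight r) * g r) + of_real (mfield R r) * cnj (g r) * (of_real (weight r) * radial_laplacian g q r)"
      if "r > 0" for r
      unfolding of_real_mult gg e_eq[OF that] radial_laplacian_def by (simp add: algebra_simps)
  qed
  let ?H = "\<lambda>r. (cmod (f r))\<^sup>2 + (cmod (g r))\<^sup>2"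
  have bnd: "weight r * cmod (of_real (mfield R r) * cnj (g r) * g r) \<le> 1 * (r * (weight r * ?H r))" if r: "0 < r" for r
  proof -
    have "cmod (of_real (mfield R r) * cnj (g r) * g r) = mfield R r * (cmod (g r))\<^sup>2"
      using mfield_bounds(1)[OF R r] by (simp add: norm_mult power2_eq_square)
    also have "\<dots> \<le> r * ?H r" using mfield_bounds(1,2)[OF R r] r by (intro mult_mono) auto
    finally have "weight r * cmod (of_real (mfield R r) * cnj (g r) * g r) \<le> weight r * (r * ?H r)"
      using weight_pos[OF r] by (intro mult_left_mono) auto
    thus ?thesis by (simp add: mult_ac)
  qed
  show "(\<integral>r. of_real ((2 * mfield' R r - mdiv R r) * (cmod (g r))\<^sup>2) + of_real (mfield R r) * (cnj (radial_laplacian g q r) * g r + cnj (g r) * radial_laplacian g q r) \<partial>\<mu>) = 0"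
  proof (rule flux_zero[OF ac _ profile_H[OF P], where C=1 and R=1])
    show "weight r * cmod (of_real (mfield R r) * cnj (g r) * g r) \<le> 1 * (r + sqrt (r * (weight r * ?H r)) + r * (weight r * ?H r))"
      if "0 < r" "r \<le> 1" for r
    proof -
      define X where "X = r * (weight r * ?H r)"
      have "0 \<le> X" unfolding X_def using that weight_pos[OF that(1)] by simp
      hence "1 * X \<le> 1 * (r + sqrt X + X)" using that by simp
      with bnd[OF that(1)] show ?thesis unfolding X_def[symmetric] by (rule order_trans)
    qed
    show "integrable \<mu> (\<lambda>r. of_real ((2 * mfield' R r - mdiv R r) * (cmod (g r))\<^sup>2) + of_real (mfield R r) * (cnj (radial_laplacian g q r) * g r + cnj (g r) * radial_laplacian g q r))"
      by (rule Bochner_Integration.integrable_add[OF I1 I2])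
  qed (use bnd in auto)
qed

lemma powr_sq_bound:
  fixes \<sigma> x B :: real
  assumes "0 < \<sigma>" "0 \<le> x" "x \<le> B" shows "x powr (2 * \<sigma> + 2) \<le> B powr (2 * \<sigma>) * x\<^sup>2"
proof -
  have "x powr (2 * \<sigma> + 2) = x powr (2 * \<sigma>) * x\<^sup>2" using assms by (simp add: powr_add)
  also have "\<dots> \<le> B powr (2 * \<sigma>) * x\<^sup>2" using assms by (intro mult_right_mono powr_mono2) auto
  finally show ?thesis .
qed

lemma integrable_potential:
  assumes f: "sq_int \<mu> f" and B: "\<And>r. r > 0 \<Longrightarrow> cmod (f r) \<le> B" and s: "0 < \<sigma>"
  shows "integrable \<mu> (\<lambda>r. cmod (f r) powr (2 * \<sigma> + 2))"
proof (rule Bochner_Integration.integrable_bound)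
  note [measurable] = sq_int_measurable[OF f, simplified]
  show "integrable \<mu> (\<lambda>r. B powr (2 * \<sigma>) * (cmod (f r))\<^sup>2)" using f by (simp add: sq_int_def)
  show "(\<lambda>r. cmod (f r) powr (2 * \<sigma> + 2)) \<in> borel_measurable \<mu>" by simp
  show "AE r in \<mu>. norm (cmod (f r) powr (2 * \<sigma> + 2)) \<le> norm (B powr (2 * \<sigma>) * (cmod (f r))\<^sup>2)"
    unfolding AE_\<mu> using powr_sq_bound[OF s norm_ge_zero B] by auto
qed

lemma sq_int_nonlinearity:
  assumes f: "sq_int \<mu> f" and B: "\<And>r. r > 0 \<Longrightarrow> cmod (f r) \<le> B" and s: "0 < \<sigma>"
  shows "sq_int \<mu> (\<lambda>r. of_real (cmod (f r) powr (2 * \<sigma>)) * f r)"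
proof (rule sq_int_mult_bdd[OF f])
  note [measurable] = sq_int_measurable[OF f, simplified]
  show "(\<lambda>r. complex_of_real (cmod (f r) powr (2 * \<sigma>))) \<in> borel_measurable \<mu>" by simp
  show "AE r in \<mu>. cmod (of_real (cmod (f r) powr (2 * \<sigma>))) \<le> B powr (2 * \<sigma>)"
    unfolding AE_\<mu> using B s by (auto intro!: powr_mono2)
qed

text \<open>
  The total derivative of $w X |f|^{2\sigma+2}$; the field vanishes beyond \<open>R\<close>.
\<close>

lemma flux_potential:
  assumes P: "profile f g q" and R: "0 < R" and s: "0 < \<sigma>"
  shows "(\<integral>r. of_real (mdiv R r * cmod (f r) powr (2 * \<sigma> + 2) + (2 * \<sigma> + 2) * mfield R r * cmod (f r) powr (2 * \<sigma>) * Re (cnj (f r) * g r)) \<partial>\<mu>) = (0::complex)"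
    "integrable \<mu> (\<lambda>r. complex_of_real (mdiv R r * cmod (f r) powr (2 * \<sigma> + 2) + (2 * \<sigma> + 2) * mfield R r * cmod (f r) powr (2 * \<sigma>) * Re (cnj (f r) * g r)))"
    "integrable \<mu> (\<lambda>r. mdiv R r * cmod (f r) powr (2 * \<sigma> + 2))"
proof -
  have f: "sq_int \<mu> f" and g: "sq_int \<mu> g" using P by (auto simp: profile_def)
  note [measurable] = sq_int_measurable[OF f, simplified] sq_int_measurable[OF g, simplified]
  obtain B where B: "\<And>r. r > 0 \<Longrightarrow> cmod (f r) \<le> B" using P by (auto simp: profile_def)
  have B0: "0 \<le> B" using B[of 1] by (meson norm_ge_zero order_trans zero_less_one)
  define V where "V r = cmod (f r) powr (2 * \<sigma> + 2)" for r
  define V' where "V' r = (2 * \<sigma> + 2) * cmod (f r) powr (2 * \<sigma>) * Re (cnj (f r) * g r)" for r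
  have Vi: "integrable \<mu> V" unfolding V_def[abs_def] by (rule integrable_potential[OF f B s])
  have [measurable]: "V \<in> borel_measurable borel" unfolding V_def[abs_def] by measurable
  have gc: "continuous_on {0<..} g" by (rule ac_pos_continuous[OF profile_ac(2)[OF P]])
  have fc: "continuous_on {0<..} f" by (rule ac_pos_continuous[OF profile_ac(1)[OF P]])
  have acV: "ac_pos (\<lambda>r. complex_of_real (V r)) (\<lambda>r. complex_of_real (V' r))"
  proof (rule ac_pos_C1)
    show "((\<lambda>r. complex_of_real (V r)) has_vector_derivative complex_of_real (V' r)) (at r)" if "r > 0" for r
    proof -
      have "(f has_vector_derivative g r) (at r)" using P that by (simp add: profile_def)
      from DERIV_cmod_powr[OF this s] show ?thesis unfolding V_def V'_def
        by (intro has_vector_derivative_of_real) (simp add: has_real_derivative_iff_has_vector_derivative[symmetric])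
    qed
    show "continuous_on {0<..} (\<lambda>r. complex_of_real (V' r))"
      unfolding V'_def using s by (intro continuous_intros fc gc continuous_on_powr') auto
  qed
  have eV: "integrable \<mu> (\<lambda>r. mdiv R r * V r)"
  proof (rule Bochner_Integration.integrable_bound)
    show "integrable \<mu> (\<lambda>r. (real k + 7) * V r)" using Vi by simp
    show "AE r in \<mu>. norm (mdiv R r * V r) \<le> norm ((real k + 7) * V r)"
      unfolding AE_\<mu>
    proof (intro AE_I2 impI)
      fix r :: real assume "0 < r"
      hence "\<bar>mdiv R r\<bar> * V r \<le> (real k + 7) * V r" by (intro mult_right_mono mdiv_bounds(1)[OF R]) (simp_all add: V_def)
      thus "norm (mdiv R r * V r) \<le> norm ((real k + 7) * V r)" by (simp add: abs_mult V_def)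
    qed
  qed simp
  thus "integrable \<mu> (\<lambda>r. mdiv R r * cmod (f r) powr (2 * \<sigma> + 2))" by (simp add: V_def)
  have bV: "integrable \<mu> (\<lambda>r. mfield R r * V' r)"
  proof -
    have N: "sq_int \<mu> (\<lambda>r. of_real (cmod (f r) powr (2 * \<sigma>)) * f r)" by (rule sq_int_nonlinearity[OF f B s])
    have bA: "AE r in \<mu>. cmod (of_real (mfield R r)) \<le> R"
      unfolding AE_\<mu> using mfield_bounds[OF R] by auto
    have "integrable \<mu> (\<lambda>r. of_real (mfield R r) * cnj (of_real (cmod (f r) powr (2 * \<sigma>)) * f r) * g r)"
      by (rule sq_int_integrable_mult3[OF sq_int_cnj[OF N] g _ bA]) simp
    from integrable_mult_right[OF integrable_Re[OF this], of "2 * \<sigma> + 2"]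
    show ?thesis by (simp add: V'_def algebra_simps)
  qed
  have eq: "of_real (mdiv R r * cmod (f r) powr (2 * \<sigma> + 2) + (2 * \<sigma> + 2) * mfield R r * cmod (f r) powr (2 * \<sigma>) * Re (cnj (f r) * g r)) = complex_of_real (mdiv R r * V r + mfield R r * V' r)" for r
    by (simp add: V_def V'_def algebra_simps)
  have I: "integrable \<mu> (\<lambda>r. complex_of_real (mdiv R r * V r + mfield R r * V' r))"
    by (rule integrable_of_real[OF Bochner_Integration.integrable_add[OF eV bV]])
  thus "integrable \<mu> (\<lambda>r. complex_of_real (mdiv R r * cmod (f r) powr (2 * \<sigma> + 2) + (2 * \<sigma> + 2) * mfield R r * cmod (f r) powr (2 * \<sigma>) * Re (cnj (f r) * g r)))"
    unfolding eq .
  have e_eq: "mdiv R r = mfield' R r + k / r * mfield R r" if "r > 0" for r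
    using that by (simp add: mdiv_def mfield'_def mfield_def algebra_simps)
  have ac: "ac_pos (\<lambda>r. of_real (weight r) * (of_real (mfield R r) * complex_of_real (V r))) (\<lambda>r. of_real (weight r) * complex_of_real (mdiv R r * V r + mfield R r * V' r))"
  proof (rule ac_pos_cong[OF ac_pos_mult[OF ac_pos_mult[OF ac_weight ac_of_real[OF mfield_deriv continuous_multipliers(2)]] acV]])
    show "R \<noteq> 0" using R by simp
    show "complex_of_real (weight r) * (of_real (mfield R r) * of_real (V r)) = of_real (weight r) * of_real (mfield R r) * of_real (V r)" for r by simp
    show "complex_of_real (weight r) * of_real (mdiv R r * V r + mfield R r * V' r)
      = (of_real (weight r * (k / r)) * of_real (mfield R r) + of_real (weight r) * of_real (mfield' R r)) * of_real (V r) + of_real (weight r) * of_real (mfield R r) * of_real (V' r)"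
      if "r > 0" for r unfolding e_eq[OF that] by (simp add: algebra_simps)
  qed
  let ?H = "\<lambda>r. (cmod (f r))\<^sup>2 + (cmod (g r))\<^sup>2"
  show "(\<integral>r. of_real (mdiv R r * cmod (f r) powr (2 * \<sigma> + 2) + (2 * \<sigma> + 2) * mfield R r * cmod (f r) powr (2 * \<sigma>) * Re (cnj (f r) * g r)) \<partial>\<mu>) = (0::complex)"
    unfolding eq
  proof (rule flux_zero[OF ac I profile_H[OF P], where C="c * B powr (2 * \<sigma> + 2)" and R=R])
    show "weight r * cmod (of_real (mfield R r) * complex_of_real (V r))
         \<le> c * B powr (2 * \<sigma> + 2) * (r + sqrt (r * (weight r * ?H r)) + r * (weight r * ?H r))" if r: "0 < r" "r \<le> 1" for r
    proof -
      have "cmod (of_real (mfield R r) * complex_of_real (V r)) = mfield R r * V r"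
        using mfield_bounds(1)[OF R r(1)] by (simp add: V_def norm_mult)
      also have "\<dots> \<le> r * B powr (2 * \<sigma> + 2)"
        unfolding V_def using mfield_bounds(1,2)[OF R r(1)] B[OF r(1)] r s by (intro mult_mono powr_mono2) auto
      finally have "weight r * cmod (of_real (mfield R r) * complex_of_real (V r)) \<le> c * (r * B powr (2 * \<sigma> + 2))"
        using weight_le(2)[OF r] weight_pos[OF r(1)] c_pos by (intro mult_mono) auto
      also have "\<dots> = c * B powr (2 * \<sigma> + 2) * r" by simp
      also have "\<dots> \<le> c * B powr (2 * \<sigma> + 2) * (r + sqrt (r * (weight r * ?H r)) + r * (weight r * ?H r))"
        using c_pos r weight_pos[OF r(1)] by (intro mult_left_mono) auto
      finally show ?thesis .
    qed
    show "weight r * cmod (of_real (mfield R r) * complex_of_real (V r)) \<le> c * B powr (2 * \<sigma> + 2) * (r * (weight r * ?H r))"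
      if "R \<le> r" "0 < r" for r
      using mfield_bounds(4)[OF R that(2,1)] c_pos weight_pos[OF that(2)] that by simp
  qed auto
qed

text \<open>
  The total derivative of $w X \bar f f_2$. It moves the derivative off $f_2$, which will be a
  difference of the solution at two times.
\<close>

lemma flux_difference:
  assumes P: "profile f g q" and P2: "profile f2 g2 q2" and R: "0 < R"
  shows "(\<integral>r. of_real (mfield R r) * cnj (f r) * g2 r \<partial>\<mu>) = - (\<integral>r. (of_real (mdiv R r) * cnj (f r) + of_real (mfield R r) * cnj (g r)) * f2 r \<partial>\<mu>)"
    "sq_int \<mu> (\<lambda>r. of_real (mdiv R r) * cnj (f r) + of_real (mfield R r) * cnj (g r))"
proof -
  have f: "sq_int \<mu> f" and g: "sq_int \<mu> g" and f2: "sq_int \<mu> f2" and g2: "sq_int \<mu> g2"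
    using P P2 by (auto simp: profile_def)
  obtain B where B: "\<And>r. r > 0 \<Longrightarrow> cmod (f r) \<le> B" using P by (auto simp: profile_def)
  have B0: "0 \<le> B" using B[of 1] by (meson norm_ge_zero order_trans zero_less_one)
  obtain B2 where B2: "\<And>r. r > 0 \<Longrightarrow> cmod (f2 r) \<le> B2" using P2 by (auto simp: profile_def)
  have B20: "0 \<le> B2" using B2[of 1] by (meson norm_ge_zero order_trans zero_less_one)
  have bA: "AE r in \<mu>. cmod (of_real (mfield R r)) \<le> R"
    unfolding AE_\<mu> using mfield_bounds[OF R] by auto
  have bE: "AE r in \<mu>. cmod (of_real (mdiv R r)) \<le> real k + 7"
    unfolding AE_\<mu> using mdiv_bounds(1)[OF R] by auto
  have s1: "sq_int \<mu> (\<lambda>r. of_real (mdiv R r) * cnj (f r))" by (rule sq_int_mult_bdd[OF sq_int_cnj[OF f] _ bE]) simp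
  have s2: "sq_int \<mu> (\<lambda>r. of_real (mfield R r) * cnj (g r))" by (rule sq_int_mult_bdd[OF sq_int_cnj[OF g] _ bA]) simp
  show S: "sq_int \<mu> (\<lambda>r. of_real (mdiv R r) * cnj (f r) + of_real (mfield R r) * cnj (g r))"
    by (rule sq_int_add[OF s1 s2])
  have I1: "integrable \<mu> (\<lambda>r. (of_real (mdiv R r) * cnj (f r) + of_real (mfield R r) * cnj (g r)) * f2 r)"
    by (rule sq_int_integrable_mult[OF S f2])
  have I2: "integrable \<mu> (\<lambda>r. of_real (mfield R r) * cnj (f r) * g2 r)"
    by (rule sq_int_integrable_mult3[OF sq_int_cnj[OF f] g2 _ bA]) simp
  have e_eq: "mdiv R r = mfield' R r + k / r * mfield R r" if "r > 0" for r
    using that by (simp add: mdiv_def mfield'_def mfield_def algebra_simps)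
  let ?G = "\<lambda>r. (of_real (mdiv R r) * cnj (f r) + of_real (mfield R r) * cnj (g r)) * f2 r + of_real (mfield R r) * cnj (f r) * g2 r"
  have ac: "ac_pos (\<lambda>r. of_real (weight r) * (of_real (mfield R r) * cnj (f r) * f2 r)) (\<lambda>r. of_real (weight r) * ?G r)"
  proof (rule ac_pos_cong[OF ac_pos_mult[OF ac_pos_mult[OF ac_pos_mult[OF ac_weight ac_of_real[OF mfield_deriv continuous_multipliers(2)]] ac_pos_cnj[OF profile_ac(1)[OF P]]] profile_ac(1)[OF P2]]])
    show "R \<noteq> 0" using R by simp
    show "of_real (weight r) * (of_real (mfield R r) * cnj (f r) * f2 r) = of_real (weight r) * of_real (mfield R r) * cnj (f r) * f2 r" for r by simp
    show "of_real (weight r) * ?G r = ((of_real (weight r * (k / r)) * of_real (mfield R r) + of_real (weight r) * of_real (mfield' R r)) * cnj (f r) + of_real (weight r) * of_real (mfield R r) * cnj (g r)) * f2 r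
       + of_real (weight r) * of_real (mfield R r) * cnj (f r) * g2 r" if "r > 0" for r
      unfolding e_eq[OF that] by (simp add: algebra_simps)
  qed
  let ?H = "\<lambda>r. (cmod (f r))\<^sup>2 + (cmod (g r))\<^sup>2"
  have "(\<integral>r. ?G r \<partial>\<mu>) = 0"
  proof (rule flux_zero[OF ac Bochner_Integration.integrable_add[OF I1 I2] profile_H[OF P], where C="c * (B * B2)" and R=R])
    show "weight r * cmod (of_real (mfield R r) * cnj (f r) * f2 r)
         \<le> c * (B * B2) * (r + sqrt (r * (weight r * ?H r)) + r * (weight r * ?H r))" if r: "0 < r" "r \<le> 1" for r
    proof -
      have "cmod (of_real (mfield R r) * cnj (f r) * f2 r) = mfield R r * (cmod (f r) * cmod (f2 r))"
        using mfield_bounds(1)[OF R r(1)] by (simp add: norm_mult)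
      also have "\<dots> \<le> r * (B * B2)"
        using mfield_bounds(1,2)[OF R r(1)] B[OF r(1)] B2[OF r(1)] r B0 by (intro mult_mono) auto
      finally have "weight r * cmod (of_real (mfield R r) * cnj (f r) * f2 r) \<le> c * (r * (B * B2))"
        using weight_le(2)[OF r] weight_pos[OF r(1)] c_pos by (intro mult_mono) auto
      also have "\<dots> = c * (B * B2) * r" by simp
      also have "\<dots> \<le> c * (B * B2) * (r + sqrt (r * (weight r * ?H r)) + r * (weight r * ?H r))"
        using c_pos r weight_pos[OF r(1)] B0 B20 by (intro mult_left_mono) auto
      finally show ?thesis .
    qed
    show "weight r * cmod (of_real (mfield R r) * cnj (f r) * f2 r) \<le> c * (B * B2) * (r * (weight r * ?H r))"
      if "R \<le> r" "0 < r" for r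
      using mfield_bounds(4)[OF R that(2,1)] c_pos weight_pos[OF that(2)] that B0 B20 by simp
  qed auto
  thus "(\<integral>r. of_real (mfield R r) * cnj (f r) * g2 r \<partial>\<mu>) = - (\<integral>r. (of_real (mdiv R r) * cnj (f r) + of_real (mfield R r) * cnj (g r)) * f2 r \<partial>\<mu>)"
    using Bochner_Integration.integral_add[OF I1 I2] by (simp add: eq_neg_iff_add_eq_0 add.commute)
qed

end

section \<open>The virial inequality and the variance\<close>

lemma real_derivative_within_bound:
  fixes h h' :: "real \<Rightarrow> real"
  assumes d: "\<And>s. s \<in> {0..<Tc} \<Longrightarrow> (h has_real_derivative h' s) (at s within {0..<Tc})"
    and t: "0 \<le> t" "t < Tc" and b: "\<And>s. s \<in> {0..t} \<Longrightarrow> h' s \<le> K"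
  shows "h t \<le> h 0 + K * t"
proof (cases "t = 0")
  case False
  hence t0: "0 < t" using t by simp
  have "\<exists>x\<in>{0<..<t}. h t - h 0 = h' x * (t - 0)"
  proof (rule mvt_simple[OF t0])
    fix x assume "0 \<le> x" "x \<le> t"
    hence "(h has_real_derivative h' x) (at x within {0..t})"
      using t by (intro has_field_derivative_subset[OF d]) auto
    thus "(h has_derivative (*) (h' x)) (at x within {0..t})" by (simp add: has_field_derivative_def)
  qed
  then obtain x where x: "x \<in> {0<..<t}" "h t - h 0 = h' x * t" by auto
  have "h' x * t \<le> K * t" using b[of x] x t by (intro mult_right_mono) auto
  thus ?thesis using x(2) by linarith
qed simp

lemma norm_integral_le_integral_AE:
  fixes f :: "'a \<Rightarrow> 'b::{banach, second_countable_topology}" and h :: "'a \<Rightarrow> real"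
  assumes "integrable M f" "integrable M h" "AE x in M. norm (f x) \<le> h x"
  shows "norm (\<integral>x. f x \<partial>M) \<le> (\<integral>x. h x \<partial>M)"
  by (rule order_trans[OF integral_norm_bound integral_mono_AE[OF integrable_norm[OF assms(1)] assms(2,3)]])

text \<open>
  The spatial part of the virial identity. Insert $p = i (\Delta f + |f|^{2\sigma} f)$; the
  resulting integrand differs from the asserted one by a combination of the three total
  derivatives \<open>flux_fg\<close>, with the divergence as \<open>A\<close>,
  \<open>flux_gg\<close> and \<open>flux_potential\<close>.
\<close>

lemma (in radial_weight) virial_stationary:
  assumes P: "profile f g q" and p: "sq_int \<mu> p" and s: "0 < \<sigma>" and R: "0 < R"
    and eq: "AE r in \<mu>. \<i> * p r + radial_laplacian g q r + of_real (cmod (f r) powr (2 * \<sigma>)) * f r = 0"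
  defines "S \<equiv> \<lambda>r. of_real (mdiv R r) * cnj (f r) + 2 * of_real (mfield R r) * cnj (g r)"
  shows "Im (\<integral>r. S r * p r \<partial>\<mu>) = - ((\<integral>r. 2 * mfield' R r * (cmod (g r))\<^sup>2 \<partial>\<mu>) + Re (\<integral>r. of_real (mdiv' R r) * (cnj (f r) * g r) \<partial>\<mu>)
        - \<sigma> / (\<sigma> + 1) * (\<integral>r. mdiv R r * cmod (f r) powr (2 * \<sigma> + 2) \<partial>\<mu>))"
    "sq_int \<mu> S" "integrable \<mu> (\<lambda>r. 2 * mfield' R r * (cmod (g r))\<^sup>2)"
proof -
  have f: "sq_int \<mu> f" and g: "sq_int \<mu> g" and l: "sq_int \<mu> (radial_laplacian g q)"
    using P by (auto simp: profile_def)
  have R0: "R \<noteq> 0" using R by simp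
  have bA: "AE r in \<mu>. cmod (of_real (mfield R r)) \<le> R"
    unfolding AE_\<mu> using mfield_bounds[OF R] by auto
  have s2: "sq_int \<mu> (\<lambda>r. of_real (mfield R r) * cnj (g r))" by (rule sq_int_mult_bdd[OF sq_int_cnj[OF g] _ bA]) simp
  show S: "sq_int \<mu> S"
    using sq_int_add[OF flux_difference(2)[OF P P R] s2] by (simp add: S_def algebra_simps)
  have Sp: "integrable \<mu> (\<lambda>r. S r * p r)" by (rule sq_int_integrable_mult[OF S p])
  define K where "K = max (real k + 7) ((6 * real k + 42) / R)"
  have K: "\<bar>mdiv R r\<bar> \<le> K" "\<bar>mdiv' R r\<bar> \<le> K" if "0 < r" for r
    using mdiv_bounds(1)[OF R that] mdiv'_bounds[OF R that] by (auto simp: K_def)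
  define \<Gamma>1 where "\<Gamma>1 r = of_real (mdiv' R r) * (cnj (f r) * g r) + of_real (mdiv R r) * (of_real ((cmod (g r))\<^sup>2) + cnj (f r) * radial_laplacian g q r)" for r
  define \<Gamma>2 where "\<Gamma>2 r = complex_of_real ((2 * mfield' R r - mdiv R r) * (cmod (g r))\<^sup>2) + of_real (mfield R r) * (cnj (radial_laplacian g q r) * g r + cnj (g r) * radial_laplacian g q r)" for r
  define \<Gamma>3 where "\<Gamma>3 r = complex_of_real (mdiv R r * cmod (f r) powr (2 * \<sigma> + 2) + (2 * \<sigma> + 2) * mfield R r * cmod (f r) powr (2 * \<sigma>) * Re (cnj (f r) * g r))" for r
  note F1 = flux_fg[OF P mdiv_deriv[OF R0] continuous_multipliers(4) K]
  have z1: "(\<integral>r. \<Gamma>1 r \<partial>\<mu>) = 0" and i1: "integrable \<mu> \<Gamma>1"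
    unfolding \<Gamma>1_def using F1(1) Bochner_Integration.integrable_add[OF F1(2,3)] by simp_all
  have z2: "(\<integral>r. \<Gamma>2 r \<partial>\<mu>) = 0" and i2: "integrable \<mu> \<Gamma>2"
    unfolding \<Gamma>2_def using flux_gg(1)[OF P R] Bochner_Integration.integrable_add[OF flux_gg(2,3)[OF P R]] by simp_all
  have z3: "(\<integral>r. \<Gamma>3 r \<partial>\<mu>) = 0" and i3: "integrable \<mu> \<Gamma>3"
    unfolding \<Gamma>3_def using flux_potential(1,2)[OF P R s] by simp_all
  have ie': "integrable \<mu> (\<lambda>r. of_real (mdiv' R r) * (cnj (f r) * g r))" by (rule F1(2))
  have ieP: "integrable \<mu> (\<lambda>r. mdiv R r * cmod (f r) powr (2 * \<sigma> + 2))" by (rule flux_potential(3)[OF P R s])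
  show ib': "integrable \<mu> (\<lambda>r. 2 * mfield' R r * (cmod (g r))\<^sup>2)"
  proof (rule Bochner_Integration.integrable_bound)
    note [measurable] = sq_int_measurable[OF g, simplified]
    show "integrable \<mu> (\<lambda>r. 14 * (cmod (g r))\<^sup>2)" using g by (simp add: sq_int_def)
    show "(\<lambda>r. 2 * mfield' R r * (cmod (g r))\<^sup>2) \<in> borel_measurable \<mu>" by simp
    show "AE r in \<mu>. norm (2 * mfield' R r * (cmod (g r))\<^sup>2) \<le> norm (14 * (cmod (g r))\<^sup>2)"
      unfolding AE_\<mu>
    proof (intro AE_I2 impI)
      fix r :: real assume "0 < r"
      hence "2 * \<bar>mfield' R r\<bar> * (cmod (g r))\<^sup>2 \<le> 14 * (cmod (g r))\<^sup>2" using mfield'_bounds(2)[OF R, of r] by (intro mult_right_mono) auto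
      thus "norm (2 * mfield' R r * (cmod (g r))\<^sup>2) \<le> norm (14 * (cmod (g r))\<^sup>2)" by (simp add: abs_mult)
    qed
  qed
  let ?T = "\<lambda>r. 2 * mfield' R r * (cmod (g r))\<^sup>2 + Re (of_real (mdiv' R r) * (cnj (f r) * g r)) - \<sigma> / (\<sigma> + 1) * (mdiv R r * cmod (f r) powr (2 * \<sigma> + 2))"
  have iT: "integrable \<mu> ?T"
    using ib' integrable_Re[OF ie'] ieP by (intro Bochner_Integration.integrable_diff Bochner_Integration.integrable_add integrable_mult_right)
  have ae: "AE r in \<mu>. Im (S r * p r) + ?T r = Re (\<Gamma>1 r) + Re (\<Gamma>2 r) + (1 / (\<sigma> + 1)) * Re (\<Gamma>3 r)"
    using eq
  proof eventually_elim
    case (elim r)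
    define x where "x = cmod (f r) powr (2 * \<sigma>)"
    have pw: "cmod (f r) powr (2 * \<sigma> + 2) = x * (cmod (f r))\<^sup>2" by (simp add: x_def powr_add)
    have "\<i> * (\<i> * p r + radial_laplacian g q r + of_real x * f r) = 0" using elim by (simp add: x_def)
    hence pr: "p r = \<i> * (radial_laplacian g q r + of_real x * f r)" by (simp add: algebra_simps)
    have s1: "\<sigma> / (\<sigma> + 1) = 1 - 1 / (\<sigma> + 1)" using s by (simp add: field_simps)
    have s2: "1 / (\<sigma> + 1) * (A + (2 * \<sigma> + 2) * B) = 1 / (\<sigma> + 1) * A + 2 * B" for A B :: real
      using s by (simp add: field_simps)
    have g3: "Re (\<Gamma>3 r) = mdiv R r * (x * (cmod (f r))\<^sup>2) + (2 * \<sigma> + 2) * (mfield R r * x * Re (cnj (f r) * g r))"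
      by (simp add: \<Gamma>3_def pw x_def)
    show ?case
      unfolding g3 s2 s1 pw S_def \<Gamma>1_def \<Gamma>2_def pr cmod_power2
      by (simp add: algebra_simps power2_eq_square)
  qed
  have "(\<integral>r. Im (S r * p r) + ?T r \<partial>\<mu>) = (\<integral>r. Re (\<Gamma>1 r) + Re (\<Gamma>2 r) + (1 / (\<sigma> + 1)) * Re (\<Gamma>3 r) \<partial>\<mu>)"
    by (rule integral_cong_AE[OF
          borel_measurable_integrable[OF Bochner_Integration.integrable_add[OF integrable_Im[OF Sp] iT]]
          borel_measurable_integrable[OF Bochner_Integration.integrable_add[OF Bochner_Integration.integrable_add[OF
            integrable_Re[OF i1] integrable_Re[OF i2]] integrable_mult_right[OF integrable_Re[OF i3]]]] ae])
  also have "\<dots> = Re (\<integral>r. \<Gamma>1 r \<partial>\<mu>) + Re (\<integral>r. \<Gamma>2 r \<partial>\<mu>) + (1 / (\<sigma> + 1)) * Re (\<integral>r. \<Gamma>3 r \<partial>\<mu>)"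
    using i1 i2 i3 by simp
  also have "\<dots> = 0" by (simp add: z1 z2 z3)
  also have "(\<integral>r. Im (S r * p r) + ?T r \<partial>\<mu>) = Im (\<integral>r. S r * p r \<partial>\<mu>) + (\<integral>r. ?T r \<partial>\<mu>)"
    using Sp iT by (simp only: Bochner_Integration.integral_add integrable_Im integral_Im)
  also have "(\<integral>r. ?T r \<partial>\<mu>) = (\<integral>r. 2 * mfield' R r * (cmod (g r))\<^sup>2 \<partial>\<mu>) + Re (\<integral>r. of_real (mdiv' R r) * (cnj (f r) * g r) \<partial>\<mu>)
        - \<sigma> / (\<sigma> + 1) * (\<integral>r. mdiv R r * cmod (f r) powr (2 * \<sigma> + 2) \<partial>\<mu>)"
    using ib' ie' ieP integrable_Re[OF ie']
    by (simp only: Bochner_Integration.integral_diff Bochner_Integration.integral_add integrable_mult_right integral_mult_right_zero integral_Re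
         Bochner_Integration.integrable_add)
  finally show "Im (\<integral>r. S r * p r \<partial>\<mu>) = - ((\<integral>r. 2 * mfield' R r * (cmod (g r))\<^sup>2 \<partial>\<mu>) + Re (\<integral>r. of_real (mdiv' R r) * (cnj (f r) * g r) \<partial>\<mu>)
        - \<sigma> / (\<sigma> + 1) * (\<integral>r. mdiv R r * cmod (f r) powr (2 * \<sigma> + 2) \<partial>\<mu>))"
    by linarith
qed

text \<open>
  The radial picture of a solution: \<open>f t\<close>, \<open>g t\<close>, \<open>q t\<close> are
  the profile and its radial derivatives, \<open>p t\<close> is the time derivative in the sense
  of $L^2$. The conservation laws enter as upper bounds \<open>N0\<close> and \<open>E0\<close>
  for mass and energy.
\<close>

locale radial_flow = radial_weight c k for c k +
  fixes \<sigma> Tc N0 E0 :: real and f g q p :: "real \<Rightarrow> real \<Rightarrow> complex"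
  assumes sigma_pos: "0 < \<sigma>" and supercritical: "2 \<le> \<sigma> * (real k + 1)" and Tc_pos: "0 < Tc"
    and prof: "\<And>t. t \<in> {0..<Tc} \<Longrightarrow> profile (f t) (g t) (q t)"
    and p_L2: "\<And>t. t \<in> {0..<Tc} \<Longrightarrow> sq_int \<mu> (p t)"
    and eqn: "\<And>t. t \<in> {0..<Tc} \<Longrightarrow> AE r in \<mu>. \<i> * p t r + radial_laplacian (g t) (q t) r + of_real (cmod (f t r) powr (2 * \<sigma>)) * f t r = 0"
    and f_cont: "\<And>t. t \<in> {0..<Tc} \<Longrightarrow> ((\<lambda>s. sq_norm \<mu> (\<lambda>r. f s r - f t r)) \<longlongrightarrow> 0) (at t within {0..<Tc})"
    and p_cont: "\<And>t. t \<in> {0..<Tc} \<Longrightarrow> ((\<lambda>s. sq_norm \<mu> (\<lambda>r. p s r - p t r)) \<longlongrightarrow> 0) (at t within {0..<Tc})"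
    and p_deriv: "\<And>t. t \<in> {0..<Tc} \<Longrightarrow>
       ((\<lambda>s. sq_norm \<mu> (\<lambda>r. (f s r - f t r) / of_real (s - t) - p t r)) \<longlongrightarrow> 0) (at t within {0..<Tc})"
    and bounded_f: "\<And>T. T < Tc \<Longrightarrow> \<exists>B. \<forall>t\<in>{0..T}. \<forall>r>0. cmod (f t r) \<le> B"
    and rf_L2: "\<And>t. t \<in> {0..<Tc} \<Longrightarrow> sq_int \<mu> (\<lambda>r. of_real r * f t r)"
    and rf_cont: "\<And>t. t \<in> {0..<Tc} \<Longrightarrow>
       ((\<lambda>s. sq_norm \<mu> (\<lambda>r. of_real r * f s r - of_real r * f t r)) \<longlongrightarrow> 0) (at t within {0..<Tc})"
    and mass: "\<And>t. t \<in> {0..<Tc} \<Longrightarrow> sq_norm \<mu> (f t) \<le> N0"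
    and energy: "\<And>t. t \<in> {0..<Tc} \<Longrightarrow>
       sq_norm \<mu> (g t) - 1 / (\<sigma> + 1) * (\<integral>r. cmod (f t r) powr (2 * \<sigma> + 2) \<partial>\<mu>) \<le> E0"
begin

abbreviation "I \<equiv> {0..<Tc}"

lemma f_L2: "t \<in> I \<Longrightarrow> sq_int \<mu> (f t)" and g_L2: "t \<in> I \<Longrightarrow> sq_int \<mu> (g t)"
  and l_L2: "t \<in> I \<Longrightarrow> sq_int \<mu> (radial_laplacian (g t) (q t))"
  using prof by (auto simp: profile_def)

lemma eventually_I: "\<forall>\<^sub>F s in at t within I. s \<in> I"
  by (auto simp: eventually_at_filter)

lemma eventually_below:
  assumes "t < T" shows "\<forall>\<^sub>F s in at t within I. s \<in> {0..T}"
proof -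
  have "\<forall>\<^sub>F s in at t within I. s \<in> {..<T}"
    by (rule eventually_at_topological[THEN iffD2]) (use assms in \<open>auto intro!: exI[of _ "{..<T}"]\<close>)
  with eventually_I show ?thesis by eventually_elim auto
qed

lemma f_bound:
  assumes "T < Tc" obtains B where "0 \<le> B" "\<And>t r. t \<in> {0..T} \<Longrightarrow> 0 < r \<Longrightarrow> cmod (f t r) \<le> B"
proof -
  obtain B where B: "\<forall>t\<in>{0..T}. \<forall>r>0. cmod (f t r) \<le> B" using bounded_f[OF assms] by blast
  hence "\<And>t r. t \<in> {0..T} \<Longrightarrow> 0 < r \<Longrightarrow> cmod (f t r) \<le> max 0 B" by fastforce
  thus thesis using that[of "max 0 B"] by simp
qed

lemma lap_bound:
  assumes t: "t \<in> I" and B: "0 \<le> B" "\<And>r. 0 < r \<Longrightarrow> cmod (f t r) \<le> B"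
  shows "sq_norm \<mu> (radial_laplacian (g t) (q t)) \<le> 2 * sq_norm \<mu> (p t) + 2 * ((B powr (2 * \<sigma>))\<^sup>2 * N0)"
proof -
  define Nl where "Nl r = of_real (cmod (f t r) powr (2 * \<sigma>)) * f t r" for r
  have N: "sq_int \<mu> Nl" unfolding Nl_def[abs_def] by (rule sq_int_nonlinearity[OF f_L2[OF t] B(2) sigma_pos])
  have "sq_norm \<mu> (radial_laplacian (g t) (q t)) = sq_norm \<mu> (\<lambda>r. - \<i> * p t r - Nl r)"
    unfolding sq_norm_def
  proof (rule integral_cong_AE)
    show "AE r in \<mu>. (cmod (radial_laplacian (g t) (q t) r))\<^sup>2 = (cmod (- \<i> * p t r - Nl r))\<^sup>2"
      using eqn[OF t]
    proof eventually_elim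
      case (elim r)
      hence "radial_laplacian (g t) (q t) r = - \<i> * p t r - Nl r" by (simp add: Nl_def add_eq_0_iff algebra_simps)
      thus ?case by simp
    qed
  qed (use sq_int_measurable[OF l_L2[OF t]] sq_int_measurable[OF p_L2[OF t]] sq_int_measurable[OF N] in simp_all)
  also have "\<dots> \<le> 2 * sq_norm \<mu> (\<lambda>r. - \<i> * p t r) + 2 * sq_norm \<mu> Nl"
    by (rule sq_norm_diff[OF sq_int_cmult[OF p_L2[OF t]] N])
  also have "sq_norm \<mu> (\<lambda>r. - \<i> * p t r) = sq_norm \<mu> (p t)" by (subst sq_norm_cmult) simp
  also have "sq_norm \<mu> Nl \<le> (B powr (2 * \<sigma>))\<^sup>2 * sq_norm \<mu> (f t)"
  proof (rule sq_norm_bound[OF f_L2[OF t] sq_int_measurable[OF N]])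
    show "AE r in \<mu>. cmod (Nl r) \<le> B powr (2 * \<sigma>) * cmod (f t r)"
      unfolding AE_\<mu> Nl_def norm_mult norm_of_real using B sigma_pos
      by (auto intro!: AE_I2 mult_right_mono powr_mono2)
  qed
  also have "\<dots> \<le> (B powr (2 * \<sigma>))\<^sup>2 * N0" using mass[OF t] by (intro mult_left_mono) auto
  finally show ?thesis by simp
qed

text \<open>
  Interpolate between the continuity of \<open>f\<close> in $L^2$ and the local boundedness of the
  Laplacian in $L^2$. The latter is read off from the equation: both the time derivative and the
  nonlinear term are locally bounded in $L^2$.
\<close>

lemma g_cont:
  assumes t: "t \<in> I"
  shows "((\<lambda>s. sq_norm \<mu> (\<lambda>r. g s r - g t r)) \<longlongrightarrow> 0) (at t within I)"
proof -
  define T where "T = (t + Tc) / 2"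
  have T: "t < T" "T < Tc" using t by (auto simp: T_def)
  obtain B where B: "0 \<le> B" "\<And>t r. t \<in> {0..T} \<Longrightarrow> 0 < r \<Longrightarrow> cmod (f t r) \<le> B" using f_bound[OF T(2)] by blast
  define C where "C = 2 * (2 * (2 * 1 + 2 * sq_norm \<mu> (p t)) + 2 * ((B powr (2 * \<sigma>))\<^sup>2 * N0)) + 2 * sq_norm \<mu> (radial_laplacian (g t) (q t))"
  show ?thesis
  proof (rule Lim_null_comparison)
    show "\<forall>\<^sub>F s in at t within I. norm (sq_norm \<mu> (\<lambda>r. g s r - g t r)) \<le> sqrt (sq_norm \<mu> (\<lambda>r. f s r - f t r)) * sqrt C"
      using eventually_I eventually_below[OF T(1)] order_tendstoD(2)[OF p_cont[OF t], of 1, simplified]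
    proof eventually_elim
      case (elim s)
      have "sq_norm \<mu> (\<lambda>r. g s r - g t r) \<le> sqrt (sq_norm \<mu> (\<lambda>r. f s r - f t r)) * sqrt (sq_norm \<mu> (radial_laplacian (\<lambda>r. g s r - g t r) (\<lambda>r. q s r - q t r)))"
        by (rule gradient_interpolation[OF profile_diff[OF prof[OF elim(1)] prof[OF t]]])
      also have "radial_laplacian (\<lambda>r. g s r - g t r) (\<lambda>r. q s r - q t r) = (\<lambda>r. radial_laplacian (g s) (q s) r - radial_laplacian (g t) (q t) r)"
        by (simp add: radial_laplacian_def fun_eq_iff algebra_simps diff_divide_distrib)
      also have "sqrt (sq_norm \<mu> (\<lambda>r. f s r - f t r)) * sqrt (sq_norm \<mu> (\<lambda>r. radial_laplacian (g s) (q s) r - radial_laplacian (g t) (q t) r)) \<le> sqrt (sq_norm \<mu> (\<lambda>r. f s r - f t r)) * sqrt C"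
      proof (intro mult_left_mono real_sqrt_le_mono)
        have "sq_norm \<mu> (p s) \<le> 2 * 1 + 2 * sq_norm \<mu> (p t)"
          using sq_norm_add[OF sq_int_diff[OF p_L2[OF elim(1)] p_L2[OF t]] p_L2[OF t]] elim(3) by simp
        moreover have "sq_norm \<mu> (radial_laplacian (g s) (q s)) \<le> 2 * sq_norm \<mu> (p s) + 2 * ((B powr (2 * \<sigma>))\<^sup>2 * N0)"
          by (rule lap_bound[OF elim(1) B(1) B(2)[OF elim(2)]])
        moreover have "sq_norm \<mu> (\<lambda>r. radial_laplacian (g s) (q s) r - radial_laplacian (g t) (q t) r) \<le> 2 * sq_norm \<mu> (radial_laplacian (g s) (q s)) + 2 * sq_norm \<mu> (radial_laplacian (g t) (q t))"
          by (rule sq_norm_diff[OF l_L2[OF elim(1)] l_L2[OF t]])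
        ultimately show "sq_norm \<mu> (\<lambda>r. radial_laplacian (g s) (q s) r - radial_laplacian (g t) (q t) r) \<le> C" unfolding C_def by argo
      qed simp
      finally show ?case by simp
    qed
    have "((\<lambda>s. sqrt (sq_norm \<mu> (\<lambda>r. f s r - f t r)) * sqrt C) \<longlongrightarrow> sqrt 0 * sqrt C) (at t within I)"
      by (intro tendsto_intros f_cont t)
    thus "((\<lambda>s. sqrt (sq_norm \<mu> (\<lambda>r. f s r - f t r)) * sqrt C) \<longlongrightarrow> 0) (at t within I)" by simp
  qed
qed

definition momentum :: "real \<Rightarrow> real \<Rightarrow> real" where
  "momentum R t = Im (\<integral>r. of_real (mfield R r) * cnj (f t r) * g t r \<partial>\<mu>)"

definition variance :: "real \<Rightarrow> real \<Rightarrow> real" where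
  "variance R t = (\<integral>r. mweight R r * (cmod (f t r))\<^sup>2 \<partial>\<mu>)"

abbreviation \<delta> :: "real \<Rightarrow> real \<Rightarrow> real \<Rightarrow> complex" where
  "\<delta> t s \<equiv> \<lambda>r. (f s r - f t r) / of_real (s - t)"

lemma \<delta>_L2: assumes "t \<in> I" shows "\<forall>\<^sub>F s in at t within I. sq_int \<mu> (\<delta> t s)"
  using eventually_I
proof eventually_elim
  case (elim s)
  show ?case using sq_int_cmult[OF sq_int_diff[OF f_L2[OF elim] f_L2[OF assms]], of "1 / of_real (s - t)"] by simp
qed

text \<open>
  In the increment of $\int X \bar f g$ the difference $g_s - g_t$ is first converted by
  \<open>flux_difference\<close> into $f_s - f_t$. Then every term contains the difference
  quotient of \<open>f\<close>, which converges to \<open>p\<close> in $L^2$.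
\<close>

lemma momentum_deriv:
  assumes t: "t \<in> I" and R: "0 < R"
  shows "(momentum R has_real_derivative - Im (\<integral>r. (of_real (mdiv R r) * cnj (f t r) + 2 * of_real (mfield R r) * cnj (g t r)) * p t r \<partial>\<mu>)) (at t within I)"
proof -
  define Sf where "Sf r = of_real (mdiv R r) * cnj (f t r) + of_real (mfield R r) * cnj (g t r)" for r
  have S: "sq_int \<mu> Sf" unfolding Sf_def[abs_def] by (rule flux_difference(2)[OF prof[OF t] prof[OF t] R])
  have bA: "AE r in \<mu>. cmod (of_real (mfield R r)) \<le> R"
    unfolding AE_\<mu> using mfield_bounds[OF R] by auto
  have bm: "(\<lambda>r. complex_of_real (mfield R r)) \<in> borel_measurable \<mu>" by simp
  have dl: "((\<lambda>s. sq_norm \<mu> (\<lambda>r. cnj (\<delta> t s r) - cnj (p t r))) \<longlongrightarrow> 0) (at t within I)"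
    using p_deriv[OF t] by (simp only: sq_norm_def complex_cnj_diff[symmetric] complex_mod_cnj)
  have L1: "((\<lambda>s. \<integral>r. of_real (mfield R r) * cnj (\<delta> t s r) * g s r \<partial>\<mu>) \<longlongrightarrow> (\<integral>r. of_real (mfield R r) * cnj (p t r) * g t r \<partial>\<mu>)) (at t within I)"
  proof (rule L2_tendsto_mult[OF _ _ sq_int_cnj[OF p_L2[OF t]] g_L2[OF t] dl g_cont[OF t] bm bA])
    show "\<forall>\<^sub>F s in at t within I. sq_int \<mu> (\<lambda>r. cnj (\<delta> t s r))"
      using \<delta>_L2[OF t] by eventually_elim (rule sq_int_cnj)
    show "\<forall>\<^sub>F s in at t within I. sq_int \<mu> (g s)" using eventually_I by eventually_elim (rule g_L2)
  qed
  have L2: "((\<lambda>s. \<integral>r. 1 * Sf r * \<delta> t s r \<partial>\<mu>) \<longlongrightarrow> (\<integral>r. 1 * Sf r * p t r \<partial>\<mu>)) (at t within I)"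
    by (rule L2_tendsto_mult[OF _ \<delta>_L2[OF t] S p_L2[OF t] _ p_deriv[OF t], where C=1]) (simp_all add: S sq_norm_def)
  have lim: "((\<lambda>s. Im ((\<integral>r. of_real (mfield R r) * cnj (\<delta> t s r) * g s r \<partial>\<mu>) - (\<integral>r. 1 * Sf r * \<delta> t s r \<partial>\<mu>))) \<longlongrightarrow>
      Im ((\<integral>r. of_real (mfield R r) * cnj (p t r) * g t r \<partial>\<mu>) - (\<integral>r. 1 * Sf r * p t r \<partial>\<mu>))) (at t within I)"
    by (intro tendsto_intros L1 L2)
  have X: "Im ((\<integral>r. of_real (mfield R r) * cnj (p t r) * g t r \<partial>\<mu>) - (\<integral>r. 1 * Sf r * p t r \<partial>\<mu>))
     = - Im (\<integral>r. (of_real (mdiv R r) * cnj (f t r) + 2 * of_real (mfield R r) * cnj (g t r)) * p t r \<partial>\<mu>)"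
  proof -
    have ib: "integrable \<mu> (\<lambda>r. of_real (mfield R r) * cnj (g t r) * p t r)"
      by (rule sq_int_integrable_mult3[OF sq_int_cnj[OF g_L2[OF t]] p_L2[OF t] bm bA])
    have "(\<integral>r. of_real (mfield R r) * cnj (p t r) * g t r \<partial>\<mu>) = (\<integral>r. cnj (of_real (mfield R r) * cnj (g t r) * p t r) \<partial>\<mu>)"
      by (rule Bochner_Integration.integral_cong) auto
    also have "\<dots> = cnj (\<integral>r. of_real (mfield R r) * cnj (g t r) * p t r \<partial>\<mu>)"
      by (rule Bochner_Integration.integral_cnj)
    finally have 1: "Im (\<integral>r. of_real (mfield R r) * cnj (p t r) * g t r \<partial>\<mu>) = - Im (\<integral>r. of_real (mfield R r) * cnj (g t r) * p t r \<partial>\<mu>)" by simp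
    have "(\<integral>r. (of_real (mdiv R r) * cnj (f t r) + 2 * of_real (mfield R r) * cnj (g t r)) * p t r \<partial>\<mu>)
       = (\<integral>r. Sf r * p t r + of_real (mfield R r) * cnj (g t r) * p t r \<partial>\<mu>)"
      by (rule Bochner_Integration.integral_cong) (auto simp: Sf_def algebra_simps)
    also have "\<dots> = (\<integral>r. Sf r * p t r \<partial>\<mu>) + (\<integral>r. of_real (mfield R r) * cnj (g t r) * p t r \<partial>\<mu>)"
      by (rule Bochner_Integration.integral_add[OF sq_int_integrable_mult[OF S p_L2[OF t]] ib])
    finally show ?thesis using 1 by simp
  qed
  have ev: "\<forall>\<^sub>F s in at t within I. Im ((\<integral>r. of_real (mfield R r) * cnj (\<delta> t s r) * g s r \<partial>\<mu>) - (\<integral>r. 1 * Sf r * \<delta> t s r \<partial>\<mu>))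
       = (momentum R s - momentum R t) / (s - t)"
    using eventually_I \<delta>_L2[OF t] eventually_neq_at_within[of t t I]
  proof eventually_elim
    case (elim s)
    have st: "s - t \<noteq> 0" using elim by simp
    have i1: "integrable \<mu> (\<lambda>r. of_real (mfield R r) * cnj (f s r) * g s r)"
      by (rule sq_int_integrable_mult3[OF sq_int_cnj[OF f_L2[OF elim(1)]] g_L2[OF elim(1)] bm bA])
    have i2: "integrable \<mu> (\<lambda>r. of_real (mfield R r) * cnj (f t r) * g t r)"
      by (rule sq_int_integrable_mult3[OF sq_int_cnj[OF f_L2[OF t]] g_L2[OF t] bm bA])
    have i3: "integrable \<mu> (\<lambda>r. of_real (mfield R r) * cnj (f t r) * (g s r - g t r))"
      by (rule sq_int_integrable_mult3[OF sq_int_cnj[OF f_L2[OF t]] sq_int_diff[OF g_L2[OF elim(1)] g_L2[OF t]] bm bA])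
    have i4: "integrable \<mu> (\<lambda>r. of_real (mfield R r) * cnj (\<delta> t s r) * g s r)"
      by (rule sq_int_integrable_mult3[OF sq_int_cnj[OF elim(2)] g_L2[OF elim(1)] bm bA])
    have fd: "(\<integral>r. of_real (mfield R r) * cnj (f t r) * (g s r - g t r) \<partial>\<mu>) = - (\<integral>r. Sf r * (f s r - f t r) \<partial>\<mu>)"
      unfolding Sf_def by (rule flux_difference(1)[OF prof[OF t] profile_diff[OF prof[OF elim(1)] prof[OF t]] R])
    have "(\<integral>r. of_real (mfield R r) * cnj (f s r) * g s r \<partial>\<mu>) - (\<integral>r. of_real (mfield R r) * cnj (f t r) * g t r \<partial>\<mu>)
      = (\<integral>r. of_real (mfield R r) * cnj (f s r) * g s r - of_real (mfield R r) * cnj (f t r) * g t r \<partial>\<mu>)"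
      by (rule Bochner_Integration.integral_diff[OF i1 i2, symmetric])
    also have "\<dots> = (\<integral>r. of_real (s - t) * (of_real (mfield R r) * cnj (\<delta> t s r) * g s r) + of_real (mfield R r) * cnj (f t r) * (g s r - g t r) \<partial>\<mu>)"
      by (rule Bochner_Integration.integral_cong) (use st in \<open>auto simp: field_simps\<close>)
    also have "\<dots> = of_real (s - t) * (\<integral>r. of_real (mfield R r) * cnj (\<delta> t s r) * g s r \<partial>\<mu>) + (\<integral>r. of_real (mfield R r) * cnj (f t r) * (g s r - g t r) \<partial>\<mu>)"
      using i3 i4 by (simp only: Bochner_Integration.integral_add integrable_mult_right integral_mult_right_zero)
    also have "(\<integral>r. of_real (mfield R r) * cnj (f t r) * (g s r - g t r) \<partial>\<mu>) = - (\<integral>r. of_real (s - t) * (1 * Sf r * \<delta> t s r) \<partial>\<mu>)"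
      unfolding fd by (subst Bochner_Integration.integral_cong[OF refl]) (use st in auto)
    also have "\<dots> = - (of_real (s - t) * (\<integral>r. 1 * Sf r * \<delta> t s r \<partial>\<mu>))" by (simp only: integral_mult_right_zero)
    finally have "(\<integral>r. of_real (mfield R r) * cnj (f s r) * g s r \<partial>\<mu>) - (\<integral>r. of_real (mfield R r) * cnj (f t r) * g t r \<partial>\<mu>)
      = of_real (s - t) * ((\<integral>r. of_real (mfield R r) * cnj (\<delta> t s r) * g s r \<partial>\<mu>) - (\<integral>r. 1 * Sf r * \<delta> t s r \<partial>\<mu>))"
      by (simp only: right_diff_distrib add_uminus_conv_diff)
    from arg_cong[OF this, of Im]
    have "momentum R s - momentum R t = (s - t) * Im ((\<integral>r. of_real (mfield R r) * cnj (\<delta> t s r) * g s r \<partial>\<mu>) - (\<integral>r. 1 * Sf r * \<delta> t s r \<partial>\<mu>))"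
      unfolding momentum_def by simp
    thus ?case using st by simp
  qed
  show ?thesis
    using Lim_transform_eventually[OF lim ev] unfolding X has_field_derivative_iff .
qed

text \<open>
  The derivative of $\int a |f|^2$ is $2 \mathrm{Re} \int a \bar f p$, and \<open>flux_fg\<close>
  with $A = a$, $a' = 2 X$ turns it into $4 M$.
\<close>

lemma variance_deriv:
  assumes t: "t \<in> I" and R: "0 < R"
  shows "(variance R has_real_derivative 4 * momentum R t) (at t within I)"
proof -
  have R0: "R \<noteq> 0" using R by simp
  have aA: "AE r in \<mu>. cmod (of_real (mweight R r)) \<le> R\<^sup>2 / 4"
    unfolding AE_\<mu> using mweight_bounds[OF R] by (auto intro!: AE_I2)
  have am: "(\<lambda>r. complex_of_real (mweight R r)) \<in> borel_measurable \<mu>" by simp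
  have dl: "((\<lambda>s. sq_norm \<mu> (\<lambda>r. cnj (\<delta> t s r) - cnj (p t r))) \<longlongrightarrow> 0) (at t within I)"
    using p_deriv[OF t] by (simp only: sq_norm_def complex_cnj_diff[symmetric] complex_mod_cnj)
  have fl: "((\<lambda>s. sq_norm \<mu> (\<lambda>r. (f s r + f t r) - (f t r + f t r))) \<longlongrightarrow> 0) (at t within I)"
    using f_cont[OF t] by simp
  have L1: "((\<lambda>s. \<integral>r. of_real (mweight R r) * cnj (\<delta> t s r) * (f s r + f t r) \<partial>\<mu>) \<longlongrightarrow> (\<integral>r. of_real (mweight R r) * cnj (p t r) * (f t r + f t r) \<partial>\<mu>)) (at t within I)"
  proof (rule L2_tendsto_mult[OF _ _ sq_int_cnj[OF p_L2[OF t]] sq_int_add[OF f_L2[OF t] f_L2[OF t]] dl fl am aA])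
    show "\<forall>\<^sub>F s in at t within I. sq_int \<mu> (\<lambda>r. cnj (\<delta> t s r))"
      using \<delta>_L2[OF t] by eventually_elim (rule sq_int_cnj)
    show "\<forall>\<^sub>F s in at t within I. sq_int \<mu> (\<lambda>r. f s r + f t r)" using eventually_I by eventually_elim (intro sq_int_add f_L2 t)
  qed
  have lim: "((\<lambda>s. Re (\<integral>r. of_real (mweight R r) * cnj (\<delta> t s r) * (f s r + f t r) \<partial>\<mu>)) \<longlongrightarrow> Re (\<integral>r. of_real (mweight R r) * cnj (p t r) * (f t r + f t r) \<partial>\<mu>)) (at t within I)"
    by (intro tendsto_intros L1)
  have X: "Re (\<integral>r. of_real (mweight R r) * cnj (p t r) * (f t r + f t r) \<partial>\<mu>) = 4 * momentum R t"
  proof -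
    have K: "\<bar>mweight R r\<bar> \<le> max (R\<^sup>2 / 4) (2 * R)" "\<bar>2 * mfield R r\<bar> \<le> max (R\<^sup>2 / 4) (2 * R)" if "0 < r" for r
      using mweight_bounds[OF R, of r] mfield_bounds[OF R that] by auto
    have c2: "continuous_on UNIV (\<lambda>r. 2 * mfield R r)" by (intro continuous_intros continuous_multipliers)
    note F = flux_fg[OF prof[OF t] mweight_deriv[OF R0] c2 K]
    have i1: "integrable \<mu> (\<lambda>r. of_real (mweight R r) * cnj (p t r) * (f t r + f t r))"
      by (rule sq_int_integrable_mult3[OF sq_int_cnj[OF p_L2[OF t]] sq_int_add[OF f_L2[OF t] f_L2[OF t]] am aA])
    have bA: "AE r in \<mu>. cmod (of_real (mfield R r)) \<le> R"
      unfolding AE_\<mu> using mfield_bounds[OF R] by auto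
    have i2: "integrable \<mu> (\<lambda>r. of_real (mfield R r) * cnj (f t r) * g t r)"
      by (rule sq_int_integrable_mult3[OF sq_int_cnj[OF f_L2[OF t]] g_L2[OF t] _ bA]) simp
    define \<Gamma> where "\<Gamma> r = of_real (2 * mfield R r) * (cnj (f t r) * g t r) + of_real (mweight R r) * (of_real ((cmod (g t r))\<^sup>2) + cnj (f t r) * radial_laplacian (g t) (q t) r)" for r
    have \<Gamma>: "integrable \<mu> \<Gamma>" "(\<integral>r. \<Gamma> r \<partial>\<mu>) = 0"
      unfolding \<Gamma>_def using Bochner_Integration.integrable_add[OF F(2,3)] F(1) by simp_all
    have ae: "AE r in \<mu>. Re (of_real (mweight R r) * cnj (p t r) * (f t r + f t r)) = 4 * Im (of_real (mfield R r) * cnj (f t r) * g t r) - 2 * Im (\<Gamma> r)"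
      using eqn[OF t]
    proof eventually_elim
      case (elim r)
      define x where "x = cmod (f t r) powr (2 * \<sigma>)"
      have l: "radial_laplacian (g t) (q t) r = - \<i> * p t r - of_real x * f t r" using elim by (simp add: x_def add_eq_0_iff algebra_simps)
      show ?case unfolding \<Gamma>_def l by (simp add: algebra_simps)
    qed
    have "Re (\<integral>r. of_real (mweight R r) * cnj (p t r) * (f t r + f t r) \<partial>\<mu>) = (\<integral>r. Re (of_real (mweight R r) * cnj (p t r) * (f t r + f t r)) \<partial>\<mu>)"
      using i1 by (simp only: integral_Re)
    also have "\<dots> = (\<integral>r. 4 * Im (of_real (mfield R r) * cnj (f t r) * g t r) - 2 * Im (\<Gamma> r) \<partial>\<mu>)"
      by (rule integral_cong_AE[OF borel_measurable_integrable[OF integrable_Re[OF i1]]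
            borel_measurable_integrable[OF Bochner_Integration.integrable_diff[OF
              integrable_mult_right[OF integrable_Im[OF i2]] integrable_mult_right[OF integrable_Im[OF \<Gamma>(1)]]]] ae])
    also have "\<dots> = 4 * momentum R t - 2 * Im (\<integral>r. \<Gamma> r \<partial>\<mu>)"
      unfolding momentum_def using integrable_Im[OF i2] integrable_Im[OF \<Gamma>(1)] i2 \<Gamma>(1)
      by (simp only: Bochner_Integration.integral_diff integrable_mult_right integral_mult_right_zero integral_Im)
    finally show ?thesis using \<Gamma>(2) by simp
  qed
  have ev: "\<forall>\<^sub>F s in at t within I. Re (\<integral>r. of_real (mweight R r) * cnj (\<delta> t s r) * (f s r + f t r) \<partial>\<mu>) = (variance R s - variance R t) / (s - t)"
    using eventually_I \<delta>_L2[OF t] eventually_neq_at_within[of t t I]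
  proof eventually_elim
    case (elim s)
    have st: "s - t \<noteq> 0" using elim by simp
    have i: "integrable \<mu> (\<lambda>r. mweight R r * (cmod (f u r))\<^sup>2)" if u: "u \<in> I" for u
    proof -
      have "integrable \<mu> (\<lambda>r. of_real (mweight R r) * cnj (f u r) * f u r)"
        by (rule sq_int_integrable_mult3[OF sq_int_cnj[OF f_L2[OF u]] f_L2[OF u] am aA])
      from integrable_Re[OF this] show ?thesis
        unfolding cmod_power2 by (simp add: algebra_simps power2_eq_square)
    qed
    have i4: "integrable \<mu> (\<lambda>r. of_real (mweight R r) * cnj (\<delta> t s r) * (f s r + f t r))"
      by (rule sq_int_integrable_mult3[OF sq_int_cnj[OF elim(2)] sq_int_add[OF f_L2[OF elim(1)] f_L2[OF t]] am aA])
    have "variance R s - variance R t = (\<integral>r. mweight R r * (cmod (f s r))\<^sup>2 - mweight R r * (cmod (f t r))\<^sup>2 \<partial>\<mu>)"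
      unfolding variance_def by (rule Bochner_Integration.integral_diff[OF i[OF elim(1)] i[OF t], symmetric])
    also have "\<dots> = (\<integral>r. (s - t) * Re (of_real (mweight R r) * cnj (\<delta> t s r) * (f s r + f t r)) \<partial>\<mu>)"
    proof (rule Bochner_Integration.integral_cong[OF refl])
      fix r
      have "(s - t) * Re (of_real (mweight R r) * cnj (\<delta> t s r) * (f s r + f t r)) = Re (of_real (s - t) * (of_real (mweight R r) * cnj (\<delta> t s r) * (f s r + f t r)))"
        by (simp only: Re_complex_of_real Im_complex_of_real times_complex.sel mult_zero_left diff_zero)
      also have "of_real (s - t) * (of_real (mweight R r) * cnj (\<delta> t s r) * (f s r + f t r)) = of_real (mweight R r) * cnj (f s r - f t r) * (f s r + f t r)"
        using st by (simp add: field_simps)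
      also have "Re \<dots> = mweight R r * (cmod (f s r))\<^sup>2 - mweight R r * (cmod (f t r))\<^sup>2"
        unfolding cmod_power2 by (simp add: algebra_simps power2_eq_square)
      finally show "mweight R r * (cmod (f s r))\<^sup>2 - mweight R r * (cmod (f t r))\<^sup>2 = (s - t) * Re (of_real (mweight R r) * cnj (\<delta> t s r) * (f s r + f t r))" by simp
    qed
    also have "\<dots> = (s - t) * Re (\<integral>r. of_real (mweight R r) * cnj (\<delta> t s r) * (f s r + f t r) \<partial>\<mu>)"
      using i4 by (simp only: integral_mult_right_zero integral_Re)
    finally show ?case using st by simp
  qed
  show ?thesis
    using Lim_transform_eventually[OF lim ev] unfolding X has_field_derivative_iff .
qed

lemma potential_bounds:
  assumes t: "t \<in> I" and B: "\<And>r. 0 < r \<Longrightarrow> cmod (f t r) \<le> B"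
  shows "integrable \<mu> (\<lambda>r. cmod (f t r) powr (2 * \<sigma> + 2))"
    "(\<integral>r. cmod (f t r) powr (2 * \<sigma> + 2) \<partial>\<mu>) \<le> B powr (2 * \<sigma>) * N0"
    "integrable \<mu> (\<lambda>r. r\<^sup>2 * cmod (f t r) powr (2 * \<sigma> + 2))"
    "(\<integral>r. r\<^sup>2 * cmod (f t r) powr (2 * \<sigma> + 2) \<partial>\<mu>) \<le> B powr (2 * \<sigma>) * sq_norm \<mu> (\<lambda>r. of_real r * f t r)"
proof -
  note [measurable] = sq_int_measurable[OF f_L2[OF t], simplified]
  have n: "(cmod (of_real r * f t r))\<^sup>2 = r\<^sup>2 * (cmod (f t r))\<^sup>2" for r
    by (simp add: norm_mult power_mult_distrib)
  have i2: "integrable \<mu> (\<lambda>r. r\<^sup>2 * (cmod (f t r))\<^sup>2)"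
    using rf_L2[OF t] unfolding sq_int_def n by simp
  show i: "integrable \<mu> (\<lambda>r. cmod (f t r) powr (2 * \<sigma> + 2))"
    by (rule integrable_potential[OF f_L2[OF t] B sigma_pos])
  have ae: "AE r in \<mu>. cmod (f t r) powr (2 * \<sigma> + 2) \<le> B powr (2 * \<sigma>) * (cmod (f t r))\<^sup>2"
    unfolding AE_\<mu> using powr_sq_bound[OF sigma_pos norm_ge_zero B] by auto
  have ae2: "AE r in \<mu>. r\<^sup>2 * cmod (f t r) powr (2 * \<sigma> + 2) \<le> B powr (2 * \<sigma>) * (r\<^sup>2 * (cmod (f t r))\<^sup>2)"
    using ae
  proof eventually_elim
    case (elim r)
    from mult_left_mono[OF this, of "r\<^sup>2"] show ?case by (simp add: mult_ac)
  qed
  have "(\<integral>r. cmod (f t r) powr (2 * \<sigma> + 2) \<partial>\<mu>) \<le> (\<integral>r. B powr (2 * \<sigma>) * (cmod (f t r))\<^sup>2 \<partial>\<mu>)"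
    by (rule integral_mono_AE[OF i _ ae]) (use f_L2[OF t] in \<open>simp add: sq_int_def\<close>)
  also have "\<dots> = B powr (2 * \<sigma>) * sq_norm \<mu> (f t)" by (simp add: sq_norm_def)
  also have "\<dots> \<le> B powr (2 * \<sigma>) * N0" using mass[OF t] by (intro mult_left_mono) auto
  finally show "(\<integral>r. cmod (f t r) powr (2 * \<sigma> + 2) \<partial>\<mu>) \<le> B powr (2 * \<sigma>) * N0" .
  show ir: "integrable \<mu> (\<lambda>r. r\<^sup>2 * cmod (f t r) powr (2 * \<sigma> + 2))"
  proof (rule Bochner_Integration.integrable_bound)
    show "integrable \<mu> (\<lambda>r. B powr (2 * \<sigma>) * (r\<^sup>2 * (cmod (f t r))\<^sup>2))" using i2 by simp
    show "(\<lambda>r. r\<^sup>2 * cmod (f t r) powr (2 * \<sigma> + 2)) \<in> borel_measurable \<mu>" by simp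
    show "AE r in \<mu>. norm (r\<^sup>2 * cmod (f t r) powr (2 * \<sigma> + 2)) \<le> norm (B powr (2 * \<sigma>) * (r\<^sup>2 * (cmod (f t r))\<^sup>2))"
      using ae2 by eventually_elim simp
  qed
  have "(\<integral>r. r\<^sup>2 * cmod (f t r) powr (2 * \<sigma> + 2) \<partial>\<mu>) \<le> (\<integral>r. B powr (2 * \<sigma>) * (r\<^sup>2 * (cmod (f t r))\<^sup>2) \<partial>\<mu>)"
    by (rule integral_mono_AE[OF ir _ ae2]) (use i2 in simp)
  also have "\<dots> = B powr (2 * \<sigma>) * sq_norm \<mu> (\<lambda>r. of_real r * f t r)" by (simp add: sq_norm_def n)
  finally show "(\<integral>r. r\<^sup>2 * cmod (f t r) powr (2 * \<sigma> + 2) \<partial>\<mu>) \<le> B powr (2 * \<sigma>) * sq_norm \<mu> (\<lambda>r. of_real r * f t r)" .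
qed

lemma variance_locally_bounded:
  assumes "T < Tc" shows "\<exists>W. \<forall>t\<in>{0..T}. sq_norm \<mu> (\<lambda>r. of_real r * f t r) \<le> W"
proof -
  have "continuous_on {0..T} (\<lambda>t. sq_norm \<mu> (\<lambda>r. of_real r * f t r))"
    unfolding continuous_on_def
  proof
    fix t assume "t \<in> {0..T}"
    hence t: "t \<in> I" using assms by auto
    have gg: "complex_of_real (sq_norm \<mu> h) = (\<integral>r. 1 * cnj (h r) * h r \<partial>\<mu>)" for h
      unfolding sq_norm_def integral_complex_of_real[symmetric]
      by (rule Bochner_Integration.integral_cong) (auto simp: complex_norm_square[symmetric] mult.commute)
    have ev: "\<forall>\<^sub>F s in at t within I. sq_int \<mu> (\<lambda>r. of_real r * f s r)"
      using eventually_I by eventually_elim (rule rf_L2)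
    have "((\<lambda>s. \<integral>r. 1 * cnj (of_real r * f s r) * (of_real r * f s r) \<partial>\<mu>) \<longlongrightarrow> (\<integral>r. 1 * cnj (of_real r * f t r) * (of_real r * f t r) \<partial>\<mu>)) (at t within I)"
    proof (rule L2_tendsto_mult[OF _ ev sq_int_cnj[OF rf_L2[OF t]] rf_L2[OF t] _ rf_cont[OF t], where C=1])
      show "\<forall>\<^sub>F s in at t within I. sq_int \<mu> (\<lambda>r. cnj (of_real r * f s r))"
        using ev by eventually_elim (rule sq_int_cnj)
      show "((\<lambda>s. sq_norm \<mu> (\<lambda>r. cnj (of_real r * f s r) - cnj (of_real r * f t r))) \<longlongrightarrow> 0) (at t within I)"
        using rf_cont[OF t] by (simp only: sq_norm_def complex_cnj_diff[symmetric] complex_mod_cnj)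
    qed simp_all
    hence "((\<lambda>s. sq_norm \<mu> (\<lambda>r. of_real r * f s r)) \<longlongrightarrow> sq_norm \<mu> (\<lambda>r. of_real r * f t r)) (at t within I)"
      unfolding gg[symmetric] tendsto_of_real_iff .
    thus "((\<lambda>s. sq_norm \<mu> (\<lambda>r. of_real r * f s r)) \<longlongrightarrow> sq_norm \<mu> (\<lambda>r. of_real r * f t r)) (at t within {0..T})"
      by (rule tendsto_within_subset) (use assms in auto)
  qed
  hence "bounded ((\<lambda>t. sq_norm \<mu> (\<lambda>r. of_real r * f t r)) ` {0..T})"
    by (intro compact_imp_bounded compact_continuous_image) auto
  then obtain W where "\<forall>x\<in>(\<lambda>t. sq_norm \<mu> (\<lambda>r. of_real r * f t r)) ` {0..T}. norm x \<le> W"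
    unfolding bounded_iff by blast
  thus ?thesis by (intro exI[of _ W]) (auto dest!: bspec)
qed

text \<open>
  In \<open>virial_stationary\<close> replace $X'$ by its upper bound 1 and the divergence by its
  lower bound $d - C r^2/R^2$. What remains is $2 \|g\|^2 - \frac{\sigma d}{\sigma+1} \int
  |f|^{2\sigma+2} \le 2 E_0$ by the energy bound and $\sigma d \ge 2$, up to errors $C/R$; here
  $\int r^2 |f|^{2\sigma+2}$ is controlled by the sup bound and the variance on $[0,T]$. The
  constant depends on \<open>T\<close>, the main term does not.
\<close>

lemma virial_inequality:
  assumes T: "T < Tc"
  shows "\<exists>C\<ge>0. \<forall>t\<in>{0..T}. \<forall>R\<ge>1. - Im (\<integral>r. (of_real (mdiv R r) * cnj (f t r) + 2 * of_real (mfield R r) * cnj (g t r)) * p t r \<partial>\<mu>) \<le> 2 * E0 + C / R"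
proof -
  obtain B where B: "0 \<le> B" "\<And>t r. t \<in> {0..T} \<Longrightarrow> 0 < r \<Longrightarrow> cmod (f t r) \<le> B" using f_bound[OF T] by blast
  obtain W0 where W0: "\<forall>t\<in>{0..T}. sq_norm \<mu> (\<lambda>r. of_real r * f t r) \<le> W0" using variance_locally_bounded[OF T] by blast
  define W where "W = max 0 W0"
  have W: "0 \<le> W" "\<And>t. t \<in> {0..T} \<Longrightarrow> sq_norm \<mu> (\<lambda>r. of_real r * f t r) \<le> W" using W0 by (force simp: W_def)+
  have N0: "0 \<le> N0" using mass[of 0] sq_norm_nonneg[of \<mu> "f 0"] Tc_pos by (meson atLeastLessThan_iff order_refl order_trans)
  define Bp where "Bp = B powr (2 * \<sigma>)"
  have Bp: "0 \<le> Bp" by (simp add: Bp_def)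
  define G where "G = max 0 E0 + Bp * N0 / (\<sigma> + 1)"
  have G0: "0 \<le> G" using Bp N0 sigma_pos by (simp add: G_def)
  define C1 where "C1 = (6 * real k + 42) * (N0 + G)"
  define C2 where "C2 = (3 * (real k + 1) + 6) * (Bp * W)"
  define s where "s = \<sigma> / (\<sigma> + 1)"
  have s: "0 \<le> s" using sigma_pos by (simp add: s_def)
  have C0: "0 \<le> C1" "0 \<le> C2" using N0 G0 Bp W by (simp_all add: C1_def C2_def)
  show ?thesis
  proof (intro exI[of _ "C1 + s * C2"] conjI ballI allI impI)
    show "0 \<le> C1 + s * C2" using C0 s by simp
    fix t R :: real assume t: "t \<in> {0..T}" and R1: "1 \<le> R"
    have tI: "t \<in> I" using t T by auto
    have R: "0 < R" using R1 by simp
    let ?P = "\<integral>r. cmod (f t r) powr (2 * \<sigma> + 2) \<partial>\<mu>"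
    note pb = potential_bounds[OF tI B(2)[OF t]]
    have f: "sq_int \<mu> (f t)" and g: "sq_int \<mu> (g t)" using f_L2[OF tI] g_L2[OF tI] by auto
    note vs = virial_stationary[OF prof[OF tI] p_L2[OF tI] sigma_pos R eqn[OF tI]]
    have P0: "0 \<le> ?P" by (intro Bochner_Integration.integral_nonneg) simp
    have ng: "sq_norm \<mu> (g t) \<le> E0 + ?P / (\<sigma> + 1)" using energy[OF tI] by simp
    have "?P / (\<sigma> + 1) \<le> Bp * N0 / (\<sigma> + 1)" using pb(2) sigma_pos by (intro divide_right_mono) (simp_all add: Bp_def)
    hence nG: "sq_norm \<mu> (g t) \<le> G" using ng unfolding G_def by linarith
    have A1: "(\<integral>r. 2 * mfield' R r * (cmod (g t r))\<^sup>2 \<partial>\<mu>) \<le> 2 * sq_norm \<mu> (g t)"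
    proof -
      have "(\<integral>r. 2 * mfield' R r * (cmod (g t r))\<^sup>2 \<partial>\<mu>) \<le> (\<integral>r. 2 * (cmod (g t r))\<^sup>2 \<partial>\<mu>)"
      proof (rule integral_mono_AE[OF vs(3)])
        show "integrable \<mu> (\<lambda>r. 2 * (cmod (g t r))\<^sup>2)" using g by (simp add: sq_int_def)
        show "AE r in \<mu>. 2 * mfield' R r * (cmod (g t r))\<^sup>2 \<le> 2 * (cmod (g t r))\<^sup>2"
          unfolding AE_\<mu>
        proof (intro AE_I2 impI)
          fix r :: real assume "0 < r"
          thus "2 * mfield' R r * (cmod (g t r))\<^sup>2 \<le> 2 * (cmod (g t r))\<^sup>2"
            using mfield'_bounds(1)[OF R, of r] by (intro mult_right_mono) auto
        qed
      qed
      thus ?thesis by (simp add: sq_norm_def)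
    qed
    have A2: "Re (\<integral>r. of_real (mdiv' R r) * (cnj (f t r) * g t r) \<partial>\<mu>) \<le> C1 / R"
    proof -
      have i: "integrable \<mu> (\<lambda>r. (6 * real k + 42) / R * ((cmod (f t r))\<^sup>2 + (cmod (g t r))\<^sup>2))"
        using f g by (simp add: sq_int_def)
      have "Re (\<integral>r. of_real (mdiv' R r) * (cnj (f t r) * g t r) \<partial>\<mu>) \<le> cmod (\<integral>r. of_real (mdiv' R r) * (cnj (f t r) * g t r) \<partial>\<mu>)"
        by (rule complex_Re_le_cmod)
      also have "\<dots> \<le> (\<integral>r. (6 * real k + 42) / R * ((cmod (f t r))\<^sup>2 + (cmod (g t r))\<^sup>2) \<partial>\<mu>)"
      proof (rule norm_integral_le_integral_AE[OF _ i])
        have bE: "AE r in \<mu>. cmod (of_real (mdiv' R r)) \<le> (6 * real k + 42) / R"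
          unfolding AE_\<mu> using mdiv'_bounds[OF R] by auto
        have "integrable \<mu> (\<lambda>r. of_real (mdiv' R r) * cnj (f t r) * g t r)"
          by (rule sq_int_integrable_mult3[OF sq_int_cnj[OF f] g _ bE]) simp
        thus "integrable \<mu> (\<lambda>r. of_real (mdiv' R r) * (cnj (f t r) * g t r))" by (simp add: mult.assoc)
        show "AE r in \<mu>. norm (of_real (mdiv' R r) * (cnj (f t r) * g t r)) \<le> (6 * real k + 42) / R * ((cmod (f t r))\<^sup>2 + (cmod (g t r))\<^sup>2)"
          using bE
        proof eventually_elim
          case (elim r)
          have "2 * (cmod (f t r) * cmod (g t r)) \<le> (cmod (f t r))\<^sup>2 + (cmod (g t r))\<^sup>2" using sum_squares_bound[of "cmod (f t r)" "cmod (g t r)"] by simp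
          moreover have "0 \<le> cmod (f t r) * cmod (g t r)" by simp
          ultimately have "cmod (f t r) * cmod (g t r) \<le> (cmod (f t r))\<^sup>2 + (cmod (g t r))\<^sup>2" by linarith
          thus ?case unfolding norm_mult complex_mod_cnj using elim by (intro mult_mono) auto
        qed
      qed
      also have "\<dots> = (6 * real k + 42) / R * (sq_norm \<mu> (f t) + sq_norm \<mu> (g t))"
        using f g by (simp add: sq_int_def sq_norm_def)
      also have "\<dots> \<le> (6 * real k + 42) / R * (N0 + G)"
        using mass[OF tI] nG R by (intro mult_left_mono) auto
      finally show ?thesis by (simp add: C1_def)
    qed
    have A3: "(real k + 1) * ?P - C2 / R \<le> (\<integral>r. mdiv R r * cmod (f t r) powr (2 * \<sigma> + 2) \<partial>\<mu>)"
    proof -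
      let ?d = "(3 * (real k + 1) + 6) / R\<^sup>2"
      have "(real k + 1) * ?P - ?d * (\<integral>r. r\<^sup>2 * cmod (f t r) powr (2 * \<sigma> + 2) \<partial>\<mu>)
         = (\<integral>r. (real k + 1) * cmod (f t r) powr (2 * \<sigma> + 2) - ?d * (r\<^sup>2 * cmod (f t r) powr (2 * \<sigma> + 2)) \<partial>\<mu>)"
        using pb(1,3) by (simp only: Bochner_Integration.integral_diff integrable_mult_right integral_mult_right_zero)
      also have "\<dots> \<le> (\<integral>r. mdiv R r * cmod (f t r) powr (2 * \<sigma> + 2) \<partial>\<mu>)"
      proof (rule integral_mono_AE)
        show "integrable \<mu> (\<lambda>r. (real k + 1) * cmod (f t r) powr (2 * \<sigma> + 2) - ?d * (r\<^sup>2 * cmod (f t r) powr (2 * \<sigma> + 2)))"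
          by (intro Bochner_Integration.integrable_diff integrable_mult_right pb(1,3))
        show "integrable \<mu> (\<lambda>r. mdiv R r * cmod (f t r) powr (2 * \<sigma> + 2))"
          by (rule flux_potential(3)[OF prof[OF tI] R sigma_pos])
        show "AE r in \<mu>. (real k + 1) * cmod (f t r) powr (2 * \<sigma> + 2) - ?d * (r\<^sup>2 * cmod (f t r) powr (2 * \<sigma> + 2)) \<le> mdiv R r * cmod (f t r) powr (2 * \<sigma> + 2)"
          unfolding AE_\<mu>
        proof (intro AE_I2 impI)
          fix r :: real assume r: "0 < r"
          have "(real k + 1 - (3 * (real k + 1) + 6) * (r / R)\<^sup>2) * cmod (f t r) powr (2 * \<sigma> + 2) \<le> mdiv R r * cmod (f t r) powr (2 * \<sigma> + 2)"
            by (intro mult_right_mono mdiv_bounds(2)[OF R r]) simp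
          thus "(real k + 1) * cmod (f t r) powr (2 * \<sigma> + 2) - ?d * (r\<^sup>2 * cmod (f t r) powr (2 * \<sigma> + 2)) \<le> mdiv R r * cmod (f t r) powr (2 * \<sigma> + 2)"
            by (simp only: left_diff_distrib power_divide times_divide_eq_right times_divide_eq_left mult.assoc)
        qed
      qed
      finally have 1: "(real k + 1) * ?P - ?d * (\<integral>r. r\<^sup>2 * cmod (f t r) powr (2 * \<sigma> + 2) \<partial>\<mu>) \<le> (\<integral>r. mdiv R r * cmod (f t r) powr (2 * \<sigma> + 2) \<partial>\<mu>)" .
      have "Bp * sq_norm \<mu> (\<lambda>r. of_real r * f t r) \<le> Bp * W" using W(2)[OF t] Bp by (rule mult_left_mono)
      hence "(\<integral>r. r\<^sup>2 * cmod (f t r) powr (2 * \<sigma> + 2) \<partial>\<mu>) \<le> Bp * W" using pb(4) by (simp add: Bp_def)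
      hence "?d * (\<integral>r. r\<^sup>2 * cmod (f t r) powr (2 * \<sigma> + 2) \<partial>\<mu>) \<le> ?d * (Bp * W)" by (rule mult_left_mono) simp
      also have "\<dots> = C2 / R\<^sup>2" by (simp add: C2_def)
      also have "\<dots> \<le> C2 / R" using R1 C0 by (intro divide_left_mono) (auto simp: power2_eq_square)
      finally show ?thesis using 1 by linarith
    qed
    have "- Im (\<integral>r. (of_real (mdiv R r) * cnj (f t r) + 2 * of_real (mfield R r) * cnj (g t r)) * p t r \<partial>\<mu>)
       \<le> 2 * sq_norm \<mu> (g t) + C1 / R - s * ((real k + 1) * ?P - C2 / R)"
      using A1 A2 mult_left_mono[OF A3 s] unfolding vs(1) s_def by linarith
    also have "\<dots> \<le> 2 * (E0 + ?P / (\<sigma> + 1)) + C1 / R - s * ((real k + 1) * ?P - C2 / R)" using ng by simp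
    also have "\<dots> = 2 * E0 + (2 - \<sigma> * (real k + 1)) * (?P / (\<sigma> + 1)) + (C1 + s * C2) / R"
      by (simp add: s_def algebra_simps add_divide_distrib diff_divide_distrib)
    also have "\<dots> \<le> 2 * E0 + (C1 + s * C2) / R"
    proof -
      have "(2 - \<sigma> * (real k + 1)) * (?P / (\<sigma> + 1)) \<le> 0"
        using supercritical P0 sigma_pos by (intro mult_nonpos_nonneg) auto
      thus ?thesis by linarith
    qed
    finally show "- Im (\<integral>r. (of_real (mdiv R r) * cnj (f t r) + 2 * of_real (mfield R r) * cnj (g t r)) * p t r \<partial>\<mu>) \<le> 2 * E0 + (C1 + s * C2) / R" .
  qed
qed

lemma variance_tendsto:
  assumes t: "t \<in> I"
  shows "(\<lambda>n. variance (real (Suc n)) t) \<longlonglongrightarrow> sq_norm \<mu> (\<lambda>r. of_real r * f t r)"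
    "variance (real (Suc n)) t \<le> sq_norm \<mu> (\<lambda>r. of_real r * f t r)"
proof -
  note [measurable] = sq_int_measurable[OF f_L2[OF t], simplified]
  have n: "(cmod (of_real r * f t r))\<^sup>2 = r\<^sup>2 * (cmod (f t r))\<^sup>2" for r
    by (simp add: norm_mult power_mult_distrib)
  have i2: "integrable \<mu> (\<lambda>r. r\<^sup>2 * (cmod (f t r))\<^sup>2)"
    using rf_L2[OF t] unfolding sq_int_def n by simp
  have bd: "norm (mweight (real (Suc n)) r * (cmod (f t r))\<^sup>2) \<le> r\<^sup>2 * (cmod (f t r))\<^sup>2" for n r
  proof -
    have "mweight (real (Suc n)) r * (cmod (f t r))\<^sup>2 \<le> r\<^sup>2 * (cmod (f t r))\<^sup>2" "0 \<le> mweight (real (Suc n)) r"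
      using mweight_bounds[of "real (Suc n)" r] by (auto intro: mult_right_mono)
    thus ?thesis by simp
  qed
  show "(\<lambda>n. variance (real (Suc n)) t) \<longlonglongrightarrow> sq_norm \<mu> (\<lambda>r. of_real r * f t r)"
    unfolding variance_def sq_norm_def n
  proof (rule integral_dominated_convergence[OF _ _ i2])
    show "AE r in \<mu>. (\<lambda>n. mweight (real (Suc n)) r * (cmod (f t r))\<^sup>2) \<longlonglongrightarrow> r\<^sup>2 * (cmod (f t r))\<^sup>2"
      by (intro AE_I2 tendsto_intros mweight_tendsto)
    show "AE r in \<mu>. norm (mweight (real (Suc n)) r * (cmod (f t r))\<^sup>2) \<le> r\<^sup>2 * (cmod (f t r))\<^sup>2" for n
      by (intro AE_I2 bd)
  qed simp_all
  have ia: "integrable \<mu> (\<lambda>r. mweight (real (Suc n)) r * (cmod (f t r))\<^sup>2)"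
  proof (rule Bochner_Integration.integrable_bound[OF i2])
    show "AE r in \<mu>. norm (mweight (real (Suc n)) r * (cmod (f t r))\<^sup>2) \<le> norm (r\<^sup>2 * (cmod (f t r))\<^sup>2)"
      using bd by (intro AE_I2) (auto intro: order_trans[OF _ abs_ge_self])
  qed simp
  show "variance (real (Suc n)) t \<le> sq_norm \<mu> (\<lambda>r. of_real r * f t r)"
    unfolding variance_def sq_norm_def n
    by (rule integral_mono[OF ia i2]) (use bd in \<open>auto intro: order_trans[OF abs_ge_self]\<close>)
qed

lemma momentum_initial:
  assumes R: "0 < R" and t: "t \<in> I"
  shows "momentum R t \<le> sq_norm \<mu> (\<lambda>r. of_real r * f t r) + sq_norm \<mu> (g t)"
proof -
  have n: "(cmod (of_real r * f t r))\<^sup>2 = r\<^sup>2 * (cmod (f t r))\<^sup>2" for r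
    by (simp add: norm_mult power_mult_distrib)
  have bA: "AE r in \<mu>. cmod (of_real (mfield R r)) \<le> R"
    unfolding AE_\<mu> using mfield_bounds[OF R] by auto
  have i: "integrable \<mu> (\<lambda>r. (cmod (of_real r * f t r))\<^sup>2 + (cmod (g t r))\<^sup>2)"
    using rf_L2[OF t] g_L2[OF t] by (simp add: sq_int_def)
  have "momentum R t \<le> cmod (\<integral>r. of_real (mfield R r) * cnj (f t r) * g t r \<partial>\<mu>)"
    unfolding momentum_def by (rule order_trans[OF abs_ge_self abs_Im_le_cmod])
  also have "\<dots> \<le> (\<integral>r. (cmod (of_real r * f t r))\<^sup>2 + (cmod (g t r))\<^sup>2 \<partial>\<mu>)"
  proof (rule norm_integral_le_integral_AE[OF _ i])
    show "integrable \<mu> (\<lambda>r. of_real (mfield R r) * cnj (f t r) * g t r)"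
      by (rule sq_int_integrable_mult3[OF sq_int_cnj[OF f_L2[OF t]] g_L2[OF t] _ bA]) simp
    show "AE r in \<mu>. norm (of_real (mfield R r) * cnj (f t r) * g t r) \<le> (cmod (of_real r * f t r))\<^sup>2 + (cmod (g t r))\<^sup>2"
      unfolding AE_\<mu>
    proof (intro AE_I2 impI)
      fix r :: real assume r: "0 < r"
      have "norm (of_real (mfield R r) * cnj (f t r) * g t r) = mfield R r * cmod (f t r) * cmod (g t r)"
        using mfield_bounds(1)[OF R r] by (simp add: norm_mult)
      also have "\<dots> \<le> r * cmod (f t r) * cmod (g t r)" using mfield_bounds(2)[OF R r] by (intro mult_right_mono) auto
      also have "\<dots> = cmod (of_real r * f t r) * cmod (g t r)" using r by (simp add: norm_mult)
      finally have 1: "norm (of_real (mfield R r) * cnj (f t r) * g t r) \<le> cmod (of_real r * f t r) * cmod (g t r)" .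
      have "2 * (cmod (of_real r * f t r) * cmod (g t r)) \<le> (cmod (of_real r * f t r))\<^sup>2 + (cmod (g t r))\<^sup>2"
        using sum_squares_bound[of "cmod (of_real r * f t r)" "cmod (g t r)"] by simp
      moreover have "0 \<le> cmod (of_real r * f t r) * cmod (g t r)" by simp
      ultimately show "norm (of_real (mfield R r) * cnj (f t r) * g t r) \<le> (cmod (of_real r * f t r))\<^sup>2 + (cmod (g t r))\<^sup>2"
        using 1 by linarith
    qed
  qed
  also have "\<dots> = sq_norm \<mu> (\<lambda>r. of_real r * f t r) + sq_norm \<mu> (g t)"
    using rf_L2[OF t] g_L2[OF t] by (simp add: sq_int_def sq_norm_def)
  finally show ?thesis .
qed

text \<open>
  Integrate twice. At time zero momentum and variance are bounded uniformly in the truncation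
  radius; the error terms $C/R$, whose constant depends on the final time \<open>t\<close>,
  disappear as $R \to \infty$ with \<open>t\<close> fixed.
\<close>

theorem variance_bounded:
  "\<exists>C. \<forall>t\<in>I. sq_norm \<mu> (\<lambda>r. of_real r * f t r) \<le> C"
proof -
  have I0: "0 \<in> I" using Tc_pos by simp
  define V0 where "V0 = sq_norm \<mu> (\<lambda>r. of_real r * f 0 r)"
  define M0 where "M0 = V0 + sq_norm \<mu> (g 0)"
  have M00: "0 \<le> M0" by (simp add: M0_def V0_def)
  show ?thesis
  proof (intro exI[of _ "V0 + 4 * (M0 + 2 * \<bar>E0\<bar> * Tc) * Tc"] ballI)
    fix t assume t: "t \<in> I"
    obtain C where C: "0 \<le> C" and vi: "\<And>u R. u \<in> {0..t} \<Longrightarrow> 1 \<le> R \<Longrightarrow>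
        - Im (\<integral>r. (of_real (mdiv R r) * cnj (f u r) + 2 * of_real (mfield R r) * cnj (g u r)) * p u r \<partial>\<mu>) \<le> 2 * E0 + C / R"
      using virial_inequality[of t] t by auto
    have le: "variance (real (Suc n)) t \<le> V0 + 4 * (M0 + (2 * \<bar>E0\<bar> + C * inverse (real (Suc n))) * Tc) * Tc" for n
    proof -
      let ?R = "real (Suc n)"
      have R: "0 < ?R" "1 \<le> ?R" by auto
      let ?K = "2 * \<bar>E0\<bar> + C * inverse ?R"
      have K0: "0 \<le> ?K" using C by simp
      have Mb: "momentum ?R u \<le> M0 + ?K * Tc" if u: "u \<in> {0..t}" for u
      proof -
        have "momentum ?R u \<le> momentum ?R 0 + (2 * E0 + C / ?R) * u"
          by (rule real_derivative_within_bound[OF momentum_deriv[OF _ R(1)]]) (use u t vi[OF _ R(2)] in auto)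
        moreover have "(2 * E0 + C / ?R) * u \<le> ?K * Tc"
        proof -
          have "(2 * E0 + C / ?R) * u \<le> ?K * u" using u by (intro mult_right_mono) (auto simp: divide_inverse)
          also have "\<dots> \<le> ?K * Tc" using u t K0 by (intro mult_left_mono) auto
          finally show ?thesis .
        qed
        ultimately show ?thesis using momentum_initial[OF R(1) I0] unfolding M0_def V0_def by linarith
      qed
      have "variance ?R t \<le> variance ?R 0 + (4 * (M0 + ?K * Tc)) * t"
      proof (rule real_derivative_within_bound[OF variance_deriv[OF _ R(1)]])
        show "4 * momentum ?R u \<le> 4 * (M0 + ?K * Tc)" if "u \<in> {0..t}" for u
          using Mb[OF that] by (rule mult_left_mono) simp
      qed (use t in auto)
      also have "\<dots> \<le> V0 + 4 * (M0 + ?K * Tc) * Tc"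
        using variance_tendsto(2)[OF I0, of n] t K0 M00 Tc_pos unfolding V0_def
        by (intro add_mono mult_left_mono) auto
      finally show ?thesis .
    qed
    have "(\<lambda>n. V0 + 4 * (M0 + (2 * \<bar>E0\<bar> + C * inverse (real (Suc n))) * Tc) * Tc) \<longlonglongrightarrow> V0 + 4 * (M0 + (2 * \<bar>E0\<bar> + C * 0) * Tc) * Tc"
      by (intro tendsto_intros LIMSEQ_inverse_real_of_nat)
    hence "sq_norm \<mu> (\<lambda>r. of_real r * f t r) \<le> V0 + 4 * (M0 + (2 * \<bar>E0\<bar> + C * 0) * Tc) * Tc"
      by (rule LIMSEQ_le[OF variance_tendsto(1)[OF t]]) (use le in auto)
    thus "sq_norm \<mu> (\<lambda>r. of_real r * f t r) \<le> V0 + 4 * (M0 + 2 * \<bar>E0\<bar> * Tc) * Tc" by simp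
  qed
qed

end

section \<open>From solutions in space to radial profiles\<close>

text \<open>
  If the bound failed at one point it would fail on an interval, by continuity.
\<close>

lemma AE_bound_imp_bound:
  fixes f :: "real \<Rightarrow> complex"
  assumes ae: "AE r in lborel. 0 < r \<longrightarrow> cmod (f r) \<le> B" and c: "continuous_on {0<..} f" and r: "0 < r"
  shows "cmod (f r) \<le> B"
proof (rule ccontr)
  assume "\<not> cmod (f r) \<le> B"
  hence gt: "B < cmod (f r)" by simp
  have "isCont (\<lambda>r. cmod (f r)) r"
    using c r by (intro continuous_norm) (auto simp: continuous_on_eq_continuous_at)
  hence "((\<lambda>r. cmod (f r)) \<longlongrightarrow> cmod (f r)) (nhds r)"
    unfolding isCont_def by (rule tendsto_at_iff_tendsto_nhds[THEN iffD1])
  hence "\<forall>\<^sub>F s in nhds r. B < cmod (f s)" using gt by (rule order_tendstoD)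
  moreover have "\<forall>\<^sub>F s in nhds r. 0 < s" using eventually_nhds_in_open[of "{0<..}" r] r by simp
  ultimately have "\<forall>\<^sub>F s in nhds r. B < cmod (f s) \<and> 0 < s" by (rule eventually_conj)
  then obtain d where d: "0 < d" "\<And>s. dist s r < d \<Longrightarrow> B < cmod (f s) \<and> 0 < s"
    unfolding eventually_nhds_metric by blast
  have "AE s in lborel. s \<notin> {r<..<r+d}"
    using ae
  proof eventually_elim
    case (elim s)
    show ?case using d(2)[of s] elim by (auto simp: dist_real_def)
  qed
  hence "{r<..<r+d} \<in> null_sets lborel" by (subst AE_iff_null_sets) auto
  thus False using d(1) by (simp add: null_sets_def)
qed

text \<open>
  The second derivative \<open>q\<close> is defined by solving the equation for it, so that the
  equation holds everywhere and \<open>q\<close> is Borel measurable; it agrees almost everywhere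
  with the given weak derivative.
\<close>

lemma radial_NLS_regular:
  fixes u ut :: "real \<Rightarrow> complex"
  assumes nls: "radial_NLS d \<sigma> u ut" and d: "1 \<le> d" and ut [measurable]: "ut \<in> borel_measurable borel"
  shows "\<exists>f g q. f \<in> borel_measurable borel \<and> g \<in> borel_measurable borel \<and> q \<in> borel_measurable borel \<and>
     (AE r in lborel. 0 < r \<longrightarrow> u r = f r) \<and> (\<forall>r>0. (f has_vector_derivative g r) (at r)) \<and> ac_pos g q \<and>
     (\<forall>r>0. \<i> * ut r + (q r + of_real (real (d - 1) / r) * g r) + of_real (cmod (f r) powr (2 * \<sigma>)) * f r = 0)"
proof -
  obtain ur urr where w: "has_weak_derivative {0<..} 1 u ur" "has_weak_derivative {0<..} 1 ur urr"
    and pde: "AE r in lborel. 0 < r \<longrightarrow> \<i> * ut r + urr r + of_real ((real d - 1) / r) * ur r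
           + of_real (cmod (u r) powr (2 * \<sigma>)) * u r = 0"
    using nls unfolding radial_NLS_def by blast
  obtain F1 where F1: "ac_pos F1 ur" "AE r in lborel. 0 < r \<longrightarrow> u r = F1 r" using weak_derivative_ac[OF w(1)] by blast
  obtain F2 where F2: "ac_pos F2 urr" "AE r in lborel. 0 < r \<longrightarrow> ur r = F2 r" using weak_derivative_ac[OF w(2)] by blast
  have c2: "continuous_on {0<..} F2" by (rule ac_pos_continuous[OF F2(1)])
  have F12: "ac_pos F1 F2"
  proof (rule ac_pos_AE_cong[OF F1(1) F2(2)])
    show "set_integrable lborel {a..b} F2" if "0 < a" "a \<le> b" for a b
      by (rule borel_integrable_atLeastAtMost') (use that in \<open>auto intro: continuous_on_subset[OF c2]\<close>)
  qed
  define f where "f r = indicator {0<..} r *\<^sub>R F1 r" for r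
  define g where "g r = indicator {0<..} r *\<^sub>R F2 r" for r
  define q where "q r = indicator {0<..} r *\<^sub>R (- \<i> * ut r - of_real (real (d - 1) / r) * g r - of_real (cmod (f r) powr (2 * \<sigma>)) * f r)" for r
  have fm [measurable]: "f \<in> borel_measurable borel"
    unfolding f_def[abs_def] by (rule borel_measurable_continuous_on_indicator[OF _ ac_pos_continuous[OF F1(1)]]) simp
  have gm [measurable]: "g \<in> borel_measurable borel"
    unfolding g_def[abs_def] by (rule borel_measurable_continuous_on_indicator[OF _ c2]) simp
  have qm [measurable]: "q \<in> borel_measurable borel" unfolding q_def[abs_def] by measurable
  have ac_fg: "ac_pos f g" by (rule ac_pos_cong[OF F12]) (auto simp: f_def g_def)
  have gc: "continuous_on {0<..} g" using c2 by (rule continuous_on_eq) (simp add: g_def)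
  have qurr: "AE r in lborel. 0 < r \<longrightarrow> urr r = q r"
    using pde F1(2) F2(2)
  proof eventually_elim
    case (elim r)
    show ?case
    proof
      assume r: "0 < r"
      have rd: "real (d - 1) = real d - 1" using d by simp
      have e: "\<i> * ut r + urr r + of_real ((real d - 1) / r) * F2 r + of_real (cmod (F1 r) powr (2 * \<sigma>)) * F1 r = 0"
        using elim r by simp
      have "q r = - \<i> * ut r - of_real ((real d - 1) / r) * F2 r - of_real (cmod (F1 r) powr (2 * \<sigma>)) * F1 r"
        using r unfolding q_def f_def g_def rd by simp
      hence "urr r - q r = \<i> * ut r + urr r + of_real ((real d - 1) / r) * F2 r + of_real (cmod (F1 r) powr (2 * \<sigma>)) * F1 r" by simp
      thus "urr r = q r" unfolding e by simp
    qed
  qed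
  have ac_g: "ac_pos g q"
  proof (rule ac_pos_AE_cong[OF _ qurr])
    show "ac_pos g urr" by (rule ac_pos_cong[OF F2(1)]) (auto simp: g_def)
    show "set_integrable lborel {a..b} q" if ab: "0 < a" "a \<le> b" for a b
      unfolding set_integrable_def
    proof (rule integrable_cong_AE_imp[OF ac_posD(1)[OF F2(1) ab, unfolded set_integrable_def]])
      show "AE r in lborel. indicator {a..b} r *\<^sub>R urr r = indicator {a..b} r *\<^sub>R q r"
        using qurr by eventually_elim (use ab in \<open>auto split: split_indicator\<close>)
    qed measurable
  qed
  have "AE r in lborel. 0 < r \<longrightarrow> u r = f r" using F1(2) by eventually_elim (simp add: f_def)
  moreover have "\<forall>r>0. (f has_vector_derivative g r) (at r)"
    using ac_pos_has_vector_derivative[OF ac_fg gc] by blast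
  moreover have "\<forall>r>0. \<i> * ut r + (q r + of_real (real (d - 1) / r) * g r) + of_real (cmod (f r) powr (2 * \<sigma>)) * f r = 0"
    by (simp add: q_def)
  ultimately show ?thesis using fm gm qm ac_g by blast
qed

lemma radial_L2_transfer:
  fixes H :: "'a::euclidean_space \<Rightarrow> complex"
  assumes h: "h \<in> borel_measurable borel" and H: "H \<in> borel_measurable borel"
    and eq: "AE x in lborel. H x = h (norm x)"
  defines "\<mu> \<equiv> radial_measure (DIM('a) * unit_ball_vol DIM('a)) (DIM('a) - 1)"
  shows "in_L2 H \<longleftrightarrow> sq_int \<mu> h" "(L2_norm H)\<^sup>2 = sq_norm \<mu> h"
proof -
  note [measurable] = h H
  have d: "\<mu> = distr (lborel :: 'a measure) borel norm" unfolding \<mu>_def by (rule distr_norm_lborel[symmetric])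
  have hm: "(\<lambda>r. (cmod (h r))\<^sup>2) \<in> borel_measurable borel" by measurable
  have ae: "AE x in lborel. (cmod (H x))\<^sup>2 = (cmod (h (norm x)))\<^sup>2" using eq by eventually_elim simp
  have "integrable \<mu> (\<lambda>r. (cmod (h r))\<^sup>2) \<longleftrightarrow> integrable lborel (\<lambda>x::'a. (cmod (h (norm x)))\<^sup>2)"
    unfolding d by (rule integrable_distr_eq) auto
  also have "\<dots> \<longleftrightarrow> integrable lborel (\<lambda>x. (cmod (H x))\<^sup>2)"
    by (rule integrable_cong_AE) (use ae in \<open>auto\<close>)
  finally show "in_L2 H \<longleftrightarrow> sq_int \<mu> h" using h H by (simp add: in_L2_def sq_int_def d)
  have "sq_norm \<mu> h = (\<integral>x. (cmod (h (norm x)))\<^sup>2 \<partial>(lborel :: 'a measure))"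
    unfolding sq_norm_def d by (rule integral_distr) auto
  also have "\<dots> = (\<integral>x. (cmod (H x))\<^sup>2 \<partial>lborel)"
    by (rule integral_cong_AE) (use ae in \<open>auto\<close>)
  finally show "(L2_norm H)\<^sup>2 = sq_norm \<mu> h" by (simp add: L2_norm_def)
qed

text \<open>
  All norms in space become norms for the radial measure. The profiles are representatives of the
  radial parts, modified to be Borel on the whole line.
\<close>

theorem radial_NLS_variance_bounded:
  fixes \<psi> :: "real \<Rightarrow> real \<Rightarrow> complex" and \<sigma> :: real
  assumes d: "CARD('d::finite) > 1" and \<sigma>: "0 < \<sigma>" "2 \<le> \<sigma> * CARD('d)" and Tc: "0 < Tc"
    and sol: "radial_NLS_solution TYPE('d) \<sigma> Tc \<psi>"
  shows "\<exists>C. \<forall>t\<in>{0..<Tc}. in_L2 (\<lambda>x::real^'d. of_real (norm x) * radial_field \<psi> t x) \<and>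
     (L2_norm (\<lambda>x::real^'d. of_real (norm x) * radial_field \<psi> t x))\<^sup>2 \<le> C"
proof -
  define \<Psi> where "\<Psi> = (radial_field \<psi> :: real \<Rightarrow> real^'d \<Rightarrow> complex)"
  define I where "I = {0..<Tc}"
  define c where "c = real DIM(real^'d) * unit_ball_vol DIM(real^'d)"
  define k where "k = DIM(real^'d) - 1"
  have k: "k = CARD('d) - 1" by (simp add: k_def)
  have c0: "0 < c" unfolding c_def by (intro mult_pos_pos) auto
  interpret radial_weight c k by unfold_locales (use c0 k d in auto)
  have dn: "distr (lborel :: (real^'d) measure) borel norm = \<mu>"
    unfolding c_def k_def by (rule distr_norm_lborel)
  have H2: "\<And>t. t \<in> I \<Longrightarrow> in_H2 (\<Psi> t)"
    and bnd: "\<And>T. T < Tc \<Longrightarrow> \<exists>B. \<forall>t\<in>{0..T}. \<forall>x. cmod (\<Psi> t x) \<le> B"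
    and xL2: "L2_continuous_on I (\<lambda>t x. of_real (norm x) * \<Psi> t x)"
    and mass: "\<And>t. t \<in> I \<Longrightarrow> nls_power (\<Psi> t) = nls_power (\<Psi> 0)"
    and energy: "\<And>t. t \<in> I \<Longrightarrow> hamiltonian \<sigma> (\<Psi> t) = hamiltonian \<sigma> (\<Psi> 0)"
    using sol unfolding radial_NLS_solution_def Let_def \<Psi>_def[symmetric] I_def[symmetric] H2_continuous_on_def by auto
  obtain \<psi>t where C1: "L2_C1_on I \<Psi> (radial_field \<psi>t)" and nls: "\<And>t. t \<in> I \<Longrightarrow> radial_NLS CARD('d) \<sigma> (\<psi> t) (\<psi>t t)"
    using sol unfolding radial_NLS_solution_def Let_def \<Psi>_def[symmetric] I_def[symmetric] by auto
  define \<Psi>t where "\<Psi>t = (radial_field \<psi>t :: real \<Rightarrow> real^'d \<Rightarrow> complex)"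
  note C1 = C1[folded \<Psi>t_def]
  have \<Psi>_L2: "in_L2 (\<Psi> t)" and \<Psi>t_L2: "in_L2 (\<Psi>t t)" and x\<Psi>_L2: "in_L2 (\<lambda>x. of_real (norm x) * \<Psi> t x)" if "t \<in> I" for t
    using C1 xL2 that by (auto simp: L2_C1_on_def L2_continuous_on_def)
  have \<Psi>_m: "\<Psi> t \<in> borel_measurable borel" and \<Psi>t_m: "\<Psi>t t \<in> borel_measurable borel" if "t \<in> I" for t
    using \<Psi>_L2[OF that] \<Psi>t_L2[OF that] by (auto simp: in_L2_def)
  define e1 :: "real^'d" where "e1 = axis undefined 1"
  have e1: "norm e1 = 1" by (simp add: e1_def)
  \<comment> \<open>Restricting the field to a ray makes its profile Borel measurable.\<close>
  define p where "p t r = \<Psi>t t (r *\<^sub>R e1)" for t r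
  have p_m: "p t \<in> borel_measurable borel" if "t \<in> I" for t
  proof -
    have [measurable]: "\<Psi>t t \<in> borel_measurable borel" by (rule \<Psi>t_m[OF that])
    show ?thesis unfolding p_def[abs_def] by measurable
  qed
  have p_eq: "p t r = \<psi>t t r" if "0 \<le> r" for t r using that by (simp add: p_def \<Psi>t_def radial_field_def e1)
  define reg where "reg t f g q \<longleftrightarrow> f \<in> borel_measurable borel \<and> g \<in> borel_measurable borel \<and> q \<in> borel_measurable borel \<and>
     (AE r in lborel. 0 < r \<longrightarrow> \<psi> t r = f r) \<and> (\<forall>r>0. (f has_vector_derivative g r) (at r)) \<and> ac_pos g q \<and>
     (\<forall>r>0. \<i> * p t r + (q r + of_real (real (CARD('d) - 1) / r) * g r) + of_real (cmod (f r) powr (2 * \<sigma>)) * f r = 0)" for t f g q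
  have "\<exists>f g q. reg t f g q" if t: "t \<in> I" for t
    unfolding reg_def
  proof (rule radial_NLS_regular)
    obtain ur urr where u: "has_weak_derivative {0<..} 1 (\<psi> t) ur" "has_weak_derivative {0<..} 1 ur urr"
      and pde: "AE r in lborel. 0 < r \<longrightarrow> \<i> * \<psi>t t r + urr r + of_real ((real CARD('d) - 1) / r) * ur r
           + of_real (cmod (\<psi> t r) powr (2 * \<sigma>)) * \<psi> t r = 0"
      using nls[OF t] unfolding radial_NLS_def by blast
    have "AE r in lborel. 0 < r \<longrightarrow> \<i> * p t r + urr r + of_real ((real CARD('d) - 1) / r) * ur r
           + of_real (cmod (\<psi> t r) powr (2 * \<sigma>)) * \<psi> t r = 0"
      using pde by eventually_elim (simp add: p_eq)
    with u show "radial_NLS CARD('d) \<sigma> (\<psi> t) (p t)" unfolding radial_NLS_def by blast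
  qed (use p_m[OF t] d in auto)
  then obtain f g q where "\<And>t. t \<in> I \<Longrightarrow> reg t (f t) (g t) (q t)" by metis
  hence f_m: "\<And>t. t \<in> I \<Longrightarrow> f t \<in> borel_measurable borel"
    and g_m: "\<And>t. t \<in> I \<Longrightarrow> g t \<in> borel_measurable borel" and q_m: "\<And>t. t \<in> I \<Longrightarrow> q t \<in> borel_measurable borel"
    and \<psi>f: "\<And>t. t \<in> I \<Longrightarrow> AE r in lborel. 0 < r \<longrightarrow> \<psi> t r = f t r"
    and fg: "\<And>t r. t \<in> I \<Longrightarrow> 0 < r \<Longrightarrow> (f t has_vector_derivative g t r) (at r)"
    and gq: "\<And>t. t \<in> I \<Longrightarrow> ac_pos (g t) (q t)"
    and eqn: "\<And>t r. t \<in> I \<Longrightarrow> 0 < r \<Longrightarrow> \<i> * p t r + (q t r + of_real (real (CARD('d) - 1) / r) * g t r) + of_real (cmod (f t r) powr (2 * \<sigma>)) * f t r = 0"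
    unfolding reg_def by blast+
  have eqn': "\<i> * p t r + radial_laplacian (g t) (q t) r + of_real (cmod (f t r) powr (2 * \<sigma>)) * f t r = 0" if "t \<in> I" "0 < r" for t r
    using eqn[OF that] unfolding radial_laplacian_def k[symmetric] .
  have \<Psi>f: "AE x in lborel. \<Psi> t x = f t (norm x)" if "t \<in> I" for t
  proof -
    have "AE r in \<mu>. \<psi> t r = f t r" using \<psi>f[OF that] by (simp add: AE_\<mu>)
    hence "AE x in (lborel :: (real^'d) measure). \<psi> t (norm x) = f t (norm x)"
      unfolding dn[symmetric] by (rule AE_distrD[rotated]) simp
    thus ?thesis by (simp add: \<Psi>_def radial_field_def)
  qed
  have \<Psi>tp: "\<Psi>t t x = p t (norm x)" for t x using p_eq[of "norm x" t] by (simp add: \<Psi>t_def radial_field_def)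
  note tr = radial_L2_transfer[where 'a="real^'d", folded c_def k_def]
  have f_L2: "sq_int \<mu> (f t)" and f_n: "(L2_norm (\<Psi> t))\<^sup>2 = sq_norm \<mu> (f t)" if t: "t \<in> I" for t
    using tr[OF f_m[OF t] \<Psi>_m[OF t] \<Psi>f[OF t]] \<Psi>_L2[OF t] by auto
  have p_L2: "sq_int \<mu> (p t)" if t: "t \<in> I" for t
    using tr(1)[OF p_m[OF t] \<Psi>t_m[OF t]] \<Psi>tp \<Psi>t_L2[OF t] by auto
  have rf_L2: "sq_int \<mu> (\<lambda>r. of_real r * f t r)" 
    and rf_n: "(L2_norm (\<lambda>x. of_real (norm x) * \<Psi> t x))\<^sup>2 = sq_norm \<mu> (\<lambda>r. of_real r * f t r)" if t: "t \<in> I" for t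
  proof -
    have [measurable]: "f t \<in> borel_measurable borel" "\<Psi> t \<in> borel_measurable borel" by (fact f_m[OF t] \<Psi>_m[OF t])+
    have "AE x in lborel. of_real (norm x) * \<Psi> t x = of_real (norm x) * f t (norm x)"
      using \<Psi>f[OF t] by eventually_elim simp
    note T = tr[of "\<lambda>r. of_real r * f t r" "\<lambda>x. of_real (norm x) * \<Psi> t x", OF _ _ this]
    show "sq_int \<mu> (\<lambda>r. of_real r * f t r)" using T(1) x\<Psi>_L2[OF t] by simp
    show "(L2_norm (\<lambda>x. of_real (norm x) * \<Psi> t x))\<^sup>2 = sq_norm \<mu> (\<lambda>r. of_real r * f t r)" by (rule T(2)) measurable
  qed
  have gc: "continuous_on {0<..} (g t)" if "t \<in> I" for t by (rule ac_pos_continuous[OF gq[OF that]])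
  have fc: "continuous_on {0<..} (f t)" if "t \<in> I" for t
    using fg[OF that] by (intro continuous_at_imp_continuous_on) (auto intro: has_vector_derivative_continuous)
  have fb: "cmod (f t r) \<le> B" if t: "t \<in> I" and B: "\<And>x. cmod (\<Psi> t x) \<le> B" and r: "0 < r" for t B r
  proof (rule AE_bound_imp_bound[OF _ fc[OF t] r])
    have pb: "cmod (\<psi> t r) \<le> B" if "0 < r" for r
      using B[of "r *\<^sub>R e1"] that by (simp add: \<Psi>_def radial_field_def e1)
    thus "AE r in lborel. 0 < r \<longrightarrow> cmod (f t r) \<le> B"
      using \<psi>f[OF t] by eventually_elim (metis pb)
  qed
  have grad: "sq_int \<mu> (g t)" "sq_norm \<mu> (g t) \<le> gradient_norm_sq (\<Psi> t)" if t: "t \<in> I" for t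
  proof -
    have H1: "in_H1 (\<Psi> t)" "\<forall>b\<in>Basis. in_H1 (weak_derivative b (\<Psi> t))" using H2[OF t] by (auto simp: in_H2_def)
    interpret rg: radial_gradient c k "\<Psi> t" "\<lambda>b. weak_derivative b (\<Psi> t)" "f t" "g t"
    proof unfold_locales
      show "c = real DIM(real^'d) * unit_ball_vol DIM(real^'d)" "k = DIM(real^'d) - 1" by (fact c_def k_def)+
      fix i :: "real^'d" assume i: "i \<in> Basis"
      have "\<exists>G. has_weak_derivative UNIV i (\<Psi> t) G" using H1(1) i unfolding in_H1_def by blast
      thus "has_weak_derivative UNIV i (\<Psi> t) (weak_derivative i (\<Psi> t))"
        unfolding weak_derivative_def by (rule someI_ex)
      show "in_L2 (weak_derivative i (\<Psi> t))" using H1(2) i by (auto simp: in_H1_def)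
    qed (use \<Psi>f[OF t] fg[OF t] f_m[OF t] g_m[OF t] gc[OF t] in auto)
    show "sq_int \<mu> (g t)" "sq_norm \<mu> (g t) \<le> gradient_norm_sq (\<Psi> t)"
      using rg.radial_derivative_L2 by (auto simp: gradient_norm_sq_def)
  qed
  have potential: "(\<integral>x. cmod (\<Psi> t x) powr (2 * \<sigma> + 2) \<partial>lborel) = (\<integral>r. cmod (f t r) powr (2 * \<sigma> + 2) \<partial>\<mu>)" if t: "t \<in> I" for t
  proof -
    note [measurable] = f_m[OF t] \<Psi>_m[OF t]
    have "(\<integral>r. cmod (f t r) powr (2 * \<sigma> + 2) \<partial>\<mu>) = (\<integral>x. cmod (f t (norm x)) powr (2 * \<sigma> + 2) \<partial>(lborel :: (real^'d) measure))"
      unfolding dn[symmetric] by (rule integral_distr) auto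
    also have "\<dots> = (\<integral>x. cmod (\<Psi> t x) powr (2 * \<sigma> + 2) \<partial>lborel)"
    proof (rule integral_cong_AE)
      show "AE x in lborel. cmod (f t (norm x)) powr (2 * \<sigma> + 2) = cmod (\<Psi> t x) powr (2 * \<sigma> + 2)"
        using \<Psi>f[OF t] by eventually_elim simp
    qed measurable
    finally show ?thesis by simp
  qed
  have ev: "\<forall>\<^sub>F s in at t within I. s \<in> I" for t by (auto simp: eventually_at_filter)
  have sq0: "((\<lambda>s. sq_norm \<mu> (h s)) \<longlongrightarrow> 0) (at t within I)"
    if "((\<lambda>s. L2_norm (Hs s :: real^'d \<Rightarrow> complex)) \<longlongrightarrow> 0) (at t within I)" and "\<And>s. s \<in> I \<Longrightarrow> (L2_norm (Hs s))\<^sup>2 = sq_norm \<mu> (h s)" for h Hs t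
  proof (rule Lim_transform_eventually)
    show "((\<lambda>s. (L2_norm (Hs s))\<^sup>2) \<longlongrightarrow> 0) (at t within I)" using tendsto_power[OF that(1), of 2] by simp
    show "\<forall>\<^sub>F s in at t within I. (L2_norm (Hs s))\<^sup>2 = sq_norm \<mu> (h s)" using ev by eventually_elim (rule that(2))
  qed
  interpret radial_flow c k \<sigma> Tc "nls_power (\<Psi> 0)" "hamiltonian \<sigma> (\<Psi> 0)" f g q p
  proof unfold_locales
    show "0 < \<sigma>" "0 < Tc" by fact+
    show "2 \<le> \<sigma> * (real k + 1)" using \<sigma>(2) d by (simp add: k of_nat_diff)
    fix t assume "t \<in> {0..<Tc}"
    hence t: "t \<in> I" by (simp add: I_def)
    note [measurable] = f_m[OF t] \<Psi>_m[OF t] p_m[OF t] \<Psi>t_m[OF t]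
    obtain B where "\<forall>u\<in>{0..t}. \<forall>x. cmod (\<Psi> u x) \<le> B" using bnd[of t] t by (auto simp: I_def)
    hence B: "\<And>x. cmod (\<Psi> t x) \<le> B" using t by (auto simp: I_def)
    show "AE r in \<mu>. \<i> * p t r + radial_laplacian (g t) (q t) r + of_real (cmod (f t r) powr (2 * \<sigma>)) * f t r = 0"
      unfolding AE_\<mu> using eqn'[OF t] by auto
    show "sq_int \<mu> (p t)" by (rule p_L2[OF t])
    show "profile (f t) (g t) (q t)"
      unfolding profile_def
    proof (intro conjI allI impI)
      have N: "sq_int \<mu> (\<lambda>r. of_real (cmod (f t r) powr (2 * \<sigma>)) * f t r)"
        by (rule sq_int_nonlinearity[OF f_L2[OF t] fb[OF t B] \<sigma>(1)])
      have s: "sq_int \<mu> (\<lambda>r. - \<i> * p t r - of_real (cmod (f t r) powr (2 * \<sigma>)) * f t r)"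
        by (rule sq_int_diff[OF sq_int_cmult[OF p_L2[OF t]] N])
      show "sq_int \<mu> (radial_laplacian (g t) (q t))"
      proof (rule sq_int_bound[OF s, where C=1])
        note [measurable] = g_m[OF t] q_m[OF t]
        show "radial_laplacian (g t) (q t) \<in> borel_measurable \<mu>" unfolding radial_laplacian_def[abs_def] by simp
        show "AE r in \<mu>. cmod (radial_laplacian (g t) (q t) r) \<le> 1 * cmod (- \<i> * p t r - of_real (cmod (f t r) powr (2 * \<sigma>)) * f t r)"
          unfolding AE_\<mu>
        proof (intro AE_I2 impI)
          fix r :: real assume "0 < r"
          from eqn'[OF t this] have "radial_laplacian (g t) (q t) r = - \<i> * p t r - of_real (cmod (f t r) powr (2 * \<sigma>)) * f t r"
            by (simp add: add_eq_0_iff algebra_simps)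
          thus "cmod (radial_laplacian (g t) (q t) r) \<le> 1 * cmod (- \<i> * p t r - of_real (cmod (f t r) powr (2 * \<sigma>)) * f t r)" by simp
        qed
      qed
      show "\<exists>B. \<forall>r>0. cmod (f t r) \<le> B" using fb[OF t B] by blast
    qed (use fg[OF t] gq[OF t] f_L2[OF t] grad(1)[OF t] in auto)
    show "sq_int \<mu> (\<lambda>r. of_real r * f t r)" by (rule rf_L2[OF t])
    show "sq_norm \<mu> (f t) \<le> nls_power (\<Psi> 0)" using mass[OF t] f_n[OF t] by (simp add: nls_power_def)
    show "sq_norm \<mu> (g t) - 1 / (\<sigma> + 1) * (\<integral>r. cmod (f t r) powr (2 * \<sigma> + 2) \<partial>\<mu>) \<le> hamiltonian \<sigma> (\<Psi> 0)"
      using grad(2)[OF t] energy[OF t] by (simp add: hamiltonian_def potential[OF t])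
    have "((\<lambda>s. sq_norm \<mu> (\<lambda>r. f s r - f t r)) \<longlongrightarrow> 0) (at t within I)"
    proof (rule sq0)
      show "((\<lambda>s. L2_norm (\<lambda>x. \<Psi> s x - \<Psi> t x)) \<longlongrightarrow> 0) (at t within I)" using C1 t by (auto simp: L2_C1_on_def L2_continuous_on_def)
      fix s assume s: "s \<in> I"
      note [measurable] = f_m[OF s] \<Psi>_m[OF s]
      have "AE x in lborel. \<Psi> s x - \<Psi> t x = f s (norm x) - f t (norm x)" using \<Psi>f[OF s] \<Psi>f[OF t] by eventually_elim simp
      from tr(2)[of "\<lambda>r. f s r - f t r" "\<lambda>x. \<Psi> s x - \<Psi> t x", OF _ _ this]
      show "(L2_norm (\<lambda>x. \<Psi> s x - \<Psi> t x))\<^sup>2 = sq_norm \<mu> (\<lambda>r. f s r - f t r)" by simp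
    qed
    thus "((\<lambda>s. sq_norm \<mu> (\<lambda>r. f s r - f t r)) \<longlongrightarrow> 0) (at t within {0..<Tc})" by (simp add: I_def)
    have "((\<lambda>s. sq_norm \<mu> (\<lambda>r. p s r - p t r)) \<longlongrightarrow> 0) (at t within I)"
    proof (rule sq0)
      show "((\<lambda>s. L2_norm (\<lambda>x. \<Psi>t s x - \<Psi>t t x)) \<longlongrightarrow> 0) (at t within I)" using C1 t by (auto simp: L2_C1_on_def L2_continuous_on_def)
      fix s assume s: "s \<in> I"
      note [measurable] = p_m[OF s] \<Psi>t_m[OF s]
      have "AE x in lborel. \<Psi>t s x - \<Psi>t t x = p s (norm x) - p t (norm x)" by (simp add: \<Psi>tp)
      from tr(2)[of "\<lambda>r. p s r - p t r" "\<lambda>x. \<Psi>t s x - \<Psi>t t x", OF _ _ this]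
      show "(L2_norm (\<lambda>x. \<Psi>t s x - \<Psi>t t x))\<^sup>2 = sq_norm \<mu> (\<lambda>r. p s r - p t r)" by simp
    qed
    thus "((\<lambda>s. sq_norm \<mu> (\<lambda>r. p s r - p t r)) \<longlongrightarrow> 0) (at t within {0..<Tc})" by (simp add: I_def)
    have "((\<lambda>s. sq_norm \<mu> (\<lambda>r. (f s r - f t r) / of_real (s - t) - p t r)) \<longlongrightarrow> 0) (at t within I)"
    proof (rule sq0)
      show "((\<lambda>s. L2_norm (\<lambda>x. (\<Psi> s x - \<Psi> t x) / of_real (s - t) - \<Psi>t t x)) \<longlongrightarrow> 0) (at t within I)" using C1 t by (auto simp: L2_C1_on_def)
      fix s assume s: "s \<in> I"
      note [measurable] = f_m[OF s] \<Psi>_m[OF s]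
      have "AE x in lborel. (\<Psi> s x - \<Psi> t x) / of_real (s - t) - \<Psi>t t x = (f s (norm x) - f t (norm x)) / of_real (s - t) - p t (norm x)"
        using \<Psi>f[OF s] \<Psi>f[OF t] by eventually_elim (simp add: \<Psi>tp)
      from tr(2)[of "\<lambda>r. (f s r - f t r) / of_real (s - t) - p t r" "\<lambda>x. (\<Psi> s x - \<Psi> t x) / of_real (s - t) - \<Psi>t t x", OF _ _ this]
      show "(L2_norm (\<lambda>x. (\<Psi> s x - \<Psi> t x) / of_real (s - t) - \<Psi>t t x))\<^sup>2 = sq_norm \<mu> (\<lambda>r. (f s r - f t r) / of_real (s - t) - p t r)" by simp
    qed
    thus "((\<lambda>s. sq_norm \<mu> (\<lambda>r. (f s r - f t r) / of_real (s - t) - p t r)) \<longlongrightarrow> 0) (at t within {0..<Tc})" by (simp add: I_def)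
    have "((\<lambda>s. sq_norm \<mu> (\<lambda>r. of_real r * f s r - of_real r * f t r)) \<longlongrightarrow> 0) (at t within I)"
    proof (rule sq0)
      show "((\<lambda>s. L2_norm (\<lambda>x. of_real (norm x) * \<Psi> s x - of_real (norm x) * \<Psi> t x)) \<longlongrightarrow> 0) (at t within I)" using xL2 t by (auto simp: L2_continuous_on_def)
      fix s assume s: "s \<in> I"
      note [measurable] = f_m[OF s] \<Psi>_m[OF s]
      have "AE x in lborel. of_real (norm x) * \<Psi> s x - of_real (norm x) * \<Psi> t x = of_real (norm x) * f s (norm x) - of_real (norm x) * f t (norm x)" using \<Psi>f[OF s] \<Psi>f[OF t] by eventually_elim simp
      from tr(2)[of "\<lambda>r. of_real r * f s r - of_real r * f t r" "\<lambda>x. of_real (norm x) * \<Psi> s x - of_real (norm x) * \<Psi> t x", OF _ _ this]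
      show "(L2_norm (\<lambda>x. of_real (norm x) * \<Psi> s x - of_real (norm x) * \<Psi> t x))\<^sup>2 = sq_norm \<mu> (\<lambda>r. of_real r * f s r - of_real r * f t r)" by simp
    qed
    thus "((\<lambda>s. sq_norm \<mu> (\<lambda>r. of_real r * f s r - of_real r * f t r)) \<longlongrightarrow> 0) (at t within {0..<Tc})" by (simp add: I_def)
  next
    fix T assume "T < Tc"
    then obtain B where B: "\<And>t x. t \<in> {0..T} \<Longrightarrow> cmod (\<Psi> t x) \<le> B" using bnd by blast
    show "\<exists>B. \<forall>t\<in>{0..T}. \<forall>r>0. cmod (f t r) \<le> B"
      using fb[OF _ B] \<open>T < Tc\<close> by (intro exI[of _ B]) (auto simp: I_def)
  qed
  obtain C where C: "\<And>t. t \<in> I \<Longrightarrow> sq_norm \<mu> (\<lambda>r. of_real r * f t r) \<le> C"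
    using variance_bounded unfolding I_def by blast
  have "\<forall>t\<in>I. in_L2 (\<lambda>x. of_real (norm x) * \<Psi> t x) \<and> (L2_norm (\<lambda>x. of_real (norm x) * \<Psi> t x))\<^sup>2 \<le> C"
    using x\<Psi>_L2 C rf_n by auto
  thus ?thesis unfolding \<Psi>_def I_def by blast
qed

section \<open>The mass carried by the ring\<close>

text \<open>
  Volume of the shell as a difference of ball volumes, bounded below by the first-order term of
  the binomial expansion.
\<close>

lemma annulus_volume:
  assumes "0 \<le> s" "0 \<le> h"
  shows "real DIM('a) * unit_ball_vol DIM('a) * s ^ (DIM('a) - 1) * h \<le> measure lborel {x::'a::euclidean_space. s \<le> norm x \<and> norm x \<le> s + h}"
proof -
  let ?n = "DIM('a)"
  have n: "0 < ?n" by simp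
  have eq: "{x::'a. s \<le> norm x \<and> norm x \<le> s + h} = cball 0 (s + h) - ball 0 s" by auto
  have "measure lborel {x::'a. s \<le> norm x \<and> norm x \<le> s + h} = measure lborel (cball (0::'a) (s+h)) - measure lborel (ball (0::'a) s)"
    unfolding eq by (rule measure_Diff) (use assms emeasure_lborel_cball_finite[of "0::'a" "s+h"] in \<open>auto simp: less_top\<close>)
  also have "\<dots> = unit_ball_vol ?n * ((s + h) ^ ?n - s ^ ?n)"
    using assms content_cball[of "s+h" "0::'a"] content_ball[of s "0::'a"] by (simp add: algebra_simps)
  also have "\<dots> \<ge> unit_ball_vol ?n * (real ?n * s ^ (?n - 1) * h)"
  proof (rule mult_left_mono)
    have "s ^ m + real m * s ^ (m - 1) * h \<le> (s + h) ^ m" for m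
    proof (induction m)
      case (Suc m)
      have e: "real m * s ^ (m - 1) * s = real m * s ^ m" by (cases m) auto
      have "s ^ Suc m + real (Suc m) * s ^ m * h \<le> (s ^ m + real m * s ^ (m - 1) * h) * (s + h)"
      proof -
        have "(s ^ m + real m * s ^ (m - 1) * h) * (s + h) = s ^ Suc m + real (Suc m) * s ^ m * h + real m * s ^ (m - 1) * h * h"
          using e by (simp add: algebra_simps)
        moreover have "0 \<le> real m * s ^ (m - 1) * h * h" using assms by simp
        ultimately show ?thesis by linarith
      qed
      also have "\<dots> \<le> (s + h) ^ m * (s + h)" using Suc assms by (intro mult_right_mono) auto
      finally show ?case by (simp add: mult.commute)
    qed simp
    from this[of ?n] show "real ?n * s ^ (?n - 1) * h \<le> (s + h) ^ ?n - s ^ ?n" by linarith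
  qed simp
  finally show ?thesis by (simp add: mult_ac)
qed

lemma annulus_L2_lower_bound:
  fixes F :: "'a::euclidean_space \<Rightarrow> complex"
  assumes F: "in_L2 (\<lambda>x. of_real (norm x) * F x)" and s: "0 \<le> s" "0 \<le> h" and A: "0 \<le> A"
    and lower: "\<And>x. s \<le> norm x \<Longrightarrow> norm x \<le> s + h \<Longrightarrow> A \<le> cmod (F x)"
  shows "(s * A)\<^sup>2 * (real DIM('a) * unit_ball_vol DIM('a) * s ^ (DIM('a) - 1) * h) \<le> (L2_norm (\<lambda>x. of_real (norm x) * F x))\<^sup>2"
proof -
  let ?S = "{x::'a. s \<le> norm x \<and> norm x \<le> s + h}"
  have [measurable]: "?S \<in> sets borel" by measurable
  have fin: "emeasure lborel ?S < \<infinity>"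
  proof -
    have "emeasure lborel ?S \<le> emeasure lborel (cball (0::'a) (s + h))" by (rule emeasure_mono) auto
    thus ?thesis using emeasure_lborel_cball_finite[of "0::'a" "s+h"] by (rule le_less_trans)
  qed
  have "(s * A)\<^sup>2 * (real DIM('a) * unit_ball_vol DIM('a) * s ^ (DIM('a) - 1) * h) \<le> (s * A)\<^sup>2 * measure lborel ?S"
    by (intro mult_left_mono annulus_volume s) simp
  also have "\<dots> = (\<integral>x. (s * A)\<^sup>2 * indicator ?S x \<partial>lborel)" using fin by simp
  also have "\<dots> \<le> (\<integral>x. (cmod (of_real (norm x) * F x))\<^sup>2 \<partial>lborel)"
  proof (rule integral_mono)
    show "integrable lborel (\<lambda>x. (s * A)\<^sup>2 * indicator ?S x)" using fin by (intro integrable_mult_right integrable_real_indicator) auto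
    show "integrable lborel (\<lambda>x. (cmod (of_real (norm x) * F x))\<^sup>2)" using F by (simp add: in_L2_def)
    show "(s * A)\<^sup>2 * indicator ?S x \<le> (cmod (of_real (norm x) * F x))\<^sup>2" for x
    proof (cases "x \<in> ?S")
      case True
      hence "s * A \<le> norm x * cmod (F x)" using lower[of x] s A by (intro mult_mono) auto
      hence "(s * A)\<^sup>2 \<le> (norm x * cmod (F x))\<^sup>2" using s A by (intro power_mono) auto
      thus ?thesis using True by (simp add: norm_mult)
    qed simp
  qed
  finally show ?thesis by (simp add: L2_norm_def)
qed

text \<open>
  The modulus of \<open>psi_Q\<close> is $L^{-1/\sigma} |Q(\rho)|$, and $|Q| \ge |Q(0)|/2$ for
  small $\rho$ by continuity, where $Q(0) \ne 0$ because it is a maximum of the modulus. The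
  deviation of \<open>\<psi>\<close> from \<open>psi_Q\<close> is eventually at most
  $L^{-1/\sigma} |Q(0)|/4$.
\<close>

lemma ring_lower_bound:
  assumes ring: "ring_asymptotic d \<sigma> Tc \<psi> Q r0 L Lt" and Q: "admissible_profile Q"
    and L: "\<forall>\<^sub>F t in at_left Tc. 0 < L t" and r0: "0 < r0"
    and bdd: "\<forall>\<^sub>F t in at_left Tc. \<exists>B. \<forall>r\<ge>0. cmod (\<psi> t r) \<le> B"
  shows "\<exists>\<delta>>0. \<exists>m>0. \<forall>\<^sub>F t in at_left Tc. \<forall>r. ring_radius d \<sigma> r0 L t \<le> r \<and> r \<le> ring_radius d \<sigma> r0 L t + \<delta> * L t \<longrightarrow>
     m / L t powr (1 / \<sigma>) \<le> cmod (\<psi> t r)"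
proof -
  obtain \<rho>c where \<rho>c: "0 < \<rho>c" and lim: "((\<lambda>t. L t powr (1 / \<sigma>) *
          (SUP r \<in> {r. 0 \<le> r \<and> \<bar>r - ring_radius d \<sigma> r0 L t\<bar> \<le> \<rho>c * L t}.
             cmod (\<psi> t r - psi_Q d \<sigma> Q r0 L Lt t r))) \<longlongrightarrow> 0) (at_left Tc)"
    using ring unfolding ring_asymptotic_def by blast
  have Qc: "continuous_on UNIV Q" and Qm: "\<And>\<rho>. cmod (Q \<rho>) \<le> cmod (Q 0)" using Q by (auto simp: admissible_profile_def)
  obtain \<rho>1 where "Q \<rho>1 \<noteq> 0" using Q by (auto simp: admissible_profile_def)
  hence Q0: "0 < cmod (Q 0)" using Qm[of \<rho>1] by (meson less_le_trans zero_less_norm_iff)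
  define m where "m = cmod (Q 0) / 4"
  have m: "0 < m" using Q0 by (simp add: m_def)
  have "isCont Q 0" using Qc by (simp add: continuous_on_eq_continuous_at)
  then obtain d0 where d0: "0 < d0" "\<And>\<rho>. dist \<rho> 0 < d0 \<Longrightarrow> dist (Q \<rho>) (Q 0) < 2 * m"
    using m unfolding continuous_at_eps_delta by (metis mult_pos_pos zero_less_numeral)
  define \<delta> where "\<delta> = min \<rho>c (d0 / 2)"
  have \<delta>: "0 < \<delta>" "\<delta> \<le> \<rho>c" "\<delta> < d0" using \<rho>c d0 by (auto simp: \<delta>_def)
  have Ql: "2 * m \<le> cmod (Q \<rho>)" if "0 \<le> \<rho>" "\<rho> \<le> \<delta>" for \<rho>
  proof -
    have "dist (Q \<rho>) (Q 0) < 2 * m" by (rule d0(2)) (use that \<delta> in \<open>simp add: dist_real_def\<close>)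
    moreover have "cmod (Q 0) \<le> cmod (Q \<rho>) + dist (Q \<rho>) (Q 0)"
      using norm_triangle_ineq2[of "Q 0" "Q \<rho>"] by (simp add: dist_norm norm_minus_commute)
    ultimately show ?thesis by (simp add: m_def)
  qed
  have "\<forall>\<^sub>F t in at_left Tc. \<forall>r. ring_radius d \<sigma> r0 L t \<le> r \<and> r \<le> ring_radius d \<sigma> r0 L t + \<delta> * L t \<longrightarrow>
     m / L t powr (1 / \<sigma>) \<le> cmod (\<psi> t r)"
    using L bdd order_tendstoD(2)[OF lim m]
  proof eventually_elim
    case (elim t)
    let ?rm = "ring_radius d \<sigma> r0 L t"
    let ?S = "{r. 0 \<le> r \<and> \<bar>r - ?rm\<bar> \<le> \<rho>c * L t}"
    let ?D = "\<lambda>r. cmod (\<psi> t r - psi_Q d \<sigma> Q r0 L Lt t r)"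
    define l where "l = L t powr (1 / \<sigma>)"
    have l: "0 < l" using elim(1) by (simp add: l_def)
    have rm: "0 < ?rm" using r0 elim(1) by (simp add: ring_radius_def)
    have psiQ: "cmod (psi_Q d \<sigma> Q r0 L Lt t r) = cmod (Q ((r - ?rm) / L t)) / l" for r
    proof -
      have 1: "exp (\<i> * of_real x + \<i> * of_real y + \<i> * of_real z) = exp (\<i> * of_real (x + y + z))" for x y z :: real
        by (simp add: algebra_simps)
      show ?thesis
        unfolding psi_Q_def Let_def 1 norm_mult norm_exp_i_times using l by (simp add: l_def norm_divide)
    qed
    obtain B where B: "\<And>r. 0 \<le> r \<Longrightarrow> cmod (\<psi> t r) \<le> B" using elim(2) by blast
    have "bdd_above (?D ` ?S)"
    proof (rule bdd_aboveI2)
      fix r assume "r \<in> ?S"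
      hence "cmod (\<psi> t r) \<le> B" using B by simp
      moreover have "cmod (psi_Q d \<sigma> Q r0 L Lt t r) \<le> cmod (Q 0) / l"
        unfolding psiQ using Qm l by (intro divide_right_mono) auto
      ultimately show "?D r \<le> B + cmod (Q 0) / l"
        using norm_triangle_ineq4[of "\<psi> t r" "psi_Q d \<sigma> Q r0 L Lt t r"] by linarith
    qed
    \<comment> \<open>Boundedness of both profiles makes the supremum an upper bound.\<close>
    hence up: "?D r \<le> (SUP r\<in>?S. ?D r)" if "r \<in> ?S" for r using that by (intro cSUP_upper)
    show ?case
    proof (intro allI impI, elim conjE)
      fix r assume r: "?rm \<le> r" "r \<le> ?rm + \<delta> * L t"
      have "\<delta> * L t \<le> \<rho>c * L t" using \<delta> elim(1) by (intro mult_right_mono) auto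
      hence rS: "r \<in> ?S" using r rm by auto
      have "l * ?D r \<le> l * (SUP r\<in>?S. ?D r)" using up[OF rS] l by (intro mult_left_mono) auto
      hence "l * ?D r \<le> m" using elim(3) by (simp add: l_def)
      hence D: "?D r \<le> m / l" using l by (simp add: field_simps)
      have "2 * m \<le> cmod (Q ((r - ?rm) / L t))"
        by (rule Ql) (use r elim(1) in \<open>auto simp: field_simps\<close>)
      hence "2 * m / l \<le> cmod (psi_Q d \<sigma> Q r0 L Lt t r)" unfolding psiQ using l by (intro divide_right_mono) auto
      moreover have "cmod (psi_Q d \<sigma> Q r0 L Lt t r) \<le> cmod (\<psi> t r) + ?D r"
        using norm_triangle_ineq2[of "psi_Q d \<sigma> Q r0 L Lt t r" "\<psi> t r"] by (simp add: norm_minus_commute)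
      moreover have "2 * m / l = m / l + m / l" by simp
      ultimately show "m / L t powr (1 / \<sigma>) \<le> cmod (\<psi> t r)" using D unfolding l_def[symmetric] by linarith
    qed
  qed
  thus ?thesis using \<delta>(1) m by blast
qed

text \<open>
  This identity is what singles out \<open>ring_exponent\<close>.
\<close>

lemma ring_mass_scaling:
  assumes L: "0 < L" and d: "1 < d" and s: "\<sigma> \<noteq> 0"
  shows "(L powr ring_exponent d \<sigma>) ^ (d - 1) * L * (1 / L powr (1 / \<sigma>))\<^sup>2 = 1"
proof -
  have "(L powr ring_exponent d \<sigma>) ^ (d - 1) = L powr (ring_exponent d \<sigma> * real (d - 1))"
    using L by (simp add: powr_powr[symmetric] powr_realpow)
  also have "ring_exponent d \<sigma> * real (d - 1) = 2 / \<sigma> - 1"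
    using d s by (simp add: ring_exponent_def field_simps)
  finally have 1: "(L powr ring_exponent d \<sigma>) ^ (d - 1) = L powr (2 / \<sigma> - 1)" .
  have 2: "(1 / L powr (1 / \<sigma>))\<^sup>2 = L powr (- (2 / \<sigma>))"
    using L by (simp add: powr_minus powr_powr[symmetric] powr_realpow[symmetric] power_divide powr_powr inverse_eq_divide flip: powr_add)
  have 3: "L = L powr 1" using L by simp
  have "(L powr ring_exponent d \<sigma>) ^ (d - 1) * L * (1 / L powr (1 / \<sigma>))\<^sup>2 = L powr (2 / \<sigma> - 1) * L powr 1 * L powr (- (2 / \<sigma>))"
    unfolding 1 2 using L by simp
  also have "\<dots> = L powr (2 / \<sigma> - 1 + 1 + - (2 / \<sigma>))" by (simp only: powr_add)
  finally show ?thesis using L by simp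
qed

theorem lemma4:
  fixes \<sigma> :: real
  assumes "CARD('d::finite) > 1" and "\<sigma> > 2"
  shows "\<not> (\<exists>(\<psi> :: real \<Rightarrow> real \<Rightarrow> complex) Tc L L\<^sub>t L\<^sub>t\<^sub>t Q r\<^sub>0 \<kappa> p.
      radial_NLS_solution TYPE('d) \<sigma> Tc \<psi> \<and>
      singular_at Tc (radial_field \<psi> :: real \<Rightarrow> real ^ 'd \<Rightarrow> complex) \<and>
      C2_width Tc L L\<^sub>t L\<^sub>t\<^sub>t \<and> (L \<longlongrightarrow> 0) (at_left Tc) \<and>
      admissible_profile Q \<and> 0 < r\<^sub>0 \<and>
      ring_asymptotic CARD('d) \<sigma> Tc \<psi> Q r\<^sub>0 L L\<^sub>t \<and>
      0 < \<kappa> \<and>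
      ((\<lambda>t. L t / (Tc - t) powr p) \<longlongrightarrow> \<kappa>) (at_left Tc) \<and>
      ((\<lambda>t. L\<^sub>t t / (Tc - t) powr (p - 1)) \<longlongrightarrow> - p * \<kappa>) (at_left Tc) \<and>
      ((\<lambda>t. L\<^sub>t\<^sub>t t / (Tc - t) powr (p - 2)) \<longlongrightarrow> p * (p - 1) * \<kappa>) (at_left Tc))"
proof (rule notI, elim exE conjE)
  fix \<psi> :: "real \<Rightarrow> real \<Rightarrow> complex" and Tc L L\<^sub>t L\<^sub>t\<^sub>t Q r\<^sub>0 and \<kappa> p :: real
  assume sol: "radial_NLS_solution TYPE('d) \<sigma> Tc \<psi>"
    and sing: "singular_at Tc (radial_field \<psi> :: real \<Rightarrow> real ^ 'd \<Rightarrow> complex)"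
    and width: "C2_width Tc L L\<^sub>t L\<^sub>t\<^sub>t" and L0: "(L \<longlongrightarrow> 0) (at_left Tc)"
    and Q: "admissible_profile Q" and r0: "0 < r\<^sub>0"
    and ring: "ring_asymptotic CARD('d) \<sigma> Tc \<psi> Q r\<^sub>0 L L\<^sub>t"
  let ?d = "CARD('d)"
  let ?\<alpha> = "ring_exponent ?d \<sigma>"
  let ?rm = "ring_radius ?d \<sigma> r\<^sub>0 L"
  have Tc: "0 < Tc" using sing by (simp add: singular_at_def)
  have evI: "\<forall>\<^sub>F t in at_left Tc. t \<in> {0..<Tc}"
    using eventually_at_left_real[OF Tc] by eventually_elim auto
  have Lpos: "\<forall>\<^sub>F t in at_left Tc. 0 < L t"
    using evI by eventually_elim (use width in \<open>auto simp: C2_width_def\<close>)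
  have \<alpha>: "?\<alpha> < 0" using assms by (auto simp: ring_exponent_def intro!: divide_neg_pos mult_pos_pos)
  have s0: "0 < \<sigma>" using assms(2) by simp
  have super: "2 \<le> \<sigma> * real ?d"
  proof -
    have "2 * 1 \<le> \<sigma> * real ?d" using assms by (intro mult_mono) auto
    thus ?thesis by simp
  qed
  obtain C where C: "\<And>t. t \<in> {0..<Tc} \<Longrightarrow> in_L2 (\<lambda>x::real^'d. of_real (norm x) * radial_field \<psi> t x)"
      "\<And>t. t \<in> {0..<Tc} \<Longrightarrow> (L2_norm (\<lambda>x::real^'d. of_real (norm x) * radial_field \<psi> t x))\<^sup>2 \<le> C"
    using radial_NLS_variance_bounded[OF assms(1) s0 super Tc sol] by blast
  have bdd: "\<forall>\<^sub>F t in at_left Tc. \<exists>B. \<forall>r\<ge>0. cmod (\<psi> t r) \<le> B"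
    using evI
  proof eventually_elim
    case (elim t)
    have "\<exists>B. \<forall>s\<in>{0..t}. \<forall>x::real^'d. cmod (radial_field \<psi> s x) \<le> B"
      using sol elim unfolding radial_NLS_solution_def Let_def by auto
    then obtain B where "\<forall>s\<in>{0..t}. \<forall>x::real^'d. cmod (radial_field \<psi> s x) \<le> B" by blast
    hence B: "\<And>x::real^'d. cmod (radial_field \<psi> t x) \<le> B" using elim by auto
    have "cmod (\<psi> t r) \<le> B" if "0 \<le> r" for r
      using B[of "r *\<^sub>R axis undefined 1"] that by (simp add: radial_field_def)
    thus ?case by blast
  qed
  obtain \<delta> m where \<delta>: "0 < \<delta>" and m: "0 < m" and low: "\<forall>\<^sub>F t in at_left Tc. \<forall>r. ?rm t \<le> r \<and> r \<le> ?rm t + \<delta> * L t \<longrightarrow>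
     m / L t powr (1 / \<sigma>) \<le> cmod (\<psi> t r)"
    using ring_lower_bound[OF ring Q Lpos r0 bdd] by blast
  define K where "K = m\<^sup>2 * (real ?d * unit_ball_vol ?d * r\<^sub>0 ^ (?d - 1) * \<delta>)"
  have K: "0 < K" unfolding K_def using m \<delta> r0 by (intro mult_pos_pos) auto
  have main: "\<forall>\<^sub>F t in at_left Tc. K * (?rm t)\<^sup>2 \<le> C"
    using evI Lpos low
  proof eventually_elim
    case (elim t)
    have rm: "0 < ?rm t" using r0 elim(2) by (simp add: ring_radius_def)
    have "(?rm t * (m / L t powr (1 / \<sigma>)))\<^sup>2 * (real DIM(real^'d) * unit_ball_vol DIM(real^'d) * ?rm t ^ (DIM(real^'d) - 1) * (\<delta> * L t))
       \<le> (L2_norm (\<lambda>x::real^'d. of_real (norm x) * radial_field \<psi> t x))\<^sup>2"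
      by (rule annulus_L2_lower_bound[OF C(1)[OF elim(1)]])
         (use elim(2,3) \<delta> m rm in \<open>auto simp: radial_field_def\<close>)
    also have "\<dots> \<le> C" by (rule C(2)[OF elim(1)])
    also have "(?rm t * (m / L t powr (1 / \<sigma>)))\<^sup>2 * (real DIM(real^'d) * unit_ball_vol DIM(real^'d) * ?rm t ^ (DIM(real^'d) - 1) * (\<delta> * L t))
       = K * (?rm t)\<^sup>2 * ((L t powr ?\<alpha>) ^ (?d - 1) * L t * (1 / L t powr (1 / \<sigma>))\<^sup>2)"
      by (simp add: K_def ring_radius_def power_mult_distrib power_divide mult_ac)
    also have "\<dots> = K * (?rm t)\<^sup>2" using ring_mass_scaling[OF elim(2) assms(1), of \<sigma>] assms(2) by simp
    finally show ?case .
  qed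
  have "filterlim (\<lambda>t. inverse (L t powr (- ?\<alpha>))) at_top (at_left Tc)"
  proof (rule filterlim_inverse_at_top)
    show "((\<lambda>t. L t powr (- ?\<alpha>)) \<longlongrightarrow> 0) (at_left Tc)"
    proof -
      have "\<forall>\<^sub>F t in at_left Tc. 0 \<le> L t" using Lpos by eventually_elim simp
      hence "((\<lambda>t. L t powr (- ?\<alpha>)) \<longlongrightarrow> 0 powr (- ?\<alpha>)) (at_left Tc)"
        using \<alpha> by (intro tendsto_powr'[OF L0 tendsto_const]) auto
      thus ?thesis by simp
    qed
    show "\<forall>\<^sub>F t in at_left Tc. 0 < L t powr (- ?\<alpha>)" using Lpos by eventually_elim simp
  qed
  hence "\<forall>\<^sub>F t in at_left Tc. max 1 ((\<bar>C\<bar> + 1) / (K * r\<^sub>0\<^sup>2)) \<le> inverse (L t powr (- ?\<alpha>))"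
    unfolding filterlim_at_top by blast
  with main have "\<forall>\<^sub>F t in at_left Tc. False"
  proof eventually_elim
    case (elim t)
    define y where "y = L t powr ?\<alpha>"
    have y: "1 \<le> y" "(\<bar>C\<bar> + 1) / (K * r\<^sub>0\<^sup>2) \<le> y" using elim(2) by (auto simp: y_def powr_minus)
    have "y * 1 \<le> y * y" using y(1) by (intro mult_left_mono) auto
    hence "(\<bar>C\<bar> + 1) / (K * r\<^sub>0\<^sup>2) \<le> y\<^sup>2" using y(2) by (simp add: power2_eq_square)
    moreover have "0 < K * r\<^sub>0\<^sup>2" using K r0 by simp
    ultimately have "\<bar>C\<bar> + 1 \<le> y\<^sup>2 * (K * r\<^sub>0\<^sup>2)" by (simp only: pos_divide_le_eq)
    also have "\<dots> = K * (?rm t)\<^sup>2" by (simp add: y_def ring_radius_def power_mult_distrib)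
    also have "\<dots> \<le> C" by (rule elim(1))
    finally show False by linarith
  qed
  thus False by (simp add: trivial_limit_at_left_real eventually_False)
qed

end
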